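(* Let $\mathbb{D}$ be a division ring with finite dimension $d$ over a central subfield $\mathbb{F}$, and let $n\geq 1$ be an integer with $|\mathbb{F}|\geq nd$. Assume that $\mathbb{D}$ is not of quadratic type over $\mathbb{F}$. Then the algebra $\mathrm{M}_n(\mathbb{D})$ contains an irreducible optimal trivial spectrum subspace only if $n=1$.
   Context: A central subfield of $\mathbb{D}$ is a subfield contained in the center of $\mathbb{D}$. An $\mathbb{F}$-linear subspace $S$ of $\mathrm{M}_n(\mathbb{D})$ has trivial spectrum if $I_n-M$ is invertible for all $M\in S$; it is optimal if it has the greatest possible dimension over $\mathbb{F}$ among all trivial spectrum $\mathbb{F}$-linear subspaces of $\mathrm{M}_n(\mathbb{D})$. Matrices of $\mathrm{M}_n(\mathbb{D})$ act on the right $\mathbb{D}$-vector space $\mathbb{D}^n$ of columns by left multiplication; a subset of $\mathrm{M}_n(\mathbb{D})$ is irreducible if the only $\mathbb{D}$-linear subspaces of $\mathbb{D}^n$ invariant under all its elements are $\{0\}$ and $\mathbb{D}^n$ (with $n\geq 1$). $\mathbb{D}$ is of quadratic type over $\mathbb{F}$ if one of the following holds: (i) $d=1$; (ii) $d=2$ and $\mathbb{D}$ is a separable field extension of $\mathbb{F}$; (iii) $d=4$ and $\mathbb{D}$ is a quaternion algebra over $\mathbb{F}$; (iv) $d=2^m$ for some $m\geq 1$, $\operatorname{char}(\mathbb{F})=2$, $\mathbb{D}$ is a field and $x^2\in\mathbb{F}$ for all $x\in\mathbb{D}$. *)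

theory Defs
  imports
    "Jordan_Normal_Form.VS_Connect"
    "HOL-Algebra.Finite_Extensions"
begin

text \<open>The division ring is a type \<open>'a\<close> of class \<^class>\<open>division_ring\<close> (commutativity is not
  assumed), and \<open>class_ring\<close> is its HOL-Algebra record.  The subfield is a set \<open>F :: 'a set\<close>.\<close>

definition central_subfield :: "'a::division_ring set \<Rightarrow> bool" where
  "central_subfield F \<longleftrightarrow> subfield F class_ring \<and> (\<forall>a\<in>F. \<forall>x. a * x = x * a)"

definition subfield_ring :: "'a::division_ring set \<Rightarrow> 'a ring" where
  "subfield_ring F = class_ring\<lparr>carrier := F\<rparr>"

text \<open>The additive group of \<open>'a\<close> with scalar action by left multiplication; restricting the
  scalars to \<open>subfield_ring F\<close> makes it an \<open>F\<close>-vector space.\<close>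

definition self_module :: "('a::division_ring, 'a) module" where
  "self_module = \<lparr>carrier = UNIV, monoid.mult = (*), one = 1, zero = 0, add = (+), smult = (*)\<rparr>"

definition finite_degree :: "'a::division_ring set \<Rightarrow> bool" where
  "finite_degree F \<longleftrightarrow> vectorspace.fin_dim (subfield_ring F) self_module"

definition degree_over :: "'a::division_ring set \<Rightarrow> nat" where
  "degree_over F = vectorspace.dim (subfield_ring F) self_module"


text \<open>A polynomial of HOL-Algebra is the list of its coefficients, leading coefficient first.\<close>

definition formal_derivative :: "'a::division_ring list \<Rightarrow> 'a list" where
  "formal_derivative p =
     ring.normalize class_ring
       (map (\<lambda>i. of_nat i * ring.coeff class_ring p i) (rev [1..<length p]))"

definition separable_poly :: "'a::division_ring set \<Rightarrow> 'a list \<Rightarrow> bool" where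
  "separable_poly F p \<longleftrightarrow>
     (\<forall>q \<in> carrier (F[X]\<^bsub>class_ring\<^esub>).
        q divides\<^bsub>F[X]\<^bsub>class_ring\<^esub>\<^esub> p \<and> q divides\<^bsub>F[X]\<^bsub>class_ring\<^esub>\<^esub> formal_derivative p
        \<longrightarrow> q \<in> Units (F[X]\<^bsub>class_ring\<^esub>))"

text \<open>\<open>ring.Irr class_ring F x\<close> is the minimal polynomial of \<open>x\<close> over \<open>F\<close>.\<close>

definition separable_field_extension :: "'a::division_ring set \<Rightarrow> bool" where
  "separable_field_extension F \<longleftrightarrow>
     (\<forall>x y :: 'a. x * y = y * x) \<and> (\<forall>x. separable_poly F (ring.Irr class_ring F x))"

text \<open>Quaternion algebra in the characteristic-free sense: a central simple algebra of
  dimension 4.\<close>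

definition quaternion_algebra :: "'a::division_ring set \<Rightarrow> bool" where
  "quaternion_algebra F \<longleftrightarrow>
     degree_over F = 4 \<and>
     {z. \<forall>x. z * x = x * z} = F \<and>
     (\<forall>I. ideal I (class_ring :: 'a ring) \<longrightarrow> I = {0} \<or> I = UNIV)"

text \<open>\<open>CHAR('a)\<close> is also the characteristic of \<open>F\<close>, which contains \<open>1\<close>.\<close>

definition quadratic_type :: "'a::division_ring set \<Rightarrow> bool" where
  "quadratic_type F \<longleftrightarrow>
     degree_over F = 1 \<or>
     degree_over F = 2 \<and> separable_field_extension F \<or>
     degree_over F = 4 \<and> quaternion_algebra F \<or>
     (\<exists>m\<ge>1. degree_over F = 2 ^ m) \<and> CHAR('a) = 2 \<and>
       (\<forall>x y :: 'a. x * y = y * x) \<and> (\<forall>x::'a. x^2 \<in> F)"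


definition mat_subspace :: "'a::division_ring set \<Rightarrow> nat \<Rightarrow> 'a mat set \<Rightarrow> bool" where
  "mat_subspace F n S \<longleftrightarrow> VectorSpace.subspace (subfield_ring F) S (module_mat TYPE('a) n n)"

definition mat_dim :: "'a::division_ring set \<Rightarrow> nat \<Rightarrow> 'a mat set \<Rightarrow> nat" where
  "mat_dim F n S =
     vectorspace.dim (subfield_ring F) ((module_mat TYPE('a) n n)\<lparr>carrier := S\<rparr>)"

definition trivial_spectrum_subspace ::
    "'a::division_ring set \<Rightarrow> nat \<Rightarrow> 'a mat set \<Rightarrow> bool" where
  "trivial_spectrum_subspace F n S \<longleftrightarrow>
     mat_subspace F n S \<and> (\<forall>M\<in>S. invertible_mat (1\<^sub>m n - M))"

definition optimal_trivial_spectrum_subspace ::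
    "'a::division_ring set \<Rightarrow> nat \<Rightarrow> 'a mat set \<Rightarrow> bool" where
  "optimal_trivial_spectrum_subspace F n S \<longleftrightarrow>
     trivial_spectrum_subspace F n S \<and>
     (\<forall>T. trivial_spectrum_subspace F n T \<longrightarrow> mat_dim F n T \<le> mat_dim F n S)"

text \<open>Columns form a right vector space, so scalars multiply the entries on the right; the
  library's \<open>\<cdot>\<^sub>v\<close> multiplies on the left.\<close>

definition right_subspace :: "nat \<Rightarrow> 'a::division_ring vec set \<Rightarrow> bool" where
  "right_subspace n W \<longleftrightarrow>
     W \<subseteq> carrier_vec n \<and> 0\<^sub>v n \<in> W \<and>
     (\<forall>v\<in>W. \<forall>w\<in>W. v + w \<in> W) \<and>
     (\<forall>v\<in>W. \<forall>a. map_vec (\<lambda>x. x * a) v \<in> W)"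

definition irreducible_mats :: "nat \<Rightarrow> 'a::division_ring mat set \<Rightarrow> bool" where
  "irreducible_mats n S \<longleftrightarrow>
     (\<forall>W. right_subspace n W \<and> (\<forall>M\<in>S. \<forall>w\<in>W. M *\<^sub>v w \<in> W)
        \<longrightarrow> W = {0\<^sub>v n} \<or> W = carrier_vec n)"

end

theory Submission
  imports Defs "HOL-Library.Function_Algebras"
begin

text \<open>Let \<open>S\<close> be a trivial spectrum space on \<open>V = D\<^sup>n\<close> and pick \<open>x\<close> with \<open>dim S x\<close> maximal.  Atkinson's lemma
  says that \<open>N x = 0\<close> implies \<open>N V \<subseteq> S x\<close>; as \<open>S x\<close> meets \<open>x D\<close> in a proper \<open>F\<close>-subspace, induction on a
  \<open>D\<close>-hyperplane gives \<open>dim S \<le> (\<Sum>k=1..n. k d - 1)\<close>.  Upper triangular matrices with diagonal entries in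
  an \<open>F\<close>-hyperplane avoiding \<open>1\<close> show that optimal spaces attain this bound.  Equality forces \<open>S x\<close> to be
  an \<open>F\<close>-hyperplane containing a \<open>D\<close>-hyperplane \<open>C\<close> complementary to \<open>x D\<close>, and the elements of \<open>S\<close>
  killing \<open>x\<close> act on \<open>C\<close> as an optimal space, so by induction they leave a hyperplane \<open>U\<close> of \<open>C\<close> invariant.
  The 2 by 2 corner of \<open>V = x D \<oplus> y D \<oplus> U\<close> then yields either a nonzero \<open>F\<close>-linear map \<open>J\<close> on \<open>D\<close> with
  \<open>J z z \<in> F\<close> for all \<open>z\<close>, or the invariance of \<open>C\<close> under \<open>S\<close>.  In the first case every element of \<open>D\<close> is
  quadratic over \<open>F\<close>, and such division rings are exactly those of quadratic type.\<close>

section \<open>Linear algebra over a central subfield\<close>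

text \<open>\<open>S\<close> is only \<open>F\<close>-linear while its elements are right
  \<open>D\<close>-linear, so all counting is done with \<open>F\<close>-dimensions of the value
  spaces \<open>S x\<close>. The size of \<open>F\<close> enters twice: Atkinson's lemma needs one
  more element of \<open>F\<close> than \<open>dim S x\<close>, which is less than
  \<open>n * d\<close>, and the corner argument needs a scalar other than 0 and 1, to separate terms
  of different degree when elements of \<open>S\<close> are rescaled.

  The map \<open>J\<close> arises as follows. Eliminating the \<open>x\<close>-coordinate from the
  equation of a fixed vector leaves a Schur complement of the corner, containing
  \<open>inverse (1 - a)\<close>. A substitution makes it polynomial, and comparing coefficients
  yields \<open>lam (z * beta c) = mu (J z * c)\<close>, where \<open>beta\<close> describes how the
  lower left entry of an element of \<open>S\<close> influences the upper right one. So
  \<open>J\<close> is an adjoint of \<open>beta\<close>, and if it vanishes the upper right entry is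
  0, which is the invariance of \<open>C\<close>. A nonzero \<open>J\<close> forces quadratic
  equations because polarising \<open>J z * z\<close> puts \<open>J z + J 1 * z\<close> into
  \<open>F\<close>, and this can be multiplied by \<open>z\<close>.\<close>

locale central =
  fixes F :: "'a::division_ring set"
  assumes central_F: "central_subfield F"
begin

lemma subfield_F: "subfield F (class_ring :: 'a ring)"
  using central_F by (simp add: central_subfield_def)

lemma F_comm: "f \<in> F \<Longrightarrow> f * x = x * f"
  using central_F by (auto simp: central_subfield_def)

lemma F_0 [simp, intro]: "0 \<in> F" and F_1 [simp, intro]: "1 \<in> F"
  and F_add [intro]: "a \<in> F \<Longrightarrow> b \<in> F \<Longrightarrow> a + b \<in> F"
  and F_mult [intro]: "a \<in> F \<Longrightarrow> b \<in> F \<Longrightarrow> a * b \<in> F"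
  and F_minus [intro]: "a \<in> F \<Longrightarrow> - a \<in> F"
  using subringE(2,3,5,6,7)[OF subfieldE(1)[OF subfield_F]]
  by (auto simp: class_ring_simps)

lemma F_diff [intro]: "a \<in> F \<Longrightarrow> b \<in> F \<Longrightarrow> a - b \<in> F"
  using F_add[of a "- b"] F_minus by simp

lemma F_inverse [intro]:
  assumes "a \<in> F" shows "inverse a \<in> F"
proof (cases "a = 0")
  case False
  then have "a \<in> Units (class_ring\<lparr>carrier := F\<rparr>)"
    using assms subfield.subfield_Units[OF subfield_F] by auto
  then obtain b where "b \<in> F" "b * a = 1" by (auto simp: Units_def)
  then show ?thesis by (metis inverse_unique left_inverse mult.assoc mult_1_left mult_1_right right_inverse False)
qed simp

lemma field_F: "field (subfield_ring F)"
proof -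
  have "\<exists>y\<in>F. x + y = 0" if "x \<in> F" for x
    using that F_minus by (intro bexI[of _ "- x"]) auto
  moreover have "\<exists>y\<in>F. y * x = 1 \<and> x * y = 1" if "x \<in> F" "x \<noteq> 0" for x
    using that F_inverse by (intro bexI[of _ "inverse x"]) auto
  ultimately show ?thesis
    unfolding subfield_ring_def
    by unfold_locales (auto simp: Units_def algebra_simps F_comm)
qed

end

text \<open>Subspaces are plain sets and the scalar action is a parameter, because the same type carries
  several actions below; \<open>frec\<close> makes the linear algebra of \<^locale>\<open>vectorspace\<close> available for them.\<close>

definition frec :: "('a \<Rightarrow> 'b \<Rightarrow> 'b) \<Rightarrow> 'b::ab_group_add set \<Rightarrow> ('a, 'b) module" where
  "frec sc W = \<lparr>carrier = W, monoid.mult = undefined, one = undefined, zero = 0, add = (+), smult = sc\<rparr>"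

definition fsub :: "'a set \<Rightarrow> ('a \<Rightarrow> 'b \<Rightarrow> 'b) \<Rightarrow> 'b::ab_group_add set \<Rightarrow> bool" where
  "fsub F sc W \<longleftrightarrow> 0 \<in> W \<and> (\<forall>u\<in>W. \<forall>v\<in>W. u + v \<in> W) \<and> (\<forall>k\<in>F. \<forall>v\<in>W. sc k v \<in> W)"

definition fdim :: "'a::division_ring set \<Rightarrow> ('a \<Rightarrow> 'b \<Rightarrow> 'b) \<Rightarrow> 'b::ab_group_add set \<Rightarrow> nat" where
  "fdim F sc W = vectorspace.dim (subfield_ring F) (frec sc W)"

definition ffin :: "'a::division_ring set \<Rightarrow> ('a \<Rightarrow> 'b \<Rightarrow> 'b) \<Rightarrow> 'b::ab_group_add set \<Rightarrow> bool" where
  "ffin F sc W \<longleftrightarrow> vectorspace.fin_dim (subfield_ring F) (frec sc W)"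

definition flin :: "'a set \<Rightarrow> ('a \<Rightarrow> 'b \<Rightarrow> 'b) \<Rightarrow> ('a \<Rightarrow> 'c \<Rightarrow> 'c) \<Rightarrow> 'b::ab_group_add set \<Rightarrow> ('b \<Rightarrow> 'c::ab_group_add) \<Rightarrow> bool" where
  "flin F sc sc' W g \<longleftrightarrow> (\<forall>u\<in>W. \<forall>v\<in>W. g (u + v) = g u + g v) \<and> (\<forall>k\<in>F. \<forall>v\<in>W. g (sc k v) = sc' k (g v))"

lemma fsubI: "0 \<in> W \<Longrightarrow> (\<And>u v. u \<in> W \<Longrightarrow> v \<in> W \<Longrightarrow> u + v \<in> W) \<Longrightarrow>
    (\<And>k v. k \<in> F \<Longrightarrow> v \<in> W \<Longrightarrow> sc k v \<in> W) \<Longrightarrow> fsub F sc W"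
  by (simp add: fsub_def)

lemma fsub_0: "fsub F sc W \<Longrightarrow> 0 \<in> W"
  and fsub_add: "fsub F sc W \<Longrightarrow> u \<in> W \<Longrightarrow> v \<in> W \<Longrightarrow> u + v \<in> W"
  and fsub_sc: "fsub F sc W \<Longrightarrow> k \<in> F \<Longrightarrow> v \<in> W \<Longrightarrow> sc k v \<in> W"
  by (simp_all add: fsub_def)

lemma flinI: "(\<And>u v. u \<in> W \<Longrightarrow> v \<in> W \<Longrightarrow> g (u + v) = g u + g v) \<Longrightarrow>
    (\<And>k v. k \<in> F \<Longrightarrow> v \<in> W \<Longrightarrow> g (sc k v) = sc' k (g v)) \<Longrightarrow> flin F sc sc' W g"
  by (simp add: flin_def)

lemma flin_add: "flin F sc sc' W g \<Longrightarrow> u \<in> W \<Longrightarrow> v \<in> W \<Longrightarrow> g (u + v) = g u + g v"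
  and flin_sc: "flin F sc sc' W g \<Longrightarrow> k \<in> F \<Longrightarrow> v \<in> W \<Longrightarrow> g (sc k v) = sc' k (g v)"
  by (simp_all add: flin_def)

lemma flin_subset: "flin F sc sc' W g \<Longrightarrow> U \<subseteq> W \<Longrightarrow> flin F sc sc' U g"
  by (auto simp: flin_def subset_iff)

locale fspace = central F for F :: "'a::division_ring set" +
  fixes sc :: "'a \<Rightarrow> 'b::ab_group_add \<Rightarrow> 'b"
  assumes sc_add_right: "k \<in> F \<Longrightarrow> sc k (u + v) = sc k u + sc k v"
    and sc_add_left: "k \<in> F \<Longrightarrow> l \<in> F \<Longrightarrow> sc (k + l) v = sc k v + sc l v"
    and sc_mult: "k \<in> F \<Longrightarrow> l \<in> F \<Longrightarrow> sc (k * l) v = sc k (sc l v)"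
    and sc_1 [simp]: "sc 1 v = v"
begin

lemma sc_0 [simp]: "sc 0 v = 0"
  using sc_add_left[of 0 0 v] by simp

lemma sc_0_right [simp]: "k \<in> F \<Longrightarrow> sc k 0 = 0"
  using sc_add_right[of k 0 0] by simp

lemma sc_minus_left: "k \<in> F \<Longrightarrow> sc (- k) v = - sc k v"
  using sc_add_left[of k "- k" v] F_minus by (simp add: minus_unique)

lemma sc_diff_left: "k \<in> F \<Longrightarrow> l \<in> F \<Longrightarrow> sc (k - l) v = sc k v - sc l v"
  using sc_add_left[of k "- l" v] by (simp add: sc_minus_left F_minus)

lemma sc_cancel: "k \<in> F \<Longrightarrow> k \<noteq> 0 \<Longrightarrow> sc (inverse k) (sc k v) = v"
  using sc_mult[of "inverse k" k v] by (auto simp: F_inverse)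

abbreviation vsub where "vsub \<equiv> fsub F sc"
abbreviation vdim where "vdim \<equiv> fdim F sc"
abbreviation vfin where "vfin \<equiv> ffin F sc"

lemma sub_UNIV [simp]: "vsub UNIV" and sub_zero [simp]: "vsub {0}"
  by (auto simp: fsub_def)

lemma sub_minus: "vsub W \<Longrightarrow> v \<in> W \<Longrightarrow> - v \<in> W"
  using fsub_sc[of F sc W "- 1" v] F_minus[of 1] sc_minus_left[of 1] by simp

lemma sub_diff: "vsub W \<Longrightarrow> u \<in> W \<Longrightarrow> v \<in> W \<Longrightarrow> u - v \<in> W"
  using fsub_add[of F sc W u "- v"] sub_minus by simp

lemma sub_Int: "vsub U \<Longrightarrow> vsub W \<Longrightarrow> vsub (U \<inter> W)"
  by (auto simp: fsub_def)

lemma vectorspace_frec: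
  assumes "vsub W" shows "vectorspace (subfield_ring F) (frec sc W)"
proof -
  have K: "cring (subfield_ring F)" using field_F by (simp add: field_def domain_def)
  have "\<exists>n\<in>W. v + n = 0" if "v \<in> W" for v
    using that sub_minus[OF assms] by (intro bexI[of _ "- v"]) auto
  then have "Module.module (subfield_ring F) (frec sc W)"
    using assms
    by (intro module_criteria K)
       (auto simp: frec_def fsub_def subfield_ring_def sc_add_right sc_add_left sc_mult algebra_simps)
  then show ?thesis by (simp add: vectorspace_def field_F)
qed

lemma subspace_frec:
  assumes "vsub W" "vsub U" "U \<subseteq> W" shows "VectorSpace.subspace (subfield_ring F) U (frec sc W)"
  using assms vectorspace_frec[OF assms(1)]
  by (auto simp: VectorSpace.subspace_def submodule_def vectorspace_def fsub_def)
    (auto simp: frec_def subfield_ring_def)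

lemma frec_carrier [simp]: "(frec sc W)\<lparr>carrier := U\<rparr> = frec sc U"
  by (simp add: frec_def)

lemma carrier_frec [simp]: "carrier (frec sc W) = W"
  by (simp add: frec_def)

text \<open>Independence does not depend on the ambient space, so independent subsets of
  \<open>U\<close> have at most \<open>dim W\<close> elements and a maximal one is a basis of
  \<open>U\<close>; with \<open>dim W\<close> elements it is already a basis of
  \<open>W\<close>.\<close>

lemma fin_subset:
  assumes "vsub W" "vsub U" "U \<subseteq> W" "vfin W"
  shows "vfin U" "vdim U \<le> vdim W" "vdim U = vdim W \<Longrightarrow> U = W"
proof -
  interpret W: vectorspace "subfield_ring F" "frec sc W" by (rule vectorspace_frec[OF assms(1)])
  interpret U: vectorspace "subfield_ring F" "frec sc U" by (rule vectorspace_frec[OF assms(2)])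
  have sm: "submodule (subfield_ring F) U (frec sc W)"
    using subspace_frec[OF assms(1-3)] by (simp add: VectorSpace.subspace_def)
  have fW: "W.fin_dim" using assms(4) by (simp add: ffin_def)
  have li: "W.lin_indpt A" if "U.lin_indpt A" "A \<subseteq> U" for A
    using W.span_li_not_depend(2)[OF that(2) sm] that by simp
  have bd: "finite A \<and> card A \<le> W.dim" if "A \<subseteq> carrier (frec sc U) \<and> U.lin_indpt A" for A
    using W.li_le_dim[OF fW, of A] li[of A] that assms(3) by auto
  obtain A where A: "maximal A (\<lambda>S. S \<subseteq> carrier (frec sc U) \<and> U.lin_indpt S)" "finite A"
    using maximal_exists[of "\<lambda>S. S \<subseteq> carrier (frec sc U) \<and> U.lin_indpt S" W.dim "{}"] bd
      U.finite_lin_indpt2[of "{}"] by auto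
  have bA: "U.basis A" by (rule U.max_li_is_basis[OF A(1)])
  then have "U.fin_dim" using A(2) by (auto simp: U.fin_dim_def U.basis_def)
  then show "vfin U" by (simp add: ffin_def)
  have dU: "U.dim = card A" using U.dim_basis[OF A(2) bA] .
  show "vdim U \<le> vdim W"
    using bd[of A] bA dU by (simp add: fdim_def U.basis_def)
  assume "vdim U = vdim W"
  then have "W.basis A"
    using li[of A] bA assms(3) dU
    by (intro W.dim_li_is_basis[OF fW A(2)]) (auto simp: fdim_def U.basis_def)
  then have "W = W.span A" by (simp add: W.basis_def)
  also have "\<dots> = U.span A" using W.span_li_not_depend(1)[OF _ sm, of A] bA by (simp add: U.basis_def)
  finally show "U = W" using bA by (simp add: U.basis_def)
qed

lemma dim_zero [simp]: "vdim {0} = 0" and fin_zero [simp]: "vfin {0}"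
proof -
  interpret U: vectorspace "subfield_ring F" "frec sc {0}" by (rule vectorspace_frec) simp
  have g: "U.gen_set {}" using U.span_empty by (auto simp: frec_def)
  then have "U.basis {}" using U.finite_lin_indpt2[of "{}"] by (auto simp: U.basis_def)
  then show "vdim {0} = 0" using U.dim_basis[of "{}"] by (auto simp: fdim_def)
  show "vfin {0}" using g by (auto simp: ffin_def U.fin_dim_def)
qed

lemma dim_eq_0: "vsub W \<Longrightarrow> vfin W \<Longrightarrow> vdim W = 0 \<Longrightarrow> W = {0}"
  using fin_subset(3)[of W "{0}"] by (auto simp: fsub_def)

text \<open>Generation is phrased through the subspaces containing \<open>A\<close>, so that later
  arguments can use intersections and kernels instead of linear combinations.\<close>

lemma fin_iff:
  assumes "vsub W"
  shows "vfin W \<longleftrightarrow> (\<exists>A. finite A \<and> A \<subseteq> W \<and> (\<forall>U. vsub U \<longrightarrow> A \<subseteq> U \<longrightarrow> W \<subseteq> U))"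
proof -
  interpret W: vectorspace "subfield_ring F" "frec sc W" by (rule vectorspace_frec[OF assms(1)])
  have 1: "W \<subseteq> U" if "finite A" "A \<subseteq> W" "W.span A = W" "vsub U" "A \<subseteq> U" for A U
  proof -
    have "W.span A \<subseteq> U \<inter> W"
      using subspace_frec[OF assms sub_Int[OF that(4) assms]] that(2,5)
      by (intro W.span_is_subset) (auto simp: VectorSpace.subspace_def)
    then show ?thesis using that(3) by simp
  qed
  have 2: "W.span A = W" if "finite A" "A \<subseteq> W" and *: "\<And>U. vsub U \<Longrightarrow> A \<subseteq> U \<Longrightarrow> W \<subseteq> U" for A
  proof -
    have sm: "submodule (subfield_ring F) (W.span A) (frec sc W)"
      using W.span_is_submodule[of A] that(2) by simp
    have "vsub (W.span A)"
      using submodule.m_closed[OF sm] submodule.zero_closed[OF sm] submodule.smult_closed[OF sm]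
      unfolding fsub_def by (simp add: frec_def subfield_ring_def)
    then have "W \<subseteq> W.span A" using * W.in_own_span[of A] that(2) by (metis carrier_frec)
    then show ?thesis using W.span_is_subset2[of A] that(2) by (metis carrier_frec subset_antisym)
  qed
  show ?thesis
  proof
    assume "vfin W"
    then obtain A where A: "finite A" "A \<subseteq> W" "W.span A = W"
      unfolding ffin_def W.fin_dim_def carrier_frec by blast
    show "\<exists>A. finite A \<and> A \<subseteq> W \<and> (\<forall>U. vsub U \<longrightarrow> A \<subseteq> U \<longrightarrow> W \<subseteq> U)"
      by (intro exI[of _ A] conjI allI impI A 1[OF A])
  next
    assume "\<exists>A. finite A \<and> A \<subseteq> W \<and> (\<forall>U. vsub U \<longrightarrow> A \<subseteq> U \<longrightarrow> W \<subseteq> U)"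
    then obtain A where A: "finite A" "A \<subseteq> W" "\<And>U. vsub U \<Longrightarrow> A \<subseteq> U \<Longrightarrow> W \<subseteq> U" by metis
    have "W.span A = W" by (rule 2[OF A(1,2)]) (rule A(3))
    then show "vfin W" unfolding ffin_def W.fin_dim_def carrier_frec using A(1,2) by metis
  qed
qed

end

section \<open>Linear maps and rank-nullity\<close>

lemma zero_frec: "\<zero>\<^bsub>frec sc W\<^esub> = 0"
  by (simp add: frec_def)

locale fspace2 = A: fspace F sc + B: fspace F sc'
  for F :: "'a::division_ring set" and sc :: "'a \<Rightarrow> 'b::ab_group_add \<Rightarrow> 'b" and sc' :: "'a \<Rightarrow> 'c::ab_group_add \<Rightarrow> 'c"
begin

lemma lin_0: "A.vsub W \<Longrightarrow> flin F sc sc' W g \<Longrightarrow> g 0 = 0"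
  using flin_sc[of F sc sc' W g 0 0] fsub_0[of F sc W] by simp

lemma lin_minus: "A.vsub W \<Longrightarrow> flin F sc sc' W g \<Longrightarrow> v \<in> W \<Longrightarrow> g (- v) = - g v"
  using flin_sc[of F sc sc' W g "- 1" v] A.F_minus[of 1] A.sc_minus_left[of 1] B.sc_minus_left[of 1] by simp

lemma lin_diff: "A.vsub W \<Longrightarrow> flin F sc sc' W g \<Longrightarrow> u \<in> W \<Longrightarrow> v \<in> W \<Longrightarrow> g (u - v) = g u - g v"
  using flin_add[of F sc sc' W g u "- v"] lin_minus[of W g v] A.sub_minus[of W v] by simp

lemma sub_image: "A.vsub W \<Longrightarrow> flin F sc sc' W g \<Longrightarrow> B.vsub (g ` W)"
  using lin_0[of W g]
  by (intro fsubI) (force simp: fsub_def, auto simp: fsub_def flin_add[symmetric] flin_sc[symmetric])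

lemma sub_vimage: "A.vsub W \<Longrightarrow> flin F sc sc' W g \<Longrightarrow> B.vsub U \<Longrightarrow> A.vsub {w \<in> W. g w \<in> U}"
  using lin_0[of W g] unfolding fsub_def flin_def by auto

lemma sub_ker: "A.vsub W \<Longrightarrow> flin F sc sc' W g \<Longrightarrow> A.vsub {w \<in> W. g w = 0}"
  using sub_vimage[of W g "{0}"] by simp

lemma linear_map_frec:
  assumes "A.vsub W" "flin F sc sc' W g"
  shows "linear_map (subfield_ring F) (frec sc W) (frec sc' (g ` W)) g"
proof -
  have "vectorspace (subfield_ring F) (frec sc W)" "vectorspace (subfield_ring F) (frec sc' (g ` W))"
    using A.vectorspace_frec B.vectorspace_frec sub_image assms by auto
  moreover have "g \<in> LinearCombinations.module_hom (subfield_ring F) (frec sc W) (frec sc' (g ` W))"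
    using assms(2) by (auto simp: LinearCombinations.module_hom_def frec_def subfield_ring_def flin_def)
  ultimately show ?thesis
    by (auto simp: linear_map_def mod_hom_def vectorspace_def mod_hom_axioms_def)
qed

lemma rank_nullity:
  assumes "A.vsub W" "flin F sc sc' W g" "A.vfin W"
  shows "B.vfin (g ` W)" "B.vdim (g ` W) + A.vdim {w \<in> W. g w = 0} = A.vdim W"
proof -
  interpret L: linear_map "subfield_ring F" "frec sc W" "frec sc' (g ` W)" g
    by (rule linear_map_frec[OF assms(1,2)])
  have f: "L.V.fin_dim" using assms(3) by (simp add: ffin_def)
  have i: "L.im = g ` W" "L.ker = {w \<in> W. g w = 0}" by (auto simp: L.im_def L.ker_def zero_frec)
  show "B.vfin (g ` W)" using L.rank_nullity_main(2)[OF f] by (simp add: ffin_def)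
  show "B.vdim (g ` W) + A.vdim {w \<in> W. g w = 0} = A.vdim W"
    using L.rank_nullity_main(1)[OF f] by (simp add: fdim_def i)
qed

lemma dim_inj:
  assumes "A.vsub W" "flin F sc sc' W g" "A.vfin W" "\<And>w. w \<in> W \<Longrightarrow> g w = 0 \<Longrightarrow> w = 0"
  shows "B.vdim (g ` W) = A.vdim W"
proof -
  have "{w \<in> W. g w = 0} = {0}" using assms(4) fsub_0[OF assms(1)] lin_0[OF assms(1,2)] by auto
  then show ?thesis using rank_nullity[OF assms(1-3)] by simp
qed

text \<open>Generators of the kernel together with preimages of generators of the image generate
  \<open>W\<close>.\<close>

lemma fin_extension:
  assumes W: "A.vsub W" and g: "flin F sc sc' W g" and "A.vfin {w \<in> W. g w = 0}" "B.vfin (g ` W)"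
  shows "A.vfin W"
proof -
  obtain A where A: "finite A" "A \<subseteq> {w \<in> W. g w = 0}"
    "\<And>U. A.vsub U \<Longrightarrow> A \<subseteq> U \<Longrightarrow> {w \<in> W. g w = 0} \<subseteq> U"
    using assms(3) A.fin_iff[OF sub_ker[OF W g]] by auto
  obtain B where B: "finite B" "B \<subseteq> g ` W" "\<And>U. B.vsub U \<Longrightarrow> B \<subseteq> U \<Longrightarrow> g ` W \<subseteq> U"
    using assms(4) B.fin_iff[OF sub_image[OF W g]] by auto
  obtain C where C: "finite C" "C \<subseteq> W" "B = g ` C" using B(1,2) by (meson finite_subset_image)
  have "W \<subseteq> U" if U: "A.vsub U" "A \<union> C \<subseteq> U" for U
  proof
    fix w assume w: "w \<in> W"
    have UW: "A.vsub (U \<inter> W)" "flin F sc sc' (U \<inter> W) g"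
      using A.sub_Int[OF U(1) W] flin_subset[OF g] by auto
    have "C \<subseteq> U \<inter> W" using C U by auto
    then have "g ` W \<subseteq> g ` (U \<inter> W)" using B(3)[OF sub_image[OF UW]] C(3) by auto
    then obtain u where u: "u \<in> U" "u \<in> W" "g w = g u" using w by auto
    then have "w - u \<in> {w \<in> W. g w = 0}" using w A.sub_diff[OF W] lin_diff[OF W g] by auto
    then have "w - u \<in> U" using A(3)[OF U(1)] U(2) by auto
    then show "w \<in> U" using fsub_add[OF U(1) _ u(1)] by force
  qed
  then show ?thesis using A C unfolding A.fin_iff[OF W] by (intro exI[of _ "A \<union> C"]) auto
qed

end

section \<open>Sums, hyperplanes and complements\<close>

context fspace
begin

sublocale self: fspace2 F sc sc by unfold_locales

lemma sub_sum:
  assumes "vsub U" "vsub W" shows "vsub {u + w |u w. u \<in> U \<and> w \<in> W}"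
proof (rule fsubI)
  have "0 + 0 \<in> {u + w |u w. u \<in> U \<and> w \<in> W}" using assms by (blast dest: fsub_0)
  then show "0 \<in> {u + w |u w. u \<in> U \<and> w \<in> W}" by simp
next
  fix a b assume "a \<in> {u + w |u w. u \<in> U \<and> w \<in> W}" "b \<in> {u + w |u w. u \<in> U \<and> w \<in> W}"
  then obtain u w u' w' where "a = u + w" "b = u' + w'" "u \<in> U" "u' \<in> U" "w \<in> W" "w' \<in> W" by auto
  then have "a + b = (u + u') + (w + w')" "u + u' \<in> U" "w + w' \<in> W" using assms by (auto simp: fsub_def algebra_simps)
  then show "a + b \<in> {u + w |u w. u \<in> U \<and> w \<in> W}" by blast
next
  fix k a assume "k \<in> F" "a \<in> {u + w |u w. u \<in> U \<and> w \<in> W}"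
  then obtain u w where "k \<in> F" "a = u + w" "u \<in> U" "w \<in> W" by auto
  then have "sc k a = sc k u + sc k w" "sc k u \<in> U" "sc k w \<in> W" using assms by (auto simp: fsub_def sc_add_right)
  then show "sc k a \<in> {u + w |u w. u \<in> U \<and> w \<in> W}" by blast
qed

lemma sub_line: "vsub {sc k x |k. k \<in> F}"
proof (rule fsubI)
  show "0 \<in> {sc k x |k. k \<in> F}" using F_0 sc_0 by (metis (mono_tags, lifting) mem_Collect_eq)
next
  fix u v assume "u \<in> {sc k x |k. k \<in> F}" "v \<in> {sc k x |k. k \<in> F}"
  then obtain k l where "u = sc k x" "v = sc l x" "k \<in> F" "l \<in> F" by auto
  then have "u + v = sc (k + l) x" "k + l \<in> F" by (auto simp: sc_add_left)
  then show "u + v \<in> {sc k x |k. k \<in> F}" by blast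
next
  fix k v assume "k \<in> F" "v \<in> {sc k x |k. k \<in> F}"
  then obtain l where "v = sc l x" "l \<in> F" by auto
  with \<open>k \<in> F\<close> have "sc k v = sc (k * l) x" "k * l \<in> F" by (auto simp: sc_mult)
  then show "sc k v \<in> {sc k x |k. k \<in> F}" by blast
qed

lemma sum_lineI: "k \<in> F \<Longrightarrow> u \<in> U \<Longrightarrow> u + sc k x \<in> {u + v |u v. u \<in> U \<and> v \<in> {sc k x |k. k \<in> F}}"
  by blast

lemma subset_sum_line: "U \<subseteq> {u + v |u v. u \<in> U \<and> v \<in> {sc k x |k. k \<in> F}}"
proof
  fix u assume "u \<in> U"
  then show "u \<in> {u + v |u v. u \<in> U \<and> v \<in> {sc k x |k. k \<in> F}}" using sum_lineI[of 0 u U x] by simp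
qed

lemma in_sum_line: "0 \<in> U \<Longrightarrow> x \<in> {u + v |u v. u \<in> U \<and> v \<in> {sc k x |k. k \<in> F}}"
  using sum_lineI[of 1 0 U x] by simp

lemma dim_less: "vsub W \<Longrightarrow> vsub U \<Longrightarrow> U \<subset> W \<Longrightarrow> vfin W \<Longrightarrow> vdim U < vdim W"
  using fin_subset(2,3)[of W U] by (metis le_neq_implies_less psubset_eq)

text \<open>A subspace of codimension one meets every translate of itself along a line.\<close>

lemma hyperplane_shift:
  assumes W: "vsub W" "vfin W" and U: "vsub U" "U \<subseteq> W" and d: "vdim W \<le> vdim U + 1"
    and x: "x \<in> W" "x \<notin> U" and w: "w \<in> W"
  obtains k where "k \<in> F" "w - sc k x \<in> U"
proof -
  let ?L = "{u + v |u v. u \<in> U \<and> v \<in> {sc k x |k. k \<in> F}}"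
  have L: "vsub ?L" by (rule sub_sum[OF U(1) sub_line])
  have LW: "?L \<subseteq> W" using U x W(1) by (auto simp: fsub_def subset_iff)
  have "U \<subseteq> ?L" by (rule subset_sum_line)
  moreover have "x \<in> ?L" using fsub_0[OF U(1)] by (rule in_sum_line)
  ultimately have "vdim U < vdim ?L"
    using x(2) dim_less[OF L U(1)] fin_subset(1)[OF W(1) L LW W(2)] by blast
  then have "?L = W" using fin_subset(2,3)[OF W(1) L LW W(2)] d by auto
  then obtain u k where "u \<in> U" "k \<in> F" "w = u + sc k x" using w by blast
  then show ?thesis using that[of k] by simp
qed

text \<open>Stands in for Zorn's lemma, dimensions inside \<open>W\<close> being bounded. The
  parameter \<open>A\<close> can be a subspace or, as for value spaces, a vector.\<close>

lemma max_dim_exists: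
  assumes "\<And>A. P A \<Longrightarrow> fsub F sc (g A) \<and> g A \<subseteq> W" "vsub W" "vfin W" "P A0"
  obtains A where "P A" "\<And>B. P B \<Longrightarrow> vdim (g B) \<le> vdim (g A)"
proof -
  have bd: "vdim (g B) \<le> vdim W" if "P B" for B
    using fin_subset(2)[OF assms(2), of "g B"] assms(1)[OF that] assms(3) by simp
  have "\<exists>A. P A \<and> (\<forall>B. P B \<longrightarrow> vdim (g B) \<le> vdim (g A))"
    by (rule ex_has_greatest_nat[of P A0 "\<lambda>A. vdim (g A)" "Suc (vdim W)"]) (use assms(4) bd in \<open>simp_all add: less_Suc_eq_le\<close>)
  then show ?thesis using that by metis
qed

text \<open>Take \<open>V\<close> of largest dimension among the subspaces of \<open>W\<close>
  meeting \<open>U\<close> in 0. If \<open>w\<close> were outside \<open>U + V\<close>, adjoining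
  the line of \<open>w\<close> to \<open>V\<close> would keep the intersection with \<open>U\<close>
  trivial.\<close>

lemma complement:
  assumes W: "vsub W" "vfin W" and U: "vsub U" "U \<subseteq> W"
  obtains V where "vsub V" "V \<subseteq> W" "U \<inter> V = {0}" "\<And>w. w \<in> W \<Longrightarrow> \<exists>u\<in>U. \<exists>v\<in>V. w = u + v"
proof -
  obtain V where V: "vsub V \<and> V \<subseteq> W \<and> U \<inter> V = {0}"
    and mx: "\<And>B. vsub B \<and> B \<subseteq> W \<and> U \<inter> B = {0} \<Longrightarrow> vdim B \<le> vdim V"
    by (rule max_dim_exists[of "\<lambda>V. vsub V \<and> V \<subseteq> W \<and> U \<inter> V = {0}" "\<lambda>V. V" W "{0}"])
      (use W fsub_0[OF U(1)] fsub_0[OF W(1)] in auto)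
  have "\<exists>u\<in>U. \<exists>v\<in>V. w = u + v" if w: "w \<in> W" for w
  proof (rule ccontr)
    assume no: "\<not> ?thesis"
    let ?B = "{u + v |u v. u \<in> V \<and> v \<in> {sc k w |k. k \<in> F}}"
    have B: "vsub ?B" using V by (intro sub_sum sub_line) auto
    have BW: "?B \<subseteq> W" using V w W(1) by (auto simp: fsub_def subset_iff)
    have V0: "0 \<in> V" "0 \<in> U" using V U fsub_0 by auto
    have "U \<inter> ?B = {0}"
    proof -
      have "z = 0" if z: "z \<in> U" "z = v + sc k w" "v \<in> V" "k \<in> F" for z v k
      proof (cases "k = 0")
        case True
        then show ?thesis using z V by auto
      next
        case False
        then have "w = sc (inverse k) z + sc (inverse k) (- v)"
          using z sc_cancel[of k w] by (simp add: sc_add_right[symmetric] F_inverse)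
        moreover have "sc (inverse k) z \<in> U" "sc (inverse k) (- v) \<in> V"
          using z V U fsub_sc[OF U(1)] fsub_sc[of F sc V] sub_minus[of V] F_inverse by auto
        ultimately show ?thesis using no by metis
      qed
      moreover have "0 \<in> ?B" using V0 subset_sum_line[of V w] by blast
      ultimately show ?thesis using V0(2) by fastforce
    qed
    moreover have "V \<subset> ?B"
    proof
      show "V \<subseteq> ?B" by (rule subset_sum_line)
      have "w \<in> ?B" using V0 by (intro in_sum_line)
      moreover have "w \<notin> V" using no V0 by force
      ultimately show "V \<noteq> ?B" by metis
    qed
    then have "vdim V < vdim ?B"
      by (rule dim_less[OF B, rotated]) (use V fin_subset(1)[OF W(1) B BW W(2)] in simp_all)
    ultimately show False using mx[of ?B] B BW by simp
  qed
  then show ?thesis using that[of V] V by simp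
qed

end

section \<open>Atkinson's lemma\<close>

context fspace
begin

lemma psubset_sum_line:
  assumes "0 \<in> U" "x \<notin> U"
  shows "U \<subset> {u + v |u v. u \<in> U \<and> v \<in> {sc k x |k. k \<in> F}}" (is "_ \<subset> ?B")
proof (rule psubsetI[OF subset_sum_line], rule notI)
  assume eq: "U = ?B"
  have "x \<in> ?B" by (rule in_sum_line[OF assms(1)])
  then have "x \<in> U" by (subst eq)
  then show False using assms(2) by simp
qed

lemma sum_lineE:
  assumes "w \<in> {u + v |u v. u \<in> U \<and> v \<in> {sc k x |k. k \<in> F}}"
  obtains u k where "u \<in> U" "k \<in> F" "w = u + sc k x"
  using assms by auto

lemma sub_sumf: "vsub W \<Longrightarrow> (\<And>p. p \<in> P \<Longrightarrow> w p \<in> W) \<Longrightarrow> sum w P \<in> W"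
  by (induction P rule: infinite_finite_induct) (auto simp: fsub_0 fsub_add)

lemma sc_sum_right: "k \<in> F \<Longrightarrow> sc k (sum w P) = (\<Sum>p\<in>P. sc k (w p))"
  by (induction P rule: infinite_finite_induct) (auto simp: sc_add_right)

text \<open>The classical argument for eigenvectors with distinct eigenvalues \<open>p\<close>. No
  operator is given; its place is taken by \<open>shift\<close>, the fact that weighting the
  coefficients of a relation by \<open>p\<close> yields a relation again.\<close>

lemma eigen_independent:
  assumes P: "finite P" "P \<subseteq> F" and w: "\<And>p. p \<in> P \<Longrightarrow> w p \<noteq> 0"
    and shift: "\<And>c. (\<forall>p. c p \<in> F) \<Longrightarrow> (\<Sum>p\<in>P. sc (c p) (w p)) = 0 \<Longrightarrow> (\<Sum>p\<in>P. sc (p * c p) (w p)) = 0"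
    and c: "\<forall>p. c p \<in> F" "(\<Sum>p\<in>P. sc (c p) (w p)) = 0"
  shows "\<forall>p\<in>P. c p = 0"
  using c
proof (induction "card {p\<in>P. c p \<noteq> 0}" arbitrary: c rule: less_induct)
  case less
  show ?case
  proof (rule ccontr)
    assume "\<not> ?thesis"
    then obtain q where q: "q \<in> P" "c q \<noteq> 0" by auto
    have qF: "q \<in> F" using q P by auto
    \<comment> \<open>The weighted relation minus \<open>q\<close> times the given one: the
      coefficient at \<open>q\<close> drops out and the support shrinks. Off \<open>P\<close> the
      value 0 keeps \<open>c'\<close> in \<open>F\<close>, where \<open>p - q\<close> need not
      lie.\<close>
    define c' where "c' p = (if p \<in> P then (p - q) * c p else 0)" for p
    have c'F: "\<forall>p. c' p \<in> F" using less.prems P qF by (auto simp: c'_def)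
    have "(\<Sum>p\<in>P. sc (c' p) (w p)) = (\<Sum>p\<in>P. sc (p * c p) (w p)) - sc q (\<Sum>p\<in>P. sc (c p) (w p))"
    proof -
      have "sc (c' p) (w p) = sc (p * c p) (w p) - sc q (sc (c p) (w p))" if "p \<in> P" for p
        using that P less.prems(1) qF
        by (simp add: c'_def left_diff_distrib sc_diff_left F_mult subset_iff sc_mult[symmetric])
      then show ?thesis using qF by (simp add: sc_sum_right sum_subtractf)
    qed
    then have r: "(\<Sum>p\<in>P. sc (c' p) (w p)) = 0"
      by (simp only: shift[OF less.prems] less.prems(2) sc_0_right[OF qF] diff_zero)
    have "{p\<in>P. c' p \<noteq> 0} \<subseteq> {p\<in>P. c p \<noteq> 0} - {q}" by (auto simp: c'_def)
    then have "card {p\<in>P. c' p \<noteq> 0} \<le> card ({p\<in>P. c p \<noteq> 0} - {q})" using P(1) by (intro card_mono) simp_all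
    also have "\<dots> < card {p\<in>P. c p \<noteq> 0}" using P(1) q by (intro card_Diff1_less) simp_all
    finally have "card {p\<in>P. c' p \<noteq> 0} < card {p\<in>P. c p \<noteq> 0}" .
    then have "\<forall>p\<in>P. c' p = 0" by (rule less.hyps) (use c'F r in simp_all)
    then have z: "c p = 0" if "p \<in> P" "p \<noteq> q" for p using that by (auto simp: c'_def)
    have "(\<Sum>p\<in>P. sc (c p) (w p)) = sc (c q) (w q)"
      using z q P by (subst sum.remove[of P q]) auto
    then have "sc (c q) (w q) = 0" using less.prems by simp
    then have "w q = 0" using sc_cancel[of "c q" "w q"] less.prems(1) q(2) by (simp add: F_inverse)
    then show False using w[OF q(1)] by simp
  qed
qed

text \<open>The vectors \<open>w p\<close> are adjoined one at a time. Each step raises the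
  dimension, because a new vector lying in the previous span would give a relation with coefficient
  \<open>- 1\<close>.\<close>

lemma eigen_card_le:
  assumes P: "finite P" "P \<subseteq> F" and w: "\<And>p. p \<in> P \<Longrightarrow> w p \<noteq> 0"
    and W: "vsub W" "vfin W" "\<And>p. p \<in> P \<Longrightarrow> w p \<in> W"
    and shift: "\<And>c. (\<forall>p. c p \<in> F) \<Longrightarrow> (\<Sum>p\<in>P. sc (c p) (w p)) = 0 \<Longrightarrow> (\<Sum>p\<in>P. sc (p * c p) (w p)) = 0"
  shows "card P \<le> vdim W"
proof -
  have "\<exists>U. vsub U \<and> U \<subseteq> W \<and> card Q \<le> vdim U \<and> (\<forall>u\<in>U. \<exists>c. (\<forall>p. c p \<in> F) \<and> u = (\<Sum>p\<in>Q. sc (c p) (w p)))"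
    if "finite Q" "Q \<subseteq> P" for Q
    using that
  proof (induction Q rule: finite_induct)
    case empty
    then show ?case using W fsub_0 by (intro exI[of _ "{0}"]) (auto intro!: exI[of _ "\<lambda>_. 0"])
  next
    case (insert q Q)
    then obtain U where U: "vsub U" "U \<subseteq> W" "card Q \<le> vdim U"
      "\<And>u. u \<in> U \<Longrightarrow> \<exists>c. (\<forall>p. c p \<in> F) \<and> u = (\<Sum>p\<in>Q. sc (c p) (w p))" by auto
    let ?B = "{u + v |u v. u \<in> U \<and> v \<in> {sc k (w q) |k. k \<in> F}}"
    have B: "vsub ?B" by (rule sub_sum[OF U(1) sub_line])
    have BW: "?B \<subseteq> W" using U insert.prems W by (auto simp: fsub_def subset_iff)
    have "w q \<notin> U"
    proof
      assume "w q \<in> U"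
      then obtain c where c: "\<forall>p. c p \<in> F" "w q = (\<Sum>p\<in>Q. sc (c p) (w p))" using U by blast
      define c' where "c' p = (if p = q then - 1 else if p \<in> Q then c p else 0)" for p
      have "(\<Sum>p\<in>P. sc (c' p) (w p)) = (\<Sum>p\<in>insert q Q. sc (c' p) (w p))"
        using insert.prems P by (intro sum.mono_neutral_right) (auto simp: c'_def)
      also have "\<dots> = - w q + (\<Sum>p\<in>Q. sc (c' p) (w p))"
        using insert.hyps sc_minus_left[of 1] by (simp add: c'_def)
      also have "(\<Sum>p\<in>Q. sc (c' p) (w p)) = w q"
        unfolding c(2) using insert.hyps by (intro sum.cong) (auto simp: c'_def)
      finally have "(\<Sum>p\<in>P. sc (c' p) (w p)) = 0" by simp
      moreover have "\<forall>p. c' p \<in> F" using c F_minus[of 1] by (auto simp: c'_def)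
      ultimately have "\<forall>p\<in>P. c' p = 0"
        by (intro eigen_independent[OF P, of w c'] w shift) simp_all
      then show False using insert.prems by (auto simp: c'_def)
    qed
    then have "U \<subset> ?B" by (rule psubset_sum_line[OF fsub_0[OF U(1)]])
    then have "vdim U < vdim ?B" by (rule dim_less[OF B U(1)]) (rule fin_subset(1)[OF W(1) B BW W(2)])
    then have "card (insert q Q) \<le> vdim ?B" using U(3) insert.hyps by simp
    moreover have "\<exists>c. (\<forall>p. c p \<in> F) \<and> u = (\<Sum>p\<in>insert q Q. sc (c p) (w p))" if "u \<in> ?B" for u
    proof -
      obtain v k where "v \<in> U" "k \<in> F" "u = v + sc k (w q)" using \<open>u \<in> ?B\<close> by (rule sum_lineE)
      moreover obtain c where "\<forall>p. c p \<in> F" "v = (\<Sum>p\<in>Q. sc (c p) (w p))" using U(4)[OF \<open>v \<in> U\<close>] by blast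
      moreover have "(\<Sum>p\<in>Q. sc ((c(q := k)) p) (w p)) = (\<Sum>p\<in>Q. sc (c p) (w p))"
        using insert.hyps by (intro sum.cong) auto
      ultimately show ?thesis using insert.hyps by (intro exI[of _ "c(q := k)"]) (simp add: add.commute)
    qed
    ultimately show ?case using B BW by (intro exI[of _ ?B]) simp
  qed
  from this[OF P(1) subset_refl] obtain U where "vsub U" "U \<subseteq> W" "card P \<le> vdim U" by blast
  then show ?thesis using fin_subset(2)[OF W(1)] W(2) by (meson le_trans)
qed

end

lemma not_zeroE:
  assumes "A \<noteq> {z}" "z \<in> A" obtains x where "x \<in> A" "x \<noteq> z"
  using assms by blast

lemma finite_subset_of_card:
  assumes "infinite A \<or> n < card A"
  obtains B where "finite B" "B \<subseteq> A" "card B = n + 1"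
proof (cases "finite A")
  case True
  then have "n + 1 \<le> card A" using assms by simp
  then obtain B where "B \<subseteq> A" "card B = n + 1" by (rule obtain_subset_with_card_n)
  then show ?thesis using that finite_subset[OF _ True] by blast
next
  case False
  then show ?thesis using infinite_arbitrarily_large[of A "n + 1"] that by blast
qed

lemma sum_fun_apply: "(\<Sum>p\<in>P. f p) x = (\<Sum>p\<in>P. f p x :: 'b::comm_monoid_add)"
  by (induction P rule: infinite_finite_induct) auto

section \<open>Right vector spaces and spaces of operators without fixed vectors\<close>

locale rspace = central F for F :: "'a::division_ring set" +
  fixes rs :: "'v::ab_group_add \<Rightarrow> 'a \<Rightarrow> 'v"
  assumes rs_add: "rs (u + v) a = rs u a + rs v a"
    and rs_add_right: "rs v (a + b) = rs v a + rs v b"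
    and rs_mult: "rs v (a * b) = rs (rs v a) b"
    and rs_1 [simp]: "rs v 1 = v"
begin

lemma rs_0 [simp]: "rs v 0 = 0"
  using rs_add_right[of v 0 0] by simp

lemma rs_0_left [simp]: "rs 0 a = 0"
  using rs_add[of 0 0 a] by simp

lemma rs_minus: "rs (- v) a = - rs v a"
  using rs_add[of v "- v" a] by (simp add: minus_unique)

lemma rs_minus_right: "rs v (- a) = - rs v a"
  using rs_add_right[of v a "- a"] by (simp add: minus_unique)

lemma rs_diff: "rs (u - v) a = rs u a - rs v a"
  using rs_add[of u "- v" a] by (simp add: rs_minus)

lemma rs_diff_right: "rs v (a - b) = rs v a - rs v b"
  using rs_add_right[of v a "- b"] by (simp add: rs_minus_right)

lemma rs_eq_0: "rs v a = 0 \<longleftrightarrow> v = 0 \<or> a = 0"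
proof (cases "a = 0")
  case False
  then have "rs (rs v a) (inverse a) = v" by (simp add: rs_mult[symmetric])
  then show ?thesis using False by auto
qed simp

text \<open>Both are used as actions of \<open>F\<close> only. Central scalars turn right
  \<open>D\<close>-linear maps into right \<open>D\<close>-linear maps; arbitrary scalars do
  not.\<close>

abbreviation scv :: "'a \<Rightarrow> 'v \<Rightarrow> 'v" where "scv k v \<equiv> rs v k"
abbreviation sco :: "'a \<Rightarrow> ('v \<Rightarrow> 'v) \<Rightarrow> 'v \<Rightarrow> 'v" where "sco k M \<equiv> (\<lambda>v. rs (M v) k)"

sublocale V: fspace F scv
  by unfold_locales (simp_all add: rs_add rs_add_right rs_mult[symmetric] F_comm)

sublocale O: fspace F sco
  by unfold_locales (simp_all add: fun_eq_iff rs_add rs_add_right rs_mult[symmetric] F_comm)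

sublocale D: fspace F "(*)"
  by unfold_locales (simp_all add: algebra_simps)

sublocale OV: fspace2 F sco scv by unfold_locales
sublocale VD: fspace2 F scv "(*)" by unfold_locales

definition dsub :: "'v set \<Rightarrow> bool" where
  "dsub W \<longleftrightarrow> 0 \<in> W \<and> (\<forall>u\<in>W. \<forall>v\<in>W. u + v \<in> W) \<and> (\<forall>v\<in>W. \<forall>a. rs v a \<in> W)"

definition dlin :: "'v set \<Rightarrow> ('v \<Rightarrow> 'v) \<Rightarrow> bool" where
  "dlin V M \<longleftrightarrow> (\<forall>v\<in>V. M v \<in> V) \<and> (\<forall>u\<in>V. \<forall>v\<in>V. M (u + v) = M u + M v) \<and>
     (\<forall>v\<in>V. \<forall>a. M (rs v a) = rs (M v) a)"

text \<open>The last condition makes an element of \<open>S\<close> determined by its restriction to \<open>V\<close>.\<close>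

definition tss :: "'v set \<Rightarrow> ('v \<Rightarrow> 'v) set \<Rightarrow> bool" where
  "tss V S \<longleftrightarrow> fsub F sco S \<and> (\<forall>M\<in>S. dlin V M \<and> (\<forall>v\<in>V. M v = v \<longrightarrow> v = 0) \<and>
     ((\<forall>v\<in>V. M v = 0) \<longrightarrow> M = 0))"

lemma dsub_0: "dsub W \<Longrightarrow> 0 \<in> W" and dsub_add: "dsub W \<Longrightarrow> u \<in> W \<Longrightarrow> v \<in> W \<Longrightarrow> u + v \<in> W"
  and dsub_rs: "dsub W \<Longrightarrow> v \<in> W \<Longrightarrow> rs v a \<in> W"
  by (auto simp: dsub_def)

lemma dsub_sub: "dsub W \<Longrightarrow> V.vsub W"
  by (auto simp: dsub_def fsub_def)

lemma dsub_diff: "dsub W \<Longrightarrow> u \<in> W \<Longrightarrow> v \<in> W \<Longrightarrow> u - v \<in> W"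
  using V.sub_diff[OF dsub_sub] .

lemma dsub_rs_iff: "dsub W \<Longrightarrow> a \<noteq> 0 \<Longrightarrow> rs v a \<in> W \<longleftrightarrow> v \<in> W"
  using dsub_rs[of W "rs v a" "inverse a"] dsub_rs[of W v a] by (auto simp: rs_mult[symmetric])

lemma tssD:
  assumes "tss V S"
  shows tss_sub: "O.vsub S"
    and tss_closed: "M \<in> S \<Longrightarrow> v \<in> V \<Longrightarrow> M v \<in> V"
    and tss_add: "M \<in> S \<Longrightarrow> u \<in> V \<Longrightarrow> v \<in> V \<Longrightarrow> M (u + v) = M u + M v"
    and tss_rs: "M \<in> S \<Longrightarrow> v \<in> V \<Longrightarrow> M (rs v a) = rs (M v) a"
    and tss_fix: "M \<in> S \<Longrightarrow> v \<in> V \<Longrightarrow> M v = v \<Longrightarrow> v = 0"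
    and tss_zero: "M \<in> S \<Longrightarrow> (\<And>v. v \<in> V \<Longrightarrow> M v = 0) \<Longrightarrow> M = 0"
  using assms by (auto simp: tss_def dlin_def)

lemma flin_ev: "flin F sco scv S (\<lambda>M. M x)"
  by (auto intro: flinI)

lemma ev_sub: "tss V S \<Longrightarrow> V.vsub ((\<lambda>M. M x) ` S)"
  by (rule OV.sub_image[OF tss_sub flin_ev])

lemma ev_subset: "tss V S \<Longrightarrow> x \<in> V \<Longrightarrow> (\<lambda>M. M x) ` S \<subseteq> V"
  by (auto simp: tss_closed)

lemma ker_sub: "O.vsub S \<Longrightarrow> O.vsub {M \<in> S. M x = 0}"
  by (rule OV.sub_ker[OF _ flin_ev])

text \<open>Evaluation at one element of \<open>A\<close> has its image in \<open>V\<close>, and its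
  kernel is controlled by the remaining elements.\<close>

lemma fin_ops_aux:
  assumes "finite A" "V.vsub V" "V.vfin V" "O.vsub S" "\<And>M a. M \<in> S \<Longrightarrow> a \<in> A \<Longrightarrow> M a \<in> V"
    "O.vfin {M \<in> S. \<forall>a\<in>A. M a = 0}"
  shows "O.vfin S"
  using assms
proof (induction A arbitrary: S rule: finite_induct)
  case (insert a A)
  have "O.vfin {M \<in> S. M a = 0}"
  proof (rule insert.IH)
    have "{M \<in> {M \<in> S. M a = 0}. \<forall>a\<in>A. M a = 0} = {M \<in> S. \<forall>a\<in>insert a A. M a = 0}" by auto
    then show "O.vfin {M \<in> {M \<in> S. M a = 0}. \<forall>a\<in>A. M a = 0}" using insert.prems by simp
  qed (use insert.prems ker_sub in auto)
  moreover have "V.vfin ((\<lambda>M. M a) ` S)"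
    using V.fin_subset(1)[OF insert.prems(1) OV.sub_image[OF insert.prems(3) flin_ev] _ insert.prems(2)] insert.prems(4)
    by auto
  ultimately show ?case using OV.fin_extension[OF insert.prems(3) flin_ev] by blast
qed simp

text \<open>A finite set generating \<open>V\<close> over \<open>F\<close> determines an element of
  \<open>S\<close>: vanishing on it means vanishing on \<open>V\<close>, hence being 0 by the last
  clause of \<open>tss\<close>.\<close>

lemma fin_ops:
  assumes V: "dsub V" "V.vfin V" and S: "tss V S"
  shows "O.vfin S"
proof -
  have Vs: "V.vsub V" by (rule dsub_sub[OF V(1)])
  obtain A where A: "finite A" "A \<subseteq> V" "\<And>U. V.vsub U \<Longrightarrow> A \<subseteq> U \<Longrightarrow> V \<subseteq> U"
    using V(2) V.fin_iff[OF Vs] by metis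
  have "M = 0" if M: "M \<in> S" "\<And>a. a \<in> A \<Longrightarrow> M a = 0" for M
  proof (rule tss_zero[OF S M(1)])
    have "flin F scv scv V M" using S M by (auto intro!: flinI simp: tss_add tss_rs)
    then have "V.vsub {v \<in> V. M v = 0}" using V.self.sub_ker[OF Vs] by blast
    then have "V \<subseteq> {v \<in> V. M v = 0}" using A(2) M(2) by (intro A(3)) auto
    then show "v \<in> V \<Longrightarrow> M v = 0" for v by auto
  qed
  then have e: "{M \<in> S. \<forall>a\<in>A. M a = 0} = {0}" using fsub_0[OF tss_sub[OF S]] by auto
  show ?thesis
  proof (rule fin_ops_aux[OF A(1) Vs V(2) tss_sub[OF S]])
    show "M a \<in> V" if "M \<in> S" "a \<in> A" for M a using tss_closed[OF S that(1)] that(2) A(2) by blast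
    show "O.vfin {M \<in> S. \<forall>a\<in>A. M a = 0}" using O.fin_zero by (simp only: e)
  qed
qed

text \<open>If \<open>N y\<close> were outside \<open>S x\<close>, the vectors
  \<open>rs x p + y\<close> for distinct \<open>p\<close> in \<open>F\<close> would produce more
  vectors in \<open>S x\<close> than its dimension allows, independent because they behave like
  eigenvectors with eigenvalues \<open>p\<close>.\<close>

lemma atkinson:
  assumes V: "dsub V" "V.vfin V" and S: "tss V S" and x: "x \<in> V"
    and mx: "\<And>y. y \<in> V \<Longrightarrow> V.vdim ((\<lambda>M. M y) ` S) \<le> V.vdim ((\<lambda>M. M x) ` S)"
    and card: "infinite F \<or> V.vdim ((\<lambda>M. M x) ` S) < card F"
    and N: "N \<in> S" "N x = 0" and y: "y \<in> V"
  shows "N y \<in> (\<lambda>M. M x) ` S"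
proof (rule ccontr)
  assume z: "N y \<notin> (\<lambda>M. M x) ` S"
  let ?r = "V.vdim ((\<lambda>M. M x) ` S)" and ?K = "{M \<in> S. M x = 0}"
  have Ss: "O.vsub S" by (rule tss_sub[OF S])
  have Sf: "O.vfin S" by (rule fin_ops[OF V S])
  have Vs: "V.vsub V" by (rule dsub_sub[OF V(1)])
  have z0: "N y \<noteq> 0" using z fsub_0[OF ev_sub[OF S, of x]] by (cases "N y = 0") simp_all
  \<comment> \<open>Evaluation at \<open>x\<close> is injective on \<open>S0\<close> with image all
    of \<open>S x\<close>, so \<open>dim S0 = ?r\<close>. Adding the line of \<open>N\<close> gives
    \<open>?S1\<close> of dimension above \<open>?r\<close>, and by the maximality of
    \<open>?r\<close> no evaluation at a vector of \<open>V\<close> is injective on it.\<close>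
  obtain S0 where S0: "O.vsub S0" "S0 \<subseteq> S" "?K \<inter> S0 = {0}"
    "\<And>M. M \<in> S \<Longrightarrow> \<exists>A\<in>?K. \<exists>B\<in>S0. M = A + B"
    by (rule O.complement[OF Ss Sf ker_sub[OF Ss, of x]], rule Collect_restrict, rule that, assumption+)
  have S0f: "O.vfin S0" by (rule O.fin_subset(1)[OF Ss S0(1,2) Sf])
  have S0x: "M = 0" if "M \<in> S0" "M x = 0" for M
  proof -
    have "M \<in> ?K \<inter> S0" using that by (simp add: subsetD[OF S0(2)])
    then show ?thesis using S0(3) by simp
  qed
  have "(\<lambda>M. M x) ` S0 = (\<lambda>M. M x) ` S"
  proof (rule equalityI[OF image_mono[OF S0(2)]], rule subsetI)
    fix u assume "u \<in> (\<lambda>M. M x) ` S"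
    then obtain M where M: "M \<in> S" "u = M x" by (rule imageE)
    from S0(4)[OF M(1)] obtain A B where "A x = 0" "B \<in> S0" "M = A + B" by auto
    then have "u = B x" "B \<in> S0" using M by simp_all
    then show "u \<in> (\<lambda>M. M x) ` S0" by (rule image_eqI)
  qed
  then have r: "O.vdim S0 = ?r" using OV.dim_inj[OF S0(1) flin_ev S0f, of x] S0x by simp
  let ?S1 = "{u + v |u v. u \<in> S0 \<and> v \<in> {sco k N |k. k \<in> F}}"
  have S1: "O.vsub ?S1" by (rule O.sub_sum[OF S0(1) O.sub_line])
  have S1S: "?S1 \<subseteq> S"
  proof
    fix w assume "w \<in> ?S1"
    then obtain u k where "u \<in> S0" "k \<in> F" "w = u + sco k N" by (rule O.sum_lineE)
    then show "w \<in> S" using fsub_add[OF Ss subsetD[OF S0(2)] fsub_sc[OF Ss _ N(1)]] by simp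
  qed
  have S1f: "O.vfin ?S1" by (rule O.fin_subset(1)[OF Ss S1 S1S Sf])
  have "N \<notin> S0" using S0x[of N] N(2) z0 by auto
  then have "S0 \<subset> ?S1" by (rule O.psubset_sum_line[OF fsub_0[OF S0(1)]])
  then have r1: "?r < O.vdim ?S1" using O.dim_less[OF S1 S0(1) _ S1f] r by simp
  have ex: "\<exists>M\<in>S0. M x \<noteq> 0 \<and> (\<exists>s\<in>F. M (rs x p + y) = rs (N y) s)" if p: "p \<in> F" for p
  proof -
    let ?w = "rs x p + y"
    have w: "?w \<in> V" using x y V by (auto simp: dsub_def)
    have rn: "V.vdim ((\<lambda>M. M ?w) ` ?S1) + O.vdim {M \<in> ?S1. M ?w = 0} = O.vdim ?S1"
      by (rule OV.rank_nullity(2)[OF S1 flin_ev S1f])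
    have "V.vdim ((\<lambda>M. M ?w) ` ?S1) \<le> V.vdim ((\<lambda>M. M ?w) ` S)"
      by (rule V.fin_subset(2)[OF ev_sub[OF S] OV.sub_image[OF S1 flin_ev] image_mono[OF S1S]])
        (rule V.fin_subset(1)[OF Vs ev_sub[OF S] ev_subset[OF S w] V(2)])
    then have "O.vdim {M \<in> ?S1. M ?w = 0} \<noteq> 0" using rn r1 mx[OF w] by linarith
    then have "{M \<in> ?S1. M ?w = 0} \<noteq> {0}" by (metis O.dim_zero)
    then obtain M where "M \<in> {M \<in> ?S1. M ?w = 0}" "M \<noteq> 0"
      using fsub_0[OF ker_sub[OF S1, of ?w]] by (rule not_zeroE)
    then have M: "M \<in> ?S1" "M ?w = 0" "M \<noteq> 0" by simp_all
    from M(1) obtain A s where A: "A \<in> S0" "s \<in> F" "M = A + sco s N" by (rule O.sum_lineE)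
    \<comment> \<open>As \<open>N x = 0\<close>, the part of \<open>M\<close> along \<open>N\<close>
      contributes a multiple of the same vector \<open>N y\<close> for every
      \<open>p\<close>.\<close>
    have "N ?w = N y" using S N x y V by (simp add: tss_add tss_rs dsub_rs)
    then have Aw: "A ?w = rs (N y) (- s)" using M(2) A(3) by (simp add: rs_minus_right eq_neg_iff_add_eq_0)
    have "A x \<noteq> 0"
    proof
      assume "A x = 0"
      then have "A = 0" using S0x A(1) by blast
      then have "s = 0" using Aw z0 by (simp add: rs_eq_0)
      then show False using A(3) M(3) \<open>A = 0\<close> by (auto simp: fun_eq_iff)
    qed
    then show ?thesis using A(1) Aw F_minus[OF A(2)] by (intro bexI[of _ A] conjI bexI[of _ "- s"])
  qed
  then have "\<forall>p\<in>F. \<exists>M s. M \<in> S0 \<and> M x \<noteq> 0 \<and> s \<in> F \<and> M (rs x p + y) = rs (N y) s" by blast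
  then obtain m s where m: "\<And>p. p \<in> F \<Longrightarrow> m p \<in> S0 \<and> m p x \<noteq> 0 \<and> s p \<in> F \<and> m p (rs x p + y) = rs (N y) (s p)"
    by metis
  obtain P where P: "finite P" "P \<subseteq> F" "card P = ?r + 1"
    by (rule finite_subset_of_card[OF card])
  have "card P \<le> ?r"
  proof (rule V.eigen_card_le[OF P(1,2), of "\<lambda>p. m p x"])
    show "m p x \<noteq> 0" "m p x \<in> (\<lambda>M. M x) ` S" if "p \<in> P" for p using m[of p] that P(2) S0(2) by (auto simp: subset_iff)
    show "V.vsub ((\<lambda>M. M x) ` S)" by (rule ev_sub[OF S])
    show "V.vfin ((\<lambda>M. M x) ` S)" by (rule V.fin_subset(1)[OF Vs ev_sub[OF S] ev_subset[OF S x] V(2)])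
    fix c :: "'a \<Rightarrow> 'a" assume c: "\<forall>p. c p \<in> F" "(\<Sum>p\<in>P. rs (m p x) (c p)) = 0"
    \<comment> \<open>A relation among the values at \<open>x\<close> lifts to the operators
      \<open>m p\<close>, since evaluation at \<open>x\<close> is injective on \<open>S0\<close>.
      Reading the lifted relation at \<open>y\<close> brings in the factor \<open>p\<close>.\<close>
    let ?A = "\<Sum>p\<in>P. sco (c p) (m p)"
    have "?A \<in> S0"
      by (rule O.sub_sumf[OF S0(1)]) (rule fsub_sc[OF S0(1)], use m P(2) c in \<open>auto simp: subset_iff\<close>)
    moreover have "?A x = 0" using c by (simp add: sum_fun_apply)
    ultimately have "?A = 0" by (rule S0x[of ?A])
    then have "?A y = 0" by simp
    then have Ay: "(\<Sum>p\<in>P. rs (m p y) (c p)) = 0" by (simp add: sum_fun_apply)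
    have my: "m p y = rs (N y) (s p) - rs (m p x) p" if p: "p \<in> P" for p
    proof -
      have "m p \<in> S" "p \<in> F" using m[of p] p P(2) S0(2) by (auto simp: subset_iff)
      then have "m p (rs x p + y) = rs (m p x) p + m p y" using S x y V by (simp add: tss_add tss_rs dsub_rs)
      then show ?thesis using m[OF \<open>p \<in> F\<close>] by (simp add: algebra_simps)
    qed
    have "0 = (\<Sum>p\<in>P. rs (N y) (s p * c p) - rs (m p x) (p * c p))"
      unfolding Ay[symmetric] by (intro sum.cong refl) (simp add: my rs_diff rs_mult)
    also have "\<dots> = rs (N y) (\<Sum>p\<in>P. s p * c p) - (\<Sum>p\<in>P. rs (m p x) (p * c p))"
    proof -
      have "rs (N y) (\<Sum>p\<in>P. s p * c p) = (\<Sum>p\<in>P. rs (N y) (s p * c p))"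
        by (induction P rule: infinite_finite_induct) (auto simp: rs_add_right)
      then show ?thesis by (simp add: sum_subtractf)
    qed
    finally have eq: "(\<Sum>p\<in>P. rs (m p x) (p * c p)) = rs (N y) (\<Sum>p\<in>P. s p * c p)" by simp
    let ?k = "\<Sum>p\<in>P. s p * c p"
    have kF: "?k \<in> F" by (rule D.sub_sumf) (use m c P(2) F_mult in \<open>auto simp: fsub_def\<close>)
    \<comment> \<open>The left side of \<open>eq\<close> lies in the \<open>F\<close>-space
      \<open>S x\<close> and \<open>N y\<close> does not, so the scalar \<open>?k\<close> must
      vanish.\<close>
    have "(\<Sum>p\<in>P. rs (m p x) (p * c p)) \<in> (\<lambda>M. M x) ` S"
      by (rule V.sub_sumf[OF ev_sub[OF S]], rule fsub_sc[OF ev_sub[OF S]])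
        (use m P(2) c(1) S0(2) in \<open>auto simp: subset_iff\<close>)
    then have "rs (N y) ?k \<in> (\<lambda>M. M x) ` S" unfolding eq .
    from fsub_sc[OF ev_sub[OF S, of x] F_inverse[OF kF] this]
    have "?k = 0" using V.sc_cancel[OF kF, of "N y"] z by (cases "?k = 0") simp_all
    then show "(\<Sum>p\<in>P. rs (m p x) (p * c p)) = 0" using eq by simp
  qed
  then show False using P(3) by simp
qed

end

section \<open>The dimension bound\<close>

text \<open>\<open>tdim d n = d n (n + 1) / 2 - n\<close> is the dimension of the upper triangular matrices whose diagonal
  entries lie in an \<open>F\<close>-hyperplane of the division ring.\<close>

fun tdim :: "nat \<Rightarrow> nat \<Rightarrow> nat" where
  "tdim d 0 = 0"
| "tdim d (Suc n) = tdim d n + (Suc n * d - 1)"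

lemma psubset_witness: "v \<in> B \<Longrightarrow> v \<notin> A \<Longrightarrow> (\<And>u. u \<in> A \<Longrightarrow> u \<in> B) \<Longrightarrow> A \<subset> B"
  by blast

context rspace
begin

abbreviation dg :: nat where "dg \<equiv> D.vdim UNIV"

text \<open>\<open>hcomp x V C\<close> says \<open>V = x D \<oplus> C\<close>, and \<open>cf x C v\<close> is then the coordinate of \<open>v\<close> along \<open>x\<close>.\<close>

definition hcomp :: "'v \<Rightarrow> 'v set \<Rightarrow> 'v set \<Rightarrow> bool" where
  "hcomp x V C \<longleftrightarrow> dsub C \<and> C \<subseteq> V \<and> x \<in> V \<and> x \<notin> C \<and> (\<forall>v\<in>V. \<exists>a. v - rs x a \<in> C)"

definition cf :: "'v \<Rightarrow> 'v set \<Rightarrow> 'v \<Rightarrow> 'a" where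
  "cf x C v = (SOME a. v - rs x a \<in> C)"

lemma dsub_add_line:
  assumes "dsub C" shows "dsub {v. \<exists>b. v - rs y b \<in> C}" (is "dsub ?B")
  unfolding dsub_def
proof (intro conjI ballI allI)
  have "(0 :: 'v) - rs y 0 \<in> C" using dsub_0[OF assms] by simp
  then show "0 \<in> ?B" by blast
next
  fix u v assume "u \<in> ?B" "v \<in> ?B"
  then obtain a b where "u - rs y a \<in> C" "v - rs y b \<in> C" by auto
  then have "(u - rs y a) + (v - rs y b) \<in> C" by (rule dsub_add[OF assms])
  moreover have "(u - rs y a) + (v - rs y b) = u + v - rs y (a + b)" by (simp add: rs_add_right)
  ultimately have "u + v - rs y (a + b) \<in> C" by simp
  then show "u + v \<in> ?B" by blast
next
  fix v a assume "v \<in> ?B"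
  then obtain b where "v - rs y b \<in> C" by auto
  then have "rs (v - rs y b) a \<in> C" by (rule dsub_rs[OF assms])
  then have "rs v a - rs y (b * a) \<in> C" by (simp add: rs_diff rs_mult)
  then show "rs v a \<in> ?B" by blast
qed

text \<open>Among the \<open>D\<close>-subspaces of \<open>V\<close> containing \<open>W\<close> but
  not \<open>x\<close>, one of largest \<open>F\<close>-dimension works: if \<open>v\<close> were
  outside \<open>C + x D\<close>, then \<open>C + v D\<close> would still avoid
  \<open>x\<close>.\<close>

lemma hcomp_exists:
  assumes V: "dsub V" "V.vfin V" and W: "dsub W" "W \<subseteq> V" and x: "x \<in> V" "x \<notin> W"
  obtains C where "W \<subseteq> C" "hcomp x V C"
proof -
  obtain C where C: "dsub C \<and> W \<subseteq> C \<and> C \<subseteq> V \<and> x \<notin> C"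
    and mx: "\<And>B. dsub B \<and> W \<subseteq> B \<and> B \<subseteq> V \<and> x \<notin> B \<Longrightarrow> V.vdim B \<le> V.vdim C"
    by (rule V.max_dim_exists[of "\<lambda>C. dsub C \<and> W \<subseteq> C \<and> C \<subseteq> V \<and> x \<notin> C" "\<lambda>C. C" V W])
      (use W x V dsub_sub in auto)
  have "\<exists>a. v - rs x a \<in> C" if v: "v \<in> V" for v
  proof (rule ccontr)
    assume no: "\<nexists>a. v - rs x a \<in> C"
    then have no': "v - rs x a \<notin> C" for a by simp
    let ?B = "{u. \<exists>b. u - rs v b \<in> C}"
    have B: "dsub ?B" using C by (intro dsub_add_line) simp
    have CB: "u \<in> ?B" if "u \<in> C" for u
    proof -
      have "u - rs v 0 \<in> C" using that by simp
      then show ?thesis by blast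
    qed
    have BV: "u \<in> V" if "u \<in> ?B" for u
    proof -
      obtain b where "u - rs v b \<in> C" using \<open>u \<in> ?B\<close> by auto
      then have "u - rs v b \<in> V" "rs v b \<in> V" using C v V by (auto simp: dsub_rs)
      then have "(u - rs v b) + rs v b \<in> V" by (rule dsub_add[OF V(1)])
      then show ?thesis by simp
    qed
    have xB: "x \<notin> ?B"
    proof
      assume "x \<in> ?B"
      then obtain b where b: "x - rs v b \<in> C" by auto
      then have "b \<noteq> 0" using C by auto
      \<comment> \<open>Dividing by \<open>- b\<close> exchanges the roles of \<open>x\<close> and
        \<open>v\<close>.\<close>
      have "rs (x - rs v b) (- inverse b) \<in> C" using C b by (simp add: dsub_rs)
      moreover have "rs (x - rs v b) (- inverse b) = v - rs x (inverse b)"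
        using \<open>b \<noteq> 0\<close> by (simp add: rs_diff rs_minus_right rs_mult[symmetric])
      ultimately show False using no'[of "inverse b"] by simp
    qed
    have nC: "v \<notin> C" using no'[of 0] by simp
    have "v - rs v 1 \<in> C" using C dsub_0 by simp
    then have "v \<in> ?B" by blast
    then have "C \<subset> ?B" using nC CB by (rule psubset_witness)
    then have "V.vdim C < V.vdim ?B"
      using C by (intro V.dim_less dsub_sub B V.fin_subset(1)[OF dsub_sub[OF V(1)] dsub_sub[OF B] _ V(2)] subsetI BV) simp_all
    moreover have "V.vdim ?B \<le> V.vdim C"
    proof (rule mx, intro conjI B xB)
      show "W \<subseteq> ?B" by (rule subsetI, rule CB) (use C in auto)
      show "?B \<subseteq> V" by (rule subsetI, rule BV)
    qed
    ultimately show False by simp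
  qed
  then show ?thesis using that[of C] C x by (simp add: hcomp_def)
qed

lemma hcompD:
  assumes "hcomp x V C"
  shows hcomp_dsub: "dsub C" and hcomp_subset: "C \<subseteq> V" and hcomp_in: "x \<in> V" and hcomp_notin: "x \<notin> C"
  using assms by (auto simp: hcomp_def)

lemma cf_eq:
  assumes h: "hcomp x V C" and a: "v - rs x a \<in> C"
  shows "cf x C v = a"
proof -
  have "v - rs x (cf x C v) \<in> C" unfolding cf_def using a by (rule someI)
  then have "(v - rs x a) - (v - rs x (cf x C v)) \<in> C" by (rule dsub_diff[OF hcomp_dsub[OF h] a])
  then have "rs x (cf x C v - a) \<in> C" by (simp add: rs_diff_right)
  then show ?thesis using dsub_rs_iff[OF hcomp_dsub[OF h], of "cf x C v - a" x] hcomp_notin[OF h]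
    by (cases "cf x C v = a") simp_all
qed

lemma cf_mem:
  assumes h: "hcomp x V C" and v: "v \<in> V" shows "v - rs x (cf x C v) \<in> C"
proof -
  obtain a where "v - rs x a \<in> C" using h v by (auto simp: hcomp_def)
  then show ?thesis unfolding cf_def by (rule someI)
qed

lemma cf_add: "hcomp x V C \<Longrightarrow> u \<in> V \<Longrightarrow> v \<in> V \<Longrightarrow> cf x C (u + v) = cf x C u + cf x C v"
  using dsub_add[OF hcomp_dsub cf_mem cf_mem, of x V C x V u x V v]
  by (intro cf_eq) (simp_all add: rs_add_right algebra_simps)

lemma cf_rs: "hcomp x V C \<Longrightarrow> v \<in> V \<Longrightarrow> cf x C (rs v a) = cf x C v * a"
  using dsub_rs[OF hcomp_dsub cf_mem, of x V C x V v a]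
  by (intro cf_eq) (simp_all add: rs_diff rs_mult)

lemma cf_x: "hcomp x V C \<Longrightarrow> cf x C x = 1"
  using dsub_0[OF hcomp_dsub] by (intro cf_eq) simp_all

lemma cf_0: "hcomp x V C \<Longrightarrow> v \<in> C \<Longrightarrow> cf x C v = 0"
  by (intro cf_eq) simp_all

lemma cf_0_iff: "hcomp x V C \<Longrightarrow> v \<in> V \<Longrightarrow> cf x C v = 0 \<longleftrightarrow> v \<in> C"
  using cf_mem[of x V C v] cf_0 by force

lemma cf_line: "hcomp x V C \<Longrightarrow> cf x C (rs x a) = a"
  by (simp add: cf_rs[OF _ hcomp_in] cf_x)

lemma dim_hcomp:
  assumes h: "hcomp x V C" and V: "dsub V" "V.vfin V"
  shows "V.vdim V = dg + V.vdim C"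
proof -
  have l: "flin F scv (*) V (cf x C)"
    by (intro flinI) (simp add: cf_add[OF h], simp add: cf_rs[OF h], rule F_comm[symmetric])
  have "cf x C ` V = UNIV"
  proof (rule equalityI[OF subset_UNIV], rule subsetI)
    fix a
    have "rs x a \<in> V" by (rule dsub_rs[OF V(1) hcomp_in[OF h]])
    then show "a \<in> cf x C ` V" using cf_line[OF h, of a] by force
  qed
  moreover have "{v \<in> V. cf x C v = 0} = C" using cf_0_iff[OF h] hcomp_subset[OF h] by auto
  ultimately show ?thesis using VD.rank_nullity(2)[OF dsub_sub[OF V(1)] l V(2)] by simp
qed

text \<open>An operator killing \<open>x\<close> is determined on \<open>C\<close>, because
  \<open>V = x D + C\<close>. The kernel of evaluation thus becomes a space on \<open>C\<close>
  without any change to its elements, which is what the inductions need.\<close>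

lemma tss_ker:
  assumes S: "tss V S" and h: "hcomp x V C" and V: "dsub V"
    and C: "\<And>M c. M \<in> S \<Longrightarrow> M x = 0 \<Longrightarrow> c \<in> C \<Longrightarrow> M c \<in> C"
  shows "tss C {M \<in> S. M x = 0}"
  unfolding tss_def
proof (intro conjI ballI impI allI)
  show "O.vsub {M \<in> S. M x = 0}" by (rule ker_sub[OF tss_sub[OF S]])
  fix M assume "M \<in> {M \<in> S. M x = 0}"
  then have M: "M \<in> S" "M x = 0" by simp_all
  note CV = subsetD[OF hcomp_subset[OF h]]
  show "dlin C M" using M C CV S by (auto simp: dlin_def tss_add tss_rs)
  show "v \<in> C \<Longrightarrow> M v = v \<Longrightarrow> v = 0" for v using tss_fix[OF S M(1) CV] .
  assume 0: "\<forall>v\<in>C. M v = 0"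
  show "M = 0"
  proof (rule tss_zero[OF S M(1)])
    fix v assume v: "v \<in> V"
    have 1: "v - rs x (cf x C v) \<in> C" by (rule cf_mem[OF h v])
    have 2: "rs x (cf x C v) \<in> V" by (rule dsub_rs[OF V hcomp_in[OF h]])
    have "M v = M ((v - rs x (cf x C v)) + rs x (cf x C v))" by simp
    also have "\<dots> = M (v - rs x (cf x C v)) + rs (M x) (cf x C v)"
      using tss_add[OF S M(1) CV[OF 1] 2] tss_rs[OF S M(1) hcomp_in[OF h]] by simp
    also have "\<dots> = 0" using 0 1 M(2) by simp
    finally show "M v = 0" .
  qed
qed

end

section \<open>The upper bound and the case of equality\<close>

locale rspace_fin = rspace F rs for F :: "'a::division_ring set" and rs :: "'v::ab_group_add \<Rightarrow> 'a \<Rightarrow> 'v" +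
  assumes fin_D: "ffin F (*) (UNIV :: 'a set)"
begin

lemma dg_pos: "0 < dg"
proof (rule ccontr)
  assume "\<not> 0 < dg"
  then have "(UNIV :: 'a set) = {0}" using D.dim_eq_0[OF D.sub_UNIV fin_D] by simp
  then have "(1 :: 'a) = 0" by (metis UNIV_I singletonD)
  then show False by simp
qed

text \<open>The vector \<open>x\<close> itself is missing from \<open>S x\<close>, as
  \<open>M x = x\<close> is excluded. This is the source of the \<open>- 1\<close> in
  \<open>tdim\<close>.\<close>

lemma ev_dim_less:
  assumes V: "dsub V" "V.vfin V" and S: "tss V S" and x: "x \<in> V" "x \<noteq> 0"
  shows "V.vdim ((\<lambda>M. M x) ` S) < V.vdim V"
proof (rule V.dim_less[OF dsub_sub[OF V(1)] ev_sub[OF S] _ V(2)])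
  have "x \<notin> (\<lambda>M. M x) ` S"
  proof
    assume "x \<in> (\<lambda>M. M x) ` S"
    then obtain M where "M \<in> S" "M x = x" by auto
    then show False using tss_fix[OF S _ x(1)] x(2) by simp
  qed
  then show "(\<lambda>M. M x) ` S \<subset> V" using ev_subset[OF S x(1)] x(1) by auto
qed

lemma good_vector:
  assumes V: "dsub V" "V.vfin V" "V \<noteq> {0}" and S: "tss V S" and card: "infinite F \<or> V.vdim V \<le> card F"
  obtains x where "x \<in> V" "x \<noteq> 0" "\<forall>N\<in>S. N x = 0 \<longrightarrow> (\<forall>y\<in>V. N y \<in> (\<lambda>M. M x) ` S)"
proof -
  obtain x0 where x0: "x0 \<in> V" "x0 \<noteq> 0" using V(3) dsub_0[OF V(1)] by (rule not_zeroE)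
  obtain x where x: "x \<in> V \<and> x \<noteq> 0"
    and mx: "\<And>y. y \<in> V \<and> y \<noteq> 0 \<Longrightarrow> V.vdim ((\<lambda>M. M y) ` S) \<le> V.vdim ((\<lambda>M. M x) ` S)"
    by (rule V.max_dim_exists[of "\<lambda>x. x \<in> V \<and> x \<noteq> 0" "\<lambda>x. (\<lambda>M. M x) ` S" V x0])
      (use x0 ev_sub[OF S] ev_subset[OF S] V dsub_sub in auto)
  have r: "V.vdim ((\<lambda>M. M x) ` S) < V.vdim V" using ev_dim_less[OF V(1,2) S] x by simp
  have M0: "M 0 = 0" if "M \<in> S" for M
    using tss_rs[OF S that dsub_0[OF V(1)], of 0] by simp
  have e0: "(\<lambda>M. M 0) ` S = {0}"
  proof
    show "{0} \<subseteq> (\<lambda>M. M 0) ` S" using fsub_0[OF ev_sub[OF S]] by simp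
  qed (use M0 in auto)
  show ?thesis
  proof (rule that[of x])
    show "\<forall>N\<in>S. N x = 0 \<longrightarrow> (\<forall>y\<in>V. N y \<in> (\<lambda>M. M x) ` S)"
    proof (intro ballI impI)
      fix N y assume N: "N \<in> S" "N x = 0" "y \<in> V"
      show "N y \<in> (\<lambda>M. M x) ` S"
      proof (rule atkinson[OF V(1,2) S _ _ _ N])
        \<comment> \<open>The maximum was taken over nonzero vectors; at 0 the value space is
          0.\<close>
        show "V.vdim ((\<lambda>M. M z) ` S) \<le> V.vdim ((\<lambda>M. M x) ` S)" if "z \<in> V" for z
          using mx[of z] that e0 by (cases "z = 0") simp_all
        show "infinite F \<or> V.vdim ((\<lambda>M. M x) ` S) < card F" using card r by auto
      qed (use x in simp)
    qed
  qed (use x in simp_all)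
qed

lemma good_step:
  assumes V: "dsub V" "V.vfin V" "V \<noteq> {0}" and S: "tss V S" and card: "infinite F \<or> V.vdim V \<le> card F"
  obtains x W where "x \<in> V" "x \<noteq> 0" "dsub W" "W \<subseteq> V" "x \<notin> W" "W \<subseteq> (\<lambda>M. M x) ` S"
    "\<forall>N\<in>S. N x = 0 \<longrightarrow> (\<forall>y\<in>V. N y \<in> W)"
proof -
  obtain x where x: "x \<in> V" "x \<noteq> 0" "\<forall>N\<in>S. N x = 0 \<longrightarrow> (\<forall>y\<in>V. N y \<in> (\<lambda>M. M x) ` S)"
    by (rule good_vector[OF assms])
  let ?E = "(\<lambda>M. M x) ` S"
  \<comment> \<open>The largest \<open>D\<close>-subspace inside \<open>S x\<close>. For
    \<open>N\<close> in \<open>S\<close> with \<open>N x = 0\<close>, the image of \<open>V\<close>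
    under \<open>N\<close> is a \<open>D\<close>-subspace of \<open>S x\<close> and so falls into
    \<open>?W\<close>.\<close>
  let ?W = "{y. \<forall>a. rs y a \<in> ?E}"
  have WE: "?W \<subseteq> ?E"
  proof
    fix y assume "y \<in> ?W"
    then have "rs y 1 \<in> ?E" by blast
    then show "y \<in> ?E" by simp
  qed
  show ?thesis
  proof (rule that[of x ?W], rule x, rule x)
    show "dsub ?W" unfolding dsub_def
      using fsub_0[OF ev_sub[OF S, of x]] fsub_add[OF ev_sub[OF S, of x]]
      by (simp add: rs_add rs_mult[symmetric])
    show "?W \<subseteq> V" using WE ev_subset[OF S x(1)] by (rule subset_trans)
    show "x \<notin> ?W"
    proof
      assume "x \<in> ?W"
      then have "x \<in> ?E" using WE by (rule rev_subsetD)
      then obtain M where "M \<in> S" "M x = x" by auto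
      then show False using tss_fix[OF S _ x(1)] x(2) by simp
    qed
    show "?W \<subseteq> ?E" by (rule WE)
    show "\<forall>N\<in>S. N x = 0 \<longrightarrow> (\<forall>y\<in>V. N y \<in> ?W)"
    proof (intro ballI impI CollectI allI)
      fix N y a assume N: "N \<in> S" "N x = 0" "y \<in> V"
      then have "N (rs y a) \<in> ?E" using x(3) dsub_rs[OF V(1) N(3), of a] by simp
      then show "rs (N y) a \<in> ?E" using tss_rs[OF S N(1,3)] by simp
    qed
  qed
qed

lemma dim_ev: "dsub V \<Longrightarrow> V.vfin V \<Longrightarrow> tss V S \<Longrightarrow>
    O.vdim S = V.vdim ((\<lambda>M. M x) ` S) + O.vdim {M \<in> S. M x = 0}"
  using OV.rank_nullity(2)[OF tss_sub flin_ev fin_ops] by simp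

lemma tss_bound:
  assumes "dsub V" "V.vfin V" "V.vdim V = n * dg" "tss V S" "infinite F \<or> n * dg \<le> card F"
  shows "O.vdim S \<le> tdim dg n"
  using assms
proof (induction n arbitrary: V S)
  case 0
  then have V0: "V = {0}" using V.dim_eq_0[OF dsub_sub] by simp
  have "M = 0" if "M \<in> S" for M
  proof (rule tss_zero[OF 0(4) that])
    fix v assume "v \<in> V"
    then show "M v = 0" using V0 tss_closed[OF 0(4) that] by simp
  qed
  then have "S = {0}" using fsub_0[OF tss_sub[OF 0(4)]] by auto
  then show ?case by (simp only: O.dim_zero)
next
  case (Suc n)
  note V = Suc.prems(1,2) and S = Suc.prems(4)
  have ne: "V \<noteq> {0}"
  proof
    assume "V = {0}"
    then show False using Suc.prems(3) dg_pos by simp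
  qed
  have card: "infinite F \<or> V.vdim V \<le> card F" using Suc.prems by simp
  obtain x W where x: "x \<in> V" "x \<noteq> 0" and W: "dsub W" "W \<subseteq> V" "x \<notin> W" "W \<subseteq> (\<lambda>M. M x) ` S"
    "\<forall>N\<in>S. N x = 0 \<longrightarrow> (\<forall>y\<in>V. N y \<in> W)"
    by (rule good_step[OF V ne S card])
  obtain C where C: "W \<subseteq> C" "hcomp x V C" by (rule hcomp_exists[OF V W(1,2) x(1) W(3)])
  have T: "tss C {M \<in> S. M x = 0}"
    by (rule tss_ker[OF S C(2) V(1)]) (use W(5) C hcomp_subset[OF C(2)] in \<open>simp add: subset_iff\<close>)
  have "O.vdim {M \<in> S. M x = 0} \<le> tdim dg n"
  proof (rule Suc.IH[OF hcomp_dsub[OF C(2)] _ _ T])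
    show "V.vfin C" by (rule V.fin_subset(1)[OF dsub_sub[OF V(1)] dsub_sub[OF hcomp_dsub[OF C(2)]] hcomp_subset[OF C(2)] V(2)])
    show "V.vdim C = n * dg" using dim_hcomp[OF C(2) V] Suc.prems(3) by simp
    show "infinite F \<or> n * dg \<le> card F" using Suc.prems(5) by auto
  qed
  moreover have "V.vdim ((\<lambda>M. M x) ` S) \<le> Suc n * dg - 1"
    using ev_dim_less[OF V S x] Suc.prems(3) by simp
  ultimately show ?case using dim_ev[OF V S, of x] by simp
qed

text \<open>Both estimates in the induction step for the bound are sharp here: \<open>S x\<close>
  misses only one dimension of \<open>V\<close>, and the elements killing \<open>x\<close> reach the
  bound on \<open>C\<close>. What remains is to see that \<open>W\<close> fills the whole of
  \<open>C\<close>.\<close>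

lemma optimal_structure:
  assumes V: "dsub V" "V.vfin V" "V.vdim V = Suc n * dg" and S: "tss V S" and card: "infinite F \<or> Suc n * dg \<le> card F"
    and dg2: "2 \<le> dg" and opt: "tdim dg (Suc n) \<le> O.vdim S"
  obtains x C where "hcomp x V C" "x \<noteq> 0" "tss C {M \<in> S. M x = 0}" "tdim dg n \<le> O.vdim {M \<in> S. M x = 0}"
    "C \<subseteq> (\<lambda>M. M x) ` S" "V.vdim V \<le> V.vdim ((\<lambda>M. M x) ` S) + 1"
    "\<forall>N\<in>S. N x = 0 \<longrightarrow> (\<forall>y\<in>V. N y \<in> C)"
proof -
  have ne: "V \<noteq> {0}"
  proof
    assume "V = {0}"
    then show False using V(3) dg_pos by simp
  qed
  have card': "infinite F \<or> V.vdim V \<le> card F" using card V(3) by simp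
  have cardn: "infinite F \<or> n * dg \<le> card F" using card by auto
  obtain x W where x: "x \<in> V" "x \<noteq> 0" and W: "dsub W" "W \<subseteq> V" "x \<notin> W" "W \<subseteq> (\<lambda>M. M x) ` S"
    "\<forall>N\<in>S. N x = 0 \<longrightarrow> (\<forall>y\<in>V. N y \<in> W)"
    by (rule good_step[OF V(1,2) ne S card'])
  obtain C where C: "W \<subseteq> C" "hcomp x V C" by (rule hcomp_exists[OF V(1,2) W(1,2) x(1) W(3)])
  let ?T = "{M \<in> S. M x = 0}"
  note Cd = hcomp_dsub[OF C(2)] and CV = hcomp_subset[OF C(2)]
  have T: "tss C ?T"
    by (rule tss_ker[OF S C(2) V(1)]) (use W(5) C CV in \<open>simp add: subset_iff\<close>)
  have Cf: "V.vfin C" by (rule V.fin_subset(1)[OF dsub_sub[OF V(1)] dsub_sub[OF Cd] CV V(2)])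
  have Cn: "V.vdim C = n * dg" using dim_hcomp[OF C(2) V(1,2)] V(3) by simp
  have b: "O.vdim ?T \<le> tdim dg n" by (rule tss_bound[OF Cd Cf Cn T cardn])
  have l: "V.vdim ((\<lambda>M. M x) ` S) < Suc n * dg" using ev_dim_less[OF V(1,2) S x] V(3) by simp
  have e: "V.vdim ((\<lambda>M. M x) ` S) + O.vdim ?T \<ge> tdim dg n + (Suc n * dg - 1)"
    using opt dim_ev[OF V(1,2) S, of x] by simp
  have Td: "tdim dg n \<le> O.vdim ?T" using e l by linarith
  \<comment> \<open>Otherwise the elements killing \<open>x\<close> would send \<open>y\<close> into
    the \<open>D\<close>-hyperplane \<open>C'\<close> of \<open>C\<close>, of dimension
    \<open>m * dg\<close> where sharpness requires \<open>Suc m * dg - 1\<close>. That loses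
    \<open>dg - 1\<close> dimensions, at least one.\<close>
  have "C \<subseteq> W"
  proof (rule ccontr)
    assume "\<not> C \<subseteq> W"
    then obtain y where y: "y \<in> C" "y \<notin> W" by auto
    obtain C' where C': "W \<subseteq> C'" "hcomp y C C'" by (rule hcomp_exists[OF Cd Cf W(1) C(1) y])
    have dC: "V.vdim C = dg + V.vdim C'" by (rule dim_hcomp[OF C'(2) Cd Cf])
    then obtain m where n: "n = Suc m" using Cn dg_pos by (cases n) simp_all
    then have C'n: "V.vdim C' = m * dg" using dC Cn by simp
    note C'd = hcomp_dsub[OF C'(2)] and C'C = hcomp_subset[OF C'(2)]
    have C'f: "V.vfin C'" by (rule V.fin_subset(1)[OF dsub_sub[OF Cd] dsub_sub[OF C'd] C'C Cf])
    have TC': "M c \<in> C'" if "M \<in> ?T" "c \<in> C" for M c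
      using that W(5) C'(1) CV by (simp add: subset_iff)
    have U: "tss C' {M \<in> ?T. M y = 0}"
    proof (rule tss_ker[OF T C'(2) Cd])
      show "M c \<in> C'" if "M \<in> ?T" "c \<in> C'" for M c by (rule TC'[OF that(1) subsetD[OF C'C that(2)]])
    qed
    have "O.vdim {M \<in> ?T. M y = 0} \<le> tdim dg m"
      using cardn n by (intro tss_bound[OF C'd C'f C'n U]) auto
    moreover have "V.vdim ((\<lambda>M. M y) ` ?T) \<le> m * dg"
    proof -
      have "(\<lambda>M. M y) ` ?T \<subseteq> C'" using TC'[OF _ y(1)] by auto
      then show ?thesis using V.fin_subset(2)[OF dsub_sub[OF C'd] ev_sub[OF T] _ C'f] C'n by simp
    qed
    ultimately have "O.vdim ?T \<le> tdim dg m + m * dg" using dim_ev[OF Cd Cf T, of y] by simp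
    then have "Suc m * dg - 1 \<le> m * dg" using Td n by simp
    then show False using dg2 by simp
  qed
  then have CW: "C = W" using C(1) by simp
  show ?thesis
  proof (rule that[OF C(2) x(2) T Td])
    show "C \<subseteq> (\<lambda>M. M x) ` S" using W(4) CW by simp
    show "V.vdim V \<le> V.vdim ((\<lambda>M. M x) ` S) + 1" using e b V(3) by simp
    show "\<forall>N\<in>S. N x = 0 \<longrightarrow> (\<forall>y\<in>V. N y \<in> C)" using W(5) CW by simp
  qed
qed

end

section \<open>A dichotomy for linear forms\<close>

context central
begin

text \<open>The normalisation at 1 makes such a form the projection of \<open>D\<close> to
  \<open>F\<close> along its kernel, an \<open>F\<close>-hyperplane avoiding 1.\<close>

definition normal_form :: "('a \<Rightarrow> 'a) \<Rightarrow> bool" where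
  "normal_form lam \<longleftrightarrow> (\<forall>b. lam b \<in> F) \<and> (\<forall>b c. lam (b + c) = lam b + lam c) \<and>
     (\<forall>k\<in>F. \<forall>b. lam (k * b) = k * lam b) \<and> lam 1 = 1"

lemma normal_formD:
  assumes "normal_form lam"
  shows nf_F: "lam b \<in> F" and nf_add: "lam (b + c) = lam b + lam c"
    and nf_mult: "k \<in> F \<Longrightarrow> lam (k * b) = k * lam b" and nf_1: "lam 1 = 1"
    and nf_0: "lam 0 = 0" and nf_minus: "lam (- b) = - lam b" and nf_diff: "lam (b - c) = lam b - lam c"
proof -
  show 1: "lam b \<in> F" "\<And>b c. lam (b + c) = lam b + lam c"
    "\<And>k b. k \<in> F \<Longrightarrow> lam (k * b) = k * lam b" "lam 1 = 1"
    using assms by (auto simp: normal_form_def)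
  show 2: "lam 0 = 0" using 1(2)[of 0 0] by simp
  show 3: "lam (- b) = - lam b" for b using 1(2)[of b "- b"] 2 by (simp add: minus_unique)
  show "lam (b - c) = lam b - lam c" using 1(2)[of b "- c"] 3 by simp
qed

lemma form_exists:
  assumes Q: "fsub F (*) Q" "1 \<notin> Q" "\<And>b. \<exists>f\<in>F. b - f \<in> Q"
  obtains lam where "normal_form lam" "\<forall>b. lam b = 0 \<longleftrightarrow> b \<in> Q"
proof -
  interpret D: fspace F "(*)" by unfold_locales (simp_all add: algebra_simps)
  define lam where "lam b = (SOME f. f \<in> F \<and> b - f \<in> Q)" for b
  have "lam b \<in> F \<and> b - lam b \<in> Q" for b
    unfolding lam_def by (rule someI_ex) (use Q(3)[of b] in auto)
  then have lam: "\<And>b. lam b \<in> F" "\<And>b. b - lam b \<in> Q" by simp_all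
  have uniq: "lam b = f" if f: "f \<in> F" "b - f \<in> Q" for b f
  proof (rule ccontr)
    assume "lam b \<noteq> f"
    then have nz: "lam b - f \<noteq> 0" by simp
    have "(b - f) - (b - lam b) \<in> Q" by (rule D.sub_diff[OF Q(1) f(2) lam(2)])
    then have "lam b - f \<in> Q" by simp
    then have "inverse (lam b - f) * (lam b - f) \<in> Q"
      by (rule fsub_sc[OF Q(1) F_inverse[OF F_diff[OF lam(1) f(1)]]])
    then show False using nz Q(2) by simp
  qed
  have "normal_form lam"
    unfolding normal_form_def
  proof (intro conjI allI ballI)
    show "lam b \<in> F" for b by (rule lam)
    show "lam (b + c) = lam b + lam c" for b c
      using fsub_add[OF Q(1) lam(2)[of b] lam(2)[of c]] F_add[OF lam(1) lam(1)]
      by (intro uniq) (simp_all add: algebra_simps)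
    show "lam (k * b) = k * lam b" if "k \<in> F" for k b
      using fsub_sc[OF Q(1) that lam(2)[of b]] F_mult[OF that lam(1)] by (intro uniq) (simp_all add: algebra_simps)
    show "lam 1 = 1" using fsub_0[OF Q(1)] by (intro uniq) simp_all
  qed
  moreover have "\<forall>b. lam b = 0 \<longleftrightarrow> b \<in> Q"
  proof
    show "lam b = 0 \<longleftrightarrow> b \<in> Q" for b using uniq[of 0 b] lam(2)[of b] by auto
  qed
  ultimately show ?thesis by (rule that)
qed

definition all_quadratic :: bool where
  "all_quadratic \<longleftrightarrow> (\<forall>z. \<exists>e\<in>F. \<exists>f\<in>F. z * z = e + f * z)"

text \<open>Polarising \<open>J z * z\<close> puts \<open>J z * w + J w * z\<close> into
  \<open>F\<close>; for \<open>w = 1\<close>, multiplication by \<open>z\<close> gives the equation,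
  once \<open>J 1\<close> is known to be nonzero. If \<open>J 1 = 0\<close>, then
  \<open>J z0\<close> lies in \<open>F\<close>, hence so does \<open>z0\<close>, and
  \<open>J z0 = z0 * J 1 = 0\<close>.\<close>

lemma all_quadratic_if_adjoint:
  assumes J: "\<And>z w. J (z + w) = J z + J w" "\<And>k z. k \<in> F \<Longrightarrow> J (k * z) = k * J z"
    and JF: "\<And>z. J z * z \<in> F" and ne: "J z0 \<noteq> 0"
  shows all_quadratic
  unfolding all_quadratic_def
proof
  have b: "J z * w + J w * z \<in> F" for z w
  proof -
    have "J z * w + J w * z = J (z + w) * (z + w) - J z * z - J w * w"
      by (simp add: J algebra_simps)
    then show ?thesis using JF F_diff by simp
  qed
  have k: "J 1 \<in> F" using JF[of 1] by simp
  have k0: "J 1 \<noteq> 0"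
  proof
    assume 0: "J 1 = 0"
    have z0: "z0 \<noteq> 0" using ne J(2)[of 0 0] by auto
    have 1: "J z0 \<in> F" using b[of z0 1] 0 by simp
    have "inverse (J z0) * (J z0 * z0) \<in> F" by (rule F_mult[OF F_inverse[OF 1] JF])
    then have "z0 \<in> F" using ne by (simp add: mult.assoc[symmetric])
    then have "J z0 = z0 * J 1" using J(2)[of z0 1] by simp
    then show False using 0 ne by simp
  qed
  fix z
  let ?b = "J z * 1 + J 1 * z" and ?i = "inverse (J 1)"
  have iF: "?i \<in> F" using k by auto
  have "J 1 * (z * z) = ?b * z - J z * z" by (simp add: algebra_simps)
  then have "?i * (J 1 * (z * z)) = ?i * (?b * z - J z * z)" by (rule arg_cong)
  moreover have "?i * (J 1 * (z * z)) = z * z" using k0 by (simp only: mult.assoc[symmetric] left_inverse) simp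
  ultimately have "z * z = - (?i * (J z * z)) + (?i * ?b) * z" by (simp only: right_diff_distrib mult.assoc) simp
  moreover have "- (?i * (J z * z)) \<in> F" by (rule F_minus[OF F_mult[OF iF JF]])
  moreover have "?i * ?b \<in> F" by (rule F_mult[OF iF b])
  ultimately show "\<exists>e\<in>F. \<exists>f\<in>F. z * z = e + f * z" by (rule_tac bexI, rule_tac bexI)
qed

text \<open>Once \<open>main\<close> is made polynomial, comparing coefficients shows that a nonzero
  \<open>beta\<close> would have an adjoint \<open>J\<close> as in
  \<open>all_quadratic_if_adjoint\<close>. In the application \<open>a\<close> and \<open>c\<close>
  are the corner entries in the column of \<open>x\<close>, \<open>alpha a + beta c\<close> is the
  upper entry in the column of \<open>y\<close>, and \<open>phi c\<close> is \<open>lam\<close> of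
  the lower one.\<close>

lemma linear_forms_dichotomy:
  assumes lam: "normal_form lam" and mu: "normal_form mu"
    and s: "s \<in> F" "s \<noteq> 0" "s \<noteq> 1"
    and al: "\<And>h k. mu h = 0 \<Longrightarrow> k \<in> F \<Longrightarrow> alpha (k * h) = k * alpha h"
    and be: "\<And>b c. beta (b + c) = beta b + beta c" "\<And>k c. k \<in> F \<Longrightarrow> beta (k * c) = k * beta c"
    and ph: "\<And>b c. phi (b + c) = phi b + phi c" "\<And>k c. k \<in> F \<Longrightarrow> phi (k * c) = k * phi c"
    and phF: "\<And>c. phi c \<in> F"
    and main: "\<And>a c. mu a = 0 \<Longrightarrow> lam (c * inverse (1 - a) * (alpha a + beta c)) + phi c \<noteq> 1"
    and nq: "\<not> all_quadratic"
  shows "mu h = 0 \<Longrightarrow> alpha h = 0" "beta c = 0"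
proof -
  have F1: "z * f = f * z" if "f \<in> F" for z f using F_comm[OF that] by simp
  define ell where "ell z h = lam (z * beta (z * h))" for z h
  define L where "L z h = phi (z * h) - lam (z * alpha h)" for z h
  have ellF: "ell z h \<in> F" and LF: "mu h = 0 \<Longrightarrow> L z h \<in> F" for z h
    using nf_F[OF lam] phF by (auto simp: ell_def L_def)
  have ell_add: "ell z (h + h') = ell z h + ell z h'" for z h h'
    by (simp add: ell_def be nf_add[OF lam] distrib_left)
  have ell_mult: "ell z (k * h) = k * ell z h" if "k \<in> F" for z h k
    using that be(2)[of k "z * h"] nf_mult[OF lam, of k "z * beta (z * h)"] F_comm[OF that, of z]
    by (simp add: ell_def mult.assoc[symmetric])
  have L_mult: "L z (k * h) = k * L z h" if "k \<in> F" "mu h = 0" for z h k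
  proof -
    have "z * (k * h) = k * (z * h)" "z * (k * alpha h) = k * (z * alpha h)"
      using F_comm[OF that(1), of z] by (simp_all add: mult.assoc[symmetric])
    then show ?thesis using that
      by (simp add: L_def al ph(2) nf_mult[OF lam] right_diff_distrib)
  qed
  \<comment> \<open>The substitution \<open>c = z * (m + h)\<close>,
    \<open>a = - inverse m * h\<close> removes the inverse:
    \<open>1 - a = inverse m * (m + h)\<close>, so \<open>c * inverse (1 - a) = z * m\<close>. Here
    \<open>m + h\<close> is nonzero because \<open>mu\<close> takes the value \<open>m\<close> on
    it.\<close>
  have key: "L z h + m * phi z + m * (m * ell z 1 + ell z h) \<noteq> 1"
    if h: "mu h = 0" and m: "m \<in> F" "m \<noteq> 0" for z h m
  proof
    assume eq: "L z h + m * phi z + m * (m * ell z 1 + ell z h) = 1"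
    let ?i = "inverse m" and ?y = "m + h"
    have iF: "?i \<in> F" using m by auto
    have y0: "?y \<noteq> 0"
    proof
      assume "?y = 0"
      then have "mu m = 0" using nf_add[OF mu, of m h] nf_0[OF mu] h by simp
      then show False using nf_mult[OF mu m(1), of 1] nf_1[OF mu] m(2) by simp
    qed
    have mua: "mu (- (?i * h)) = 0" using h by (simp add: nf_minus[OF mu] nf_mult[OF mu iF])
    have "1 - - (?i * h) = ?i * ?y" using m by (simp add: distrib_left)
    then have inv: "inverse (1 - - (?i * h)) = inverse ?y * m"
      using m y0 by (simp add: nonzero_inverse_mult_distrib)
    have al': "alpha (- (?i * h)) = - (?i * alpha h)"
      using al[OF h, of "- ?i"] iF F_minus by simp
    have "?y * (inverse ?y * m) = m" using y0 by (simp only: mult.assoc[symmetric] right_inverse) simp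
    then have "z * ?y * (inverse ?y * m) * (- (?i * alpha h) + beta (z * ?y))
        = z * m * (- (?i * alpha h) + beta (z * ?y))"
      by (simp only: mult.assoc[of z ?y])
    also have "\<dots> = - (z * alpha h) + m * (z * beta (z * ?y))"
    proof -
      have "z * m * (?i * alpha h) = z * alpha h"
      proof -
        have "m * (?i * alpha h) = alpha h" using m(2) by (simp only: mult.assoc[symmetric] right_inverse) simp
        then show ?thesis by (simp only: mult.assoc)
      qed
      moreover have "z * m * beta (z * ?y) = m * (z * beta (z * ?y))"
        by (simp only: F_comm[OF m(1), of z, symmetric] mult.assoc)
      ultimately show ?thesis by (simp only: distrib_left mult_minus_right)
    qed
    finally have X: "lam (z * ?y * inverse (1 - - (?i * h)) * (alpha (- (?i * h)) + beta (z * ?y)))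
        = - lam (z * alpha h) + m * ell z ?y"
      unfolding inv al' using m by (simp add: nf_add[OF lam] nf_diff[OF lam] nf_minus[OF lam] nf_mult[OF lam] ell_def)
    have Y: "ell z ?y = m * ell z 1 + ell z h"
      using ell_add[of z m h] ell_mult[OF m(1), of z 1] by simp
    have Z: "phi (z * ?y) = m * phi z + phi (z * h)"
      using ph(1)[of "z * m" "z * h"] ph(2)[OF m(1), of z] F_comm[OF m(1), of z] by (simp add: distrib_left)
    have "lam (z * ?y * inverse (1 - - (?i * h)) * (alpha (- (?i * h)) + beta (z * ?y))) + phi (z * ?y) = 1"
      using eq unfolding X Y Z L_def by (simp add: algebra_simps)
    then show False using main[OF mua, of "z * ?y"] by contradiction
  qed
  have van: "L z h + m * ell z h = 0" if h: "mu h = 0" and m: "m \<in> F" "m \<noteq> 0" for z h m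
  proof (rule ccontr)
    let ?u = "L z h + m * ell z h" and ?w = "m * phi z + m * (m * ell z 1)"
    assume u: "?u \<noteq> 0"
    have uF: "?u \<in> F" by (intro F_add F_mult LF[OF h] ellF m)
    have wF: "?w \<in> F" by (intro F_add F_mult phF ellF m)
    \<comment> \<open>Replacing \<open>h\<close> by \<open>t * h\<close> turns the left side of
      \<open>key\<close> into the affine function \<open>t * ?u + ?w\<close>; this is the
      \<open>t\<close> at which it would equal 1.\<close>
    define t where "t = (1 - ?w) * inverse ?u"
    have t: "t \<in> F" unfolding t_def by (intro F_mult F_diff F_1 F_inverse uF wF)
    have "L z (t * h) + m * phi z + m * (m * ell z 1 + ell z (t * h)) = t * ?u + ?w"
    proof -
      have "m * (t * ell z h) = t * (m * ell z h)"
        by (simp only: mult.assoc[symmetric] F_comm[OF m(1), of t])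
      then show ?thesis by (simp only: L_mult[OF t h] ell_mult[OF t] distrib_left add_ac)
    qed
    also have "\<dots> = 1" using u by (simp add: t_def mult.assoc)
    finally show False using key[of "t * h" m z] h m nf_mult[OF mu t, of h] by simp
  qed
  \<comment> \<open>The expression in \<open>van\<close> is affine in \<open>m\<close>, so its
    vanishing at 1 and at \<open>s\<close> kills both coefficients.\<close>
  have ell0: "ell z h = 0" and L0: "L z h = 0" if h: "mu h = 0" for z h
  proof -
    have 1: "L z h + ell z h = 0" using van[OF h, of 1 z] by simp
    have 2: "L z h + s * ell z h = 0" using van[OF h s(1,2)] by simp
    have "(s - 1) * ell z h = (L z h + s * ell z h) - (L z h + ell z h)" by (simp add: left_diff_distrib)
    then have "(s - 1) * ell z h = 0" using 1 2 by simp
    then show "ell z h = 0" using s(3) by simp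
    then show "L z h = 0" using 1 by simp
  qed
  have ell_eq: "ell z y = ell z 1 * mu y" for z y
  proof -
    have "mu (y - mu y) = 0"
      using nf_mult[OF mu nf_F[OF mu, of y], of 1] nf_1[OF mu] by (simp add: nf_diff[OF mu])
    then have "ell z (y - mu y) = 0" by (rule ell0)
    then have "ell z y = ell z (mu y * 1)" using ell_add[of z "y - mu y" "mu y"] by simp
    also have "\<dots> = mu y * ell z 1" by (rule ell_mult[OF nf_F[OF mu]])
    finally show ?thesis by (simp add: F_comm[OF nf_F[OF mu]])
  qed
  show b0: "beta c = 0" for c
  proof (rule ccontr)
    assume bc: "beta c \<noteq> 0"
    \<comment> \<open>Putting \<open>y = inverse z * c\<close> into \<open>ell_eq\<close> gives
      \<open>lam (z * beta c) = mu (J z * c)\<close>. As the pairing by \<open>mu\<close> is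
      nondegenerate, \<open>J\<close> inherits \<open>F\<close>-linearity, and
      \<open>J z * z = ell z 1\<close> for nonzero \<open>z\<close>.\<close>
    define J where "J z = ell z 1 * inverse z" for z
    have J: "lam (z * beta c) = mu (J z * c)" for z c
    proof (cases "z = 0")
      case False
      have "lam (z * beta c) = ell z (inverse z * c)" using False by (simp add: ell_def mult.assoc[symmetric])
      also have "\<dots> = ell z 1 * mu (inverse z * c)" by (rule ell_eq)
      also have "\<dots> = mu (J z * c)" by (simp add: J_def nf_mult[OF mu ellF] mult.assoc)
      finally show ?thesis .
    qed (simp add: J_def nf_0[OF lam] nf_0[OF mu])
    have nd: "x = 0" if "\<And>c. mu (x * c) = 0" for x
      using that[of "inverse x"] nf_1[OF mu] by (cases "x = 0") simp_all
    have all_quadratic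
    proof (rule all_quadratic_if_adjoint[of J])
      show "J (z + w) = J z + J w" for z w
      proof -
        have "mu ((J (z + w) - (J z + J w)) * c) = 0" for c
          using J[of "z + w" c] J[of z c] J[of w c]
          by (simp add: left_diff_distrib distrib_right nf_diff[OF mu] nf_add[OF mu] nf_add[OF lam])
        from nd[OF this] show ?thesis by simp
      qed
      show "J (k * z) = k * J z" if "k \<in> F" for k z
      proof -
        have "mu ((J (k * z) - k * J z) * c) = 0" for c
          using J[of "k * z" c] J[of z c] that
          by (simp add: left_diff_distrib nf_diff[OF mu] nf_mult[OF mu] nf_mult[OF lam] mult.assoc)
        from nd[OF this] show ?thesis by simp
      qed
      show "J z * z \<in> F" for z
        using ellF[of z 1] by (cases "z = 0") (simp_all add: J_def mult.assoc)
      have "mu (J (inverse (beta c)) * c) = 1" using J[of "inverse (beta c)" c] bc nf_1[OF lam] by simp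
      then show "J (inverse (beta c)) \<noteq> 0" using nf_0[OF mu] by auto
    qed
    then show False using nq by simp
  qed
  have ph0: "phi z = 0" for z
  proof (rule ccontr)
    assume p: "phi z \<noteq> 0"
    \<comment> \<open>With \<open>h = 0\<close> and \<open>beta = 0\<close>, \<open>key\<close> says
      that no nonzero multiple \<open>m * phi z\<close> equals 1.\<close>
    have "inverse (phi z) \<in> F" "inverse (phi z) \<noteq> 0" using p F_inverse[OF phF] by simp_all
    from key[of 0 "inverse (phi z)" z, OF nf_0[OF mu] this]
    show False using p L0[OF nf_0[OF mu]] ell0[OF nf_0[OF mu]] b0 by (simp add: ell_def nf_0[OF lam])
  qed
  show "alpha h = 0" if h: "mu h = 0"
  proof (rule ccontr)
    assume a: "alpha h \<noteq> 0"
    have "L (inverse (alpha h)) h = - 1" using a by (simp add: L_def ph0 nf_1[OF lam])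
    then show False using L0[OF h] by simp
  qed
qed

end

section \<open>Invariant hyperplanes of optimal spaces\<close>

lemma one_minus_mult: "(1 - p) * q = r \<Longrightarrow> p * q + r = (q :: 'a::ring_1)"
  by (drule sym) (simp add: left_diff_distrib)

text \<open>Coordinates for \<open>V = x D \<oplus> y D \<oplus> U\<close> with \<open>C = y D \<oplus> U\<close>.  Writing \<open>p\<close> for the projection to \<open>C\<close>
  along \<open>x\<close>, the condition \<open>no_fix\<close> comes from a vector \<open>v = x b + w\<close> whose \<open>x\<close>-coordinate is fixed by \<open>M\<close>:
  optimality gives elements \<open>N\<close> of \<open>S\<close> killing \<open>x\<close> and \<open>U\<close> with \<open>N y\<close> arbitrary in the kernel of an
  \<open>F\<close>-linear form that is \<open>lam\<close> on \<open>y D\<close>, and if \<open>lam\<close> took the value \<open>1\<close> on the \<open>y\<close>-coordinate of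
  \<open>p (M v)\<close>, some \<open>M + N\<close> would fix \<open>v\<close>.\<close>

locale frame = rspace F rs
  for F :: "'a::division_ring set" and rs :: "'v::ab_group_add \<Rightarrow> 'a \<Rightarrow> 'v" +
  fixes V C U :: "'v set" and S :: "('v \<Rightarrow> 'v) set" and x y :: 'v and lam mu :: "'a \<Rightarrow> 'a" and s :: 'a
  assumes V: "dsub V" and hx: "hcomp x V C" and hy: "hcomp y C U" and S: "tss V S"
    and lam: "normal_form lam" and mu: "normal_form mu"
    and s: "s \<in> F" "s \<noteq> 0" "s \<noteq> 1"
    and surjC: "\<And>c. c \<in> C \<Longrightarrow> \<exists>M\<in>S. M x = c"
    and surjH: "\<And>a. mu a = 0 \<Longrightarrow> \<exists>M\<in>S. M x = rs x a"
    and muH: "\<And>M. M \<in> S \<Longrightarrow> mu (cf x C (M x)) = 0"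
    and no_fix: "\<And>M b w. M \<in> S \<Longrightarrow> w \<in> C \<Longrightarrow> cf y U w = 1 \<Longrightarrow> cf x C (M (rs x b + w)) = b \<Longrightarrow>
      lam (cf y U (M (rs x b + w) - rs x (cf x C (M (rs x b + w))))) \<noteq> 1"
begin

text \<open>Together with \<open>cf x C\<close> this reads off the corner of \<open>M\<close> on
  \<open>x D + y D\<close>: \<open>a M\<close> and \<open>c M\<close> are the upper and lower entry
  in the column of \<open>x\<close>, and \<open>R M w\<close>, \<open>Y M w\<close> are the upper
  and lower entry at a vector \<open>w\<close>.\<close>

definition cy :: "'v \<Rightarrow> 'a" where "cy v = cf y U (v - rs x (cf x C v))"
abbreviation (input) a :: "('v \<Rightarrow> 'v) \<Rightarrow> 'a" where "a M \<equiv> cf x C (M x)"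
abbreviation (input) c :: "('v \<Rightarrow> 'v) \<Rightarrow> 'a" where "c M \<equiv> cy (M x)"
abbreviation (input) R :: "('v \<Rightarrow> 'v) \<Rightarrow> 'v \<Rightarrow> 'a" where "R M w \<equiv> cf x C (M w)"
abbreviation (input) Y :: "('v \<Rightarrow> 'v) \<Rightarrow> 'v \<Rightarrow> 'a" where "Y M w \<equiv> cy (M w)"

lemmas xV = hcomp_in[OF hx] and yC = hcomp_in[OF hy]
lemmas CV = subsetD[OF hcomp_subset[OF hx]] and UC = subsetD[OF hcomp_subset[OF hy]]
lemmas Cd = hcomp_dsub[OF hx] and Ud = hcomp_dsub[OF hy]
lemmas Ss = tss_sub[OF S]

lemma pr: "v \<in> V \<Longrightarrow> v - rs x (cf x C v) \<in> C"
  by (rule cf_mem[OF hx])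

lemma cy_add: "u \<in> V \<Longrightarrow> v \<in> V \<Longrightarrow> cy (u + v) = cy u + cy v"
  using cf_add[OF hy pr pr, of u v] by (simp add: cy_def cf_add[OF hx] rs_add_right algebra_simps)

lemma cy_rs: "v \<in> V \<Longrightarrow> cy (rs v b) = cy v * b"
  using cf_rs[OF hy pr, of v b] by (simp add: cy_def cf_rs[OF hx] rs_diff rs_mult)

lemma cy_C: "w \<in> C \<Longrightarrow> cy w = cf y U w"
  by (simp add: cy_def cf_0[OF hx])

lemma MV: "M \<in> S \<Longrightarrow> v \<in> V \<Longrightarrow> M v \<in> V"
  by (rule tss_closed[OF S])

text \<open>The scalar \<open>b = inverse (1 - a M) * R M w\<close> solves
  \<open>a M * b + R M w = b\<close>, so \<open>no_fix\<close> applies to \<open>rs x b + w\<close>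
  and the Schur complement remains. The inverse exists since \<open>mu\<close> vanishes at
  \<open>a M\<close> but not at 1.\<close>

lemma fixed: "M \<in> S \<Longrightarrow> w \<in> C \<Longrightarrow> cf y U w = 1 \<Longrightarrow>
   lam (c M * inverse (1 - a M) * R M w + Y M w) \<noteq> 1"
proof -
  assume M: "M \<in> S" and w: "w \<in> C" "cf y U w = 1"
  let ?b = "inverse (1 - a M) * R M w"
  have "a M \<noteq> 1" using muH[OF M] nf_1[OF mu] by auto
  then have b: "(1 - a M) * ?b = R M w" by (simp add: mult.assoc[symmetric])
  have wV: "w \<in> V" by (rule CV[OF w(1)])
  have e: "M (rs x ?b + w) = rs (M x) ?b + M w"
    using tss_add[OF S M dsub_rs[OF V xV] wV] tss_rs[OF S M xV] by simp
  have Mx: "M x \<in> V" and Mw: "M w \<in> V" by (rule MV[OF M xV], rule MV[OF M wV])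
  have Mxb: "rs (M x) ?b \<in> V" by (rule dsub_rs[OF V Mx])
  have "cf x C (M (rs x ?b + w)) = a M * ?b + R M w"
    unfolding e by (simp only: cf_add[OF hx Mxb Mw] cf_rs[OF hx Mx])
  also have "\<dots> = ?b" by (rule one_minus_mult[OF b])
  finally have 1: "cf x C (M (rs x ?b + w)) = ?b" .
  have 2: "cy (M (rs x ?b + w)) = c M * ?b + Y M w"
    unfolding e by (simp only: cy_add[OF Mxb Mw] cy_rs[OF Mx])
  show ?thesis using no_fix[OF M w 1] unfolding cy_def[symmetric] 2 by (simp only: mult.assoc simp_thms)
qed

lemma sum_in: "M \<in> S \<Longrightarrow> N \<in> S \<Longrightarrow> M + N \<in> S" by (rule fsub_add[OF Ss])
lemma scale_in: "M \<in> S \<Longrightarrow> k \<in> F \<Longrightarrow> sco k M \<in> S" using fsub_sc[OF Ss] by simp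
lemma diff_in: "M \<in> S \<Longrightarrow> N \<in> S \<Longrightarrow> M - N \<in> S" by (rule O.sub_diff[OF Ss])

lemma coord_add:
  assumes "M \<in> S" "N \<in> S" "v \<in> V"
  shows "cf x C ((M + N) v) = cf x C (M v) + cf x C (N v)" "cy ((M + N) v) = cy (M v) + cy (N v)"
  using assms by (simp_all only: plus_fun_apply cf_add[OF hx MV MV] cy_add[OF MV MV])

lemma coord_scale:
  assumes "M \<in> S" "v \<in> V"
  shows "cf x C (rs (M v) k) = cf x C (M v) * k" "cy (rs (M v) k) = cy (M v) * k"
  using assms by (simp_all only: cf_rs[OF hx MV] cy_rs[OF MV])

lemma coord_diff:
  assumes "M \<in> S" "N \<in> S" "v \<in> V"
  shows "cf x C ((M - N) v) = cf x C (M v) - cf x C (N v)" "cy ((M - N) v) = cy (M v) - cy (N v)"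
  using coord_add[OF diff_in[OF assms(1,2)] assms(2,3)] by simp_all

text \<open>Adding \<open>rs u t\<close> to \<open>y\<close> keeps the \<open>y\<close>-coordinate
  at 1 and changes the expression in \<open>fixed\<close> by \<open>?g * t\<close>. For nonzero
  \<open>?g\<close> some \<open>t\<close> in \<open>D\<close> would bring it to 1, where
  \<open>lam\<close> is 1.\<close>

lemma G_zero:
  assumes M: "M \<in> S" and u: "u \<in> U"
  shows "c M * inverse (1 - a M) * R M u + Y M u = 0"
proof (rule ccontr)
  let ?k = "c M * inverse (1 - a M)"
  let ?g = "?k * R M u + Y M u" and ?h = "?k * R M y + Y M y"
  assume g: "?g \<noteq> 0"
  let ?t = "inverse ?g * (1 - ?h)"
  let ?w = "y + rs u ?t"
  have ut: "rs u ?t \<in> U" by (rule dsub_rs[OF Ud u])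
  have yV: "y \<in> V" and uV: "u \<in> V" and utV: "rs u ?t \<in> V" using CV UC yC u ut by simp_all
  have w: "?w \<in> C" by (rule dsub_add[OF Cd yC UC[OF ut]])
  have w1: "cf y U ?w = 1" by (rule cf_eq[OF hy]) (use ut in simp)
  have e: "M ?w = M y + rs (M u) ?t" using tss_add[OF S M yV utV] tss_rs[OF S M uV] by simp
  have Mu: "M u \<in> V" "M y \<in> V" "rs (M u) ?t \<in> V" using MV[OF M] uV yV dsub_rs[OF V] by simp_all
  have "R M ?w = R M y + R M u * ?t" "Y M ?w = Y M y + Y M u * ?t"
    unfolding e by (simp_all only: cf_add[OF hx Mu(2,3)] cy_add[OF Mu(2,3)] cf_rs[OF hx Mu(1)] cy_rs[OF Mu(1)])
  then have "?k * R M ?w + Y M ?w = ?h + ?g * ?t"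
    by (simp only: distrib_left distrib_right mult.assoc add_ac)
  also have "\<dots> = 1" using g by (simp only: mult.assoc[symmetric] right_inverse) simp
  finally have "lam (?k * R M ?w + Y M ?w) = 1" by (simp only: nf_1[OF lam])
  then show False using fixed[OF M w w1] by contradiction
qed

text \<open>With \<open>a M = 0\<close> the identity \<open>G_zero\<close> has a part of degree two
  and a part of degree one in \<open>M\<close>; comparing \<open>M\<close> with its multiple by
  \<open>s\<close> separates them.\<close>

lemma a_zero_U:
  assumes M: "M \<in> S" and a: "a M = 0" and u: "u \<in> U"
  shows "R M u = 0" "Y M u = 0"
proof -
  have uV: "u \<in> V" using CV UC u by simp
  have 1: "R M u = 0 \<or> c M = 0" "Y M u = 0" if M: "M \<in> S" and a: "a M = 0" for M
  proof -
    have g: "c M * R M u + Y M u = 0" using G_zero[OF M u] a by simp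
    have "c M * s * (R M u * s) + Y M u * s = 0"
      using G_zero[OF scale_in[OF M s(1)] u] a
      by (simp only: coord_scale[OF M xV] coord_scale[OF M uV]) simp
    then have "(c M * s * R M u + Y M u) * s = 0" by (simp only: distrib_right mult.assoc)
    then have "c M * s * R M u + Y M u = 0" using s(2) by simp
    moreover have "c M * s = s * c M" using F_comm[OF s(1), of "c M"] by simp
    ultimately have h: "s * (c M * R M u) + Y M u = 0" by (simp only: mult.assoc)
    have "s * (c M * R M u) - c M * R M u = (s * (c M * R M u) + Y M u) - (c M * R M u + Y M u)" by simp
    then have "s * (c M * R M u) - c M * R M u = 0" by (simp only: g h diff_self)
    then have "(s - 1) * (c M * R M u) = 0" by (simp add: left_diff_distrib)
    then have e: "c M * R M u = 0" using s(3) by simp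
    then show "R M u = 0 \<or> c M = 0" by auto
    show "Y M u = 0" using g unfolding e by simp
  qed
  show "Y M u = 0" by (rule 1(2)[OF M a])
  show "R M u = 0"
  proof (cases "c M = 0")
    case True
    \<comment> \<open>For \<open>c M = 0\<close> the product \<open>c M * R M u\<close> carries no
      information, so an \<open>N\<close> with lower entry 1 is added.\<close>
    obtain N where N: "N \<in> S" "N x = y" using surjC[OF yC] by auto
    have aN: "a N = 0" unfolding N(2) by (rule cf_0[OF hx yC])
    have cN: "c N = 1" unfolding N(2) cy_C[OF yC] by (rule cf_x[OF hy])
    have "R N u = 0" using 1(1)[OF N(1) aN] cN by simp
    moreover have "R (M + N) u = 0"
      using 1(1)[OF sum_in[OF M N(1)]] a aN cN True by (simp only: coord_add[OF M N(1) xV]) simp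
    ultimately show ?thesis by (simp only: coord_add[OF M N(1) uV]) simp
  qed (use 1(1)[OF M a] in simp)
qed

text \<open>To drop \<open>a M = 0\<close>, subtract an \<open>N\<close> in \<open>S\<close> that
  takes at \<open>x\<close> the \<open>C\<close>-component of \<open>M x\<close>. It has upper entry
  0, and the difference has lower entry 0, so \<open>G_zero\<close> there speaks of \<open>Y\<close>
  alone. For \<open>R\<close>, lower entry 0 is again avoided by adding an element with lower entry
  1.\<close>

lemma U_coords:
  assumes M: "M \<in> S" and u: "u \<in> U"
  shows "R M u = 0" "Y M u = 0"
proof -
  have uV: "u \<in> V" using CV UC u by simp
  have Y0: "Y M u = 0" if M: "M \<in> S" for M
  proof -
    have Mx: "M x \<in> V" by (rule MV[OF M xV])
    obtain N where N: "N \<in> S" "N x = M x - rs x (a M)" using surjC[OF pr[OF Mx]] by auto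
    have aN: "a N = 0" unfolding N(2) by (rule cf_0[OF hx pr[OF Mx]])
    have "c N = cf y U (N x)" unfolding N(2) by (rule cy_C[OF pr[OF Mx]])
    also have "\<dots> = c M" unfolding N(2) cy_def ..
    finally have cN: "c N = c M" .
    have "c (M - N) = 0" using cN by (simp only: coord_diff[OF M N(1) xV]) simp
    then have "Y (M - N) u = 0" using G_zero[OF diff_in[OF M N(1)] u] by simp
    then show ?thesis using a_zero_U(2)[OF N(1) aN u] by (simp only: coord_diff[OF M N(1) uV]) simp
  qed
  show "Y M u = 0" by (rule Y0[OF M])
  have R0: "R M u = 0" if M: "M \<in> S" and cM: "c M \<noteq> 0" for M
  proof -
    have "a M \<noteq> 1" using muH[OF M] nf_1[OF mu] by auto
    then show ?thesis using G_zero[OF M u] Y0[OF M] cM by simp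
  qed
  show "R M u = 0"
  proof (cases "c M = 0")
    case True
    obtain N where N: "N \<in> S" "N x = y" using surjC[OF yC] by auto
    have aN: "a N = 0" unfolding N(2) by (rule cf_0[OF hx yC])
    have cN: "c N = 1" unfolding N(2) cy_C[OF yC] by (rule cf_x[OF hy])
    have "R (M + N) u = 0"
      using R0[OF sum_in[OF M N(1)]] cN True by (simp only: coord_add[OF M N(1) xV]) simp
    moreover have "R N u = 0" using R0[OF N(1)] cN by simp
    ultimately show ?thesis by (simp only: coord_add[OF M N(1) uV]) simp
  qed (rule R0[OF M])
qed

lemma yV: "y \<in> V" by (rule CV[OF yC])

lemma main_ineq:
  assumes M: "M \<in> S"
  shows "lam (c M * inverse (1 - a M) * R M y) + lam (Y M y) \<noteq> 1"
  using fixed[OF M yC cf_x[OF hy]] by (simp only: nf_add[OF lam] simp_thms)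

text \<open>The condition \<open>c M = 0\<close> persists under scaling by \<open>F\<close>, and
  then the inequality says that no \<open>F\<close>-multiple of \<open>lam (Y M y)\<close> equals
  1.\<close>

lemma c_zero:
  assumes M: "M \<in> S" and c: "c M = 0"
  shows "lam (Y M y) = 0"
proof (rule ccontr)
  let ?l = "lam (Y M y)"
  assume l: "?l \<noteq> 0"
  have iF: "inverse ?l \<in> F" by (rule F_inverse[OF nf_F[OF lam]])
  have "lam (Y M y * inverse ?l) \<noteq> 1"
    using main_ineq[OF scale_in[OF M iF]] c
    by (simp only: coord_scale[OF M xV] coord_scale[OF M yV]) (simp add: nf_0[OF lam])
  moreover have "Y M y * inverse ?l = inverse ?l * Y M y" by (rule F_comm[OF iF, symmetric])
  ultimately show False using l by (simp only: nf_mult[OF lam iF]) simp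
qed

text \<open>For nonzero \<open>R M y\<close>, take \<open>N\<close> in \<open>S\<close> whose lower
  entry is the inverse of it. Along \<open>N + sco t M\<close> the left side of
  \<open>main_ineq\<close> is affine in \<open>t\<close> with slope 1, as \<open>c_zero\<close>
  keeps the \<open>Y\<close> part constant, so it would reach 1.\<close>

lemma ac_zero:
  assumes M: "M \<in> S" and a: "a M = 0" and c: "c M = 0"
  shows "R M y = 0"
proof (rule ccontr)
  let ?r = "R M y"
  assume r: "?r \<noteq> 0"
  let ?e = "inverse ?r"
  have yeC: "rs y ?e \<in> C" by (rule dsub_rs[OF Cd yC])
  obtain N where N: "N \<in> S" "N x = rs y ?e" using surjC[OF yeC] by auto
  have aN: "a N = 0" unfolding N(2) by (rule cf_0[OF hx yeC])
  have cN: "c N = ?e" unfolding N(2) cy_C[OF yeC] by (rule cf_line[OF hy])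
  let ?t = "1 - lam (?e * R N y) - lam (Y N y)"
  have tF: "?t \<in> F" by (intro F_diff F_1 nf_F[OF lam])
  let ?M = "N + sco ?t M"
  have M': "sco ?t M \<in> S" by (rule scale_in[OF M tF])
  have "c ?M = ?e" "a ?M = 0"
    using aN cN a c by (simp_all only: coord_add[OF N(1) M' xV] coord_scale[OF M xV]) simp_all
  moreover have "R ?M y = R N y + ?r * ?t" "Y ?M y = Y N y + Y M y * ?t"
    by (simp_all only: coord_add[OF N(1) M' yV] coord_scale[OF M yV])
  ultimately have "lam (?e * (R N y + ?r * ?t)) + lam (Y N y + Y M y * ?t) \<noteq> 1"
    using main_ineq[OF sum_in[OF N(1) M']] by (simp only: diff_zero inverse_1 mult_1_right simp_thms)
  moreover have "lam (Y M y * ?t) = 0"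
    using nf_mult[OF lam tF, of "Y M y"] c_zero[OF M c] by (simp only: F_comm[OF tF, of "Y M y"] mult_zero_right)
  moreover have "?e * (R N y + ?r * ?t) = ?e * R N y + ?t"
    by (simp only: distrib_left mult.assoc[symmetric] left_inverse[OF r] mult_1_left)
  moreover have "lam ?t = ?t" using nf_mult[OF lam tF, of 1] nf_1[OF lam] by simp
  ultimately show False by (simp add: nf_add[OF lam] del: diff_add_eq)
qed

text \<open>Arbitrary preimages under evaluation at \<open>x\<close> suffice: by
  \<open>coords_cong\<close> and \<open>sigma_cong\<close> the quantities \<open>R M y\<close> and
  \<open>lam (Y M y)\<close> depend only on the corner entries in the column of \<open>x\<close>,
  and thus linearly on \<open>h\<close> and \<open>e\<close>.\<close>

definition A :: "'a \<Rightarrow> 'v \<Rightarrow> 'v" where "A h = (SOME M. M \<in> S \<and> M x = rs x h)"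
definition B :: "'a \<Rightarrow> 'v \<Rightarrow> 'v" where "B e = (SOME M. M \<in> S \<and> M x = rs y e)"

lemma A: assumes "mu h = 0" shows "A h \<in> S" "A h x = rs x h"
proof -
  have "A h \<in> S \<and> A h x = rs x h" unfolding A_def by (rule someI_ex[of "\<lambda>M. M \<in> S \<and> M x = rs x h"]) (use surjH[OF assms] in auto)
  then show "A h \<in> S" "A h x = rs x h" by simp_all
qed

lemma B: "B e \<in> S" "B e x = rs y e"
proof -
  have "B e \<in> S \<and> B e x = rs y e"
    unfolding B_def by (rule someI_ex[of "\<lambda>M. M \<in> S \<and> M x = rs y e"]) (use surjC[OF dsub_rs[OF Cd yC, of e]] in auto)
  then show "B e \<in> S" "B e x = rs y e" by simp_all
qed

lemma A_coords: assumes "mu h = 0" shows "a (A h) = h" "c (A h) = 0"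
proof -
  show 1: "a (A h) = h" unfolding A(2)[OF assms] by (rule cf_line[OF hx])
  show "c (A h) = 0" by (simp add: A(2)[OF assms] cy_def cf_line[OF hx] cf_0[OF hy dsub_0[OF Ud]])
qed

lemma B_coords: "a (B e) = 0" "c (B e) = e"
proof -
  show 1: "a (B e) = 0" unfolding B(2) by (rule cf_0[OF hx dsub_rs[OF Cd yC]])
  show "c (B e) = e" unfolding B(2) cy_C[OF dsub_rs[OF Cd yC]] by (rule cf_line[OF hy])
qed

lemma coords_cong:
  assumes "M \<in> S" "N \<in> S" "a M = a N" "c M = c N"
  shows "R M y = R N y"
proof -
  have "R (M - N) y = 0"
    by (rule ac_zero[OF diff_in[OF assms(1,2)]])
      (use assms(3,4) in \<open>simp_all only: coord_diff[OF assms(1,2) xV] diff_self\<close>)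
  then show ?thesis by (simp only: coord_diff[OF assms(1,2) yV]) simp
qed

lemma sigma_cong:
  assumes "M \<in> S" "N \<in> S" "c M = c N"
  shows "lam (Y M y) = lam (Y N y)"
proof -
  have "lam (Y (M - N) y) = 0"
    by (rule c_zero[OF diff_in[OF assms(1,2)]])
      (use assms(3) in \<open>simp_all only: coord_diff[OF assms(1,2) xV] diff_self\<close>)
  then show ?thesis by (simp only: coord_diff[OF assms(1,2) yV] nf_diff[OF lam]) simp
qed

lemma C_invariant:
  assumes nq: "\<not> all_quadratic" and M: "M \<in> S" and w: "w \<in> C"
  shows "M w \<in> C"
proof -
  \<comment> \<open>By \<open>coords_cong\<close>, \<open>R M y\<close> equals
    \<open>?al (a M) + ?be (c M)\<close>, so the dichotomy makes it vanish; on \<open>U\<close> the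
    upper entry vanishes by \<open>U_coords\<close>.\<close>
  let ?al = "\<lambda>h. R (A h) y" and ?be = "\<lambda>e. R (B e) y" and ?ph = "\<lambda>e. lam (Y (B e) y)"
  have al: "?al (k * h) = k * ?al h" if h: "mu h = 0" and k: "k \<in> F" for h k
  proof -
    have h': "mu (k * h) = 0" using nf_mult[OF mu k] h by simp
    have "R (A (k * h)) y = R (sco k (A h)) y"
    proof (rule coords_cong[OF A(1)[OF h'] scale_in[OF A(1)[OF h] k]])
      show "a (A (k * h)) = a (sco k (A h))"
        unfolding A_coords(1)[OF h'] coord_scale[OF A(1)[OF h] xV] A_coords(1)[OF h] by (rule F_comm[OF k])
      show "c (A (k * h)) = c (sco k (A h))"
        by (simp only: A_coords[OF h'] coord_scale[OF A(1)[OF h] xV] A_coords[OF h] mult_zero_left)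
    qed
    then show ?thesis unfolding coord_scale[OF A(1)[OF h] yV] F_comm[OF k, of "?al h"] .
  qed
  have add_coords: "a (B (p + q)) = a (B p + B q)" "c (B (p + q)) = c (B p + B q)" for p q
    by (simp_all only: B_coords coord_add[OF B(1) B(1) xV] add_0_left)
  have add_be: "?be (p + q) = ?be p + ?be q" for p q
    using coords_cong[OF B(1) sum_in[OF B(1) B(1)] add_coords, of p q] by (simp only: coord_add[OF B(1) B(1) yV])
  have add_ph: "?ph (p + q) = ?ph p + ?ph q" for p q
    using sigma_cong[OF B(1) sum_in[OF B(1) B(1)] add_coords(2), of p q]
    by (simp only: coord_add[OF B(1) B(1) yV] nf_add[OF lam])
  have mult: "?be (k * e) = k * ?be e" "?ph (k * e) = k * ?ph e" if k: "k \<in> F" for k e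
  proof -
    have 1: "a (B (k * e)) = a (sco k (B e))" "c (B (k * e)) = c (sco k (B e))"
      by (simp_all only: B_coords coord_scale[OF B(1) xV] F_comm[OF k] mult_zero_left)
    show "?be (k * e) = k * ?be e"
      using coords_cong[OF B(1) scale_in[OF B(1) k] 1] by (simp only: coord_scale[OF B(1) yV] F_comm[OF k])
    show "?ph (k * e) = k * ?ph e"
      using sigma_cong[OF B(1) scale_in[OF B(1) k] 1(2)]
      by (simp only: coord_scale[OF B(1) yV] F_comm[OF k, symmetric] nf_mult[OF lam k])
  qed
  have ineq: "lam (e * inverse (1 - h) * (?al h + ?be e)) + ?ph e \<noteq> 1" if h: "mu h = 0" for h e
  proof -
    note Ah = A(1)[OF h]
    have 1: "a (A h + B e) = h" "c (A h + B e) = e"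
      by (simp_all only: coord_add[OF Ah B(1) xV] A_coords[OF h] B_coords add_0_left add_0_right)
    have 2: "R (A h + B e) y = ?al h + ?be e" by (simp only: coord_add[OF Ah B(1) yV])
    have "c (A h + B e) = c (B e)" by (simp only: 1 B_coords)
    then have 3: "lam (Y (A h + B e) y) = ?ph e" by (rule sigma_cong[OF sum_in[OF Ah B(1)] B(1)])
    show ?thesis using main_ineq[OF sum_in[OF Ah B(1)[of e]]] by (simp only: 1 2 3 simp_thms)
  qed
  have d1: "?al h = 0" if h: "mu h = 0" for h
    by (rule linear_forms_dichotomy(1)[OF lam mu s, of ?al ?be ?ph], erule (1) al, rule add_be, erule mult(1),
        rule add_ph, erule mult(2), rule nf_F[OF lam], erule ineq, rule nq, rule h)
  have d2: "?be e = 0" for e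
    by (rule linear_forms_dichotomy(2)[OF lam mu s, of ?al ?be ?ph], erule (1) al, rule add_be, erule mult(1),
        rule add_ph, erule mult(2), rule nf_F[OF lam], erule ineq, rule nq)
  have muM: "mu (a M) = 0" by (rule muH[OF M])
  have "R M y = R (A (a M) + B (c M)) y"
  proof (rule coords_cong[OF M sum_in[OF A(1)[OF muM] B(1)]])
    show "a M = a (A (a M) + B (c M))"
      by (simp only: coord_add[OF A(1)[OF muM] B(1) xV] A_coords[OF muM] B_coords add_0_right)
    show "c M = c (A (a M) + B (c M))"
      by (simp only: coord_add[OF A(1)[OF muM] B(1) xV] A_coords[OF muM] B_coords add_0_left)
  qed
  also have "\<dots> = 0" by (simp only: coord_add[OF A(1)[OF muM] B(1) yV] d1[OF muM] d2 add_0_left)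
  finally have Ry: "R M y = 0" .
  let ?u = "w - rs y (cf y U w)"
  have u: "?u \<in> U" by (rule cf_mem[OF hy w])
  have uV: "?u \<in> V" by (rule CV[OF UC[OF u]])
  have "M w = M (?u + rs y (cf y U w))" by simp
  also have "\<dots> = M ?u + rs (M y) (cf y U w)"
    by (simp only: tss_add[OF S M uV dsub_rs[OF V yV]] tss_rs[OF S M yV])
  finally have "R M w = R M ?u + R M y * cf y U w"
    by (simp only: cf_add[OF hx MV[OF M uV] dsub_rs[OF V MV[OF M yV]]] cf_rs[OF hx MV[OF M yV]])
  then have "R M w = 0" using U_coords(1)[OF M u] Ry by simp
  then show ?thesis by (simp only: cf_0_iff[OF hx MV[OF M CV[OF w]]])
qed

end

context rspace_fin
begin

text \<open>Restriction to \<open>U\<close> has rank at most \<open>tdim dg n\<close>, so the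
  elements of \<open>T\<close> vanishing on \<open>U\<close> have dimension at least
  \<open>Suc n * dg - 1\<close>, and their values at \<open>y\<close> form the space
  \<open>P\<close>. It contains no \<open>y - u\<close> with \<open>u\<close> in \<open>U\<close>,
  as such a value would be a fixed vector.\<close>

lemma optimal_cokernel:
  assumes C: "dsub C" "V.vfin C" "V.vdim C = Suc n * dg" and T: "tss C T"
    and card: "infinite F \<or> n * dg \<le> card F" and opt: "tdim dg (Suc n) \<le> O.vdim T"
    and hy: "hcomp y C U" and inv: "\<forall>M\<in>T. \<forall>u\<in>U. M u \<in> U"
  obtains P where "V.vsub P" "y \<notin> P" "U \<subseteq> P" "\<forall>c\<in>C. \<exists>f\<in>F. c - rs y f \<in> P"
    "\<forall>p\<in>P. \<exists>N\<in>T. N y = p \<and> (\<forall>u\<in>U. N u = 0)"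
proof -
  note Ud = hcomp_dsub[OF hy] and UC = subsetD[OF hcomp_subset[OF hy]] and yC = hcomp_in[OF hy]
  have Ts: "O.vsub T" by (rule tss_sub[OF T])
  have Tf: "O.vfin T" by (rule fin_ops[OF C(1,2) T])
  have Uf: "V.vfin U" by (rule V.fin_subset(1)[OF dsub_sub[OF C(1)] dsub_sub[OF Ud] hcomp_subset[OF hy] C(2)])
  have Un: "V.vdim U = n * dg" using dim_hcomp[OF hy C(1,2)] C(3) by simp
  \<comment> \<open>Cutting off outside \<open>U\<close> makes the restricted operators satisfy the
    last clause of \<open>tss\<close>.\<close>
  define rho :: "('v \<Rightarrow> 'v) \<Rightarrow> 'v \<Rightarrow> 'v" where "rho N = (\<lambda>v. if v \<in> U then N v else 0)" for N
  have rho: "flin F sco sco T rho" by (rule flinI) (simp_all add: rho_def fun_eq_iff)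
  have tU: "tss U (rho ` T)"
    unfolding tss_def
  proof (intro conjI ballI impI)
    show "O.vsub (rho ` T)" by (rule O.self.sub_image[OF Ts rho])
    fix M assume "M \<in> rho ` T"
    then obtain N where N: "N \<in> T" "M = rho N" by (rule imageE)
    show "dlin U M"
      using inv N(1) dsub_add[OF Ud] dsub_rs[OF Ud] tss_add[OF T N(1) UC UC] tss_rs[OF T N(1) UC]
      by (simp add: dlin_def N(2) rho_def)
    show "v \<in> U \<Longrightarrow> M v = v \<Longrightarrow> v = 0" for v using tss_fix[OF T N(1) UC] by (simp add: N(2) rho_def)
    show "\<forall>v\<in>U. M v = 0 \<Longrightarrow> M = 0" by (simp add: N(2) rho_def fun_eq_iff)
  qed
  let ?K = "{N \<in> T. rho N = 0}"
  have Ks: "O.vsub ?K" by (rule O.self.sub_ker[OF Ts rho])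
  have Kf: "O.vfin ?K" by (rule O.fin_subset(1)[OF Ts Ks Collect_restrict Tf])
  have NU: "N u = 0" if "N \<in> ?K" "u \<in> U" for N u
  proof -
    have "rho N u = 0" using that(1) by simp
    then show ?thesis using that(2) by (simp add: rho_def)
  qed
  have "O.vdim (rho ` T) + O.vdim ?K = O.vdim T" by (rule O.self.rank_nullity(2)[OF Ts rho Tf])
  moreover have "O.vdim (rho ` T) \<le> tdim dg n" by (rule tss_bound[OF Ud Uf Un tU card])
  ultimately have K: "Suc n * dg \<le> O.vdim ?K + 1" using opt by simp
  let ?P = "(\<lambda>M. M y) ` ?K"
  have Ps: "V.vsub ?P" by (rule OV.sub_image[OF Ks flin_ev])
  have "V.vdim ?P = O.vdim ?K"
  proof (rule OV.dim_inj[OF Ks flin_ev Kf])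
    fix N assume N: "N \<in> ?K" "N y = 0"
    then have NT: "N \<in> T" by simp
    show "N = 0"
    proof (rule tss_zero[OF T NT])
      fix c assume c: "c \<in> C"
      let ?u = "c - rs y (cf y U c)"
      have u: "?u \<in> U" by (rule cf_mem[OF hy c])
      have "N c = N (?u + rs y (cf y U c))" by simp
      also have "\<dots> = N ?u + rs (N y) (cf y U c)"
        by (simp only: tss_add[OF T NT UC[OF u] dsub_rs[OF C(1) yC]] tss_rs[OF T NT yC])
      also have "\<dots> = 0" using NU[OF N(1) u] N(2) by simp
      finally show "N c = 0" .
    qed
  qed
  then have dP: "V.vdim C \<le> V.vdim ?P + 1" using K C(3) by simp
  have PC: "?P \<subseteq> C" by (rule subset_trans[OF image_mono[OF Collect_restrict] ev_subset[OF T yC]])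
  have no: "y - u \<notin> ?P" if u: "u \<in> U" for u
  proof
    assume "y - u \<in> ?P"
    then obtain N where N: "N \<in> ?K" "y - u = N y" by (rule imageE)
    then have NT: "N \<in> T" by simp
    have v: "y - u \<in> C" by (rule dsub_diff[OF C(1) yC UC[OF u]])
    have "N y = N ((y - u) + u)" by simp
    also have "\<dots> = N (y - u) + N u" by (rule tss_add[OF T NT v UC[OF u]])
    finally have "N (y - u) = y - u" using N NU[OF N(1) u] by simp
    then have "y - u = 0" by (rule tss_fix[OF T NT v])
    then show False using u hcomp_notin[OF hy] by simp
  qed
  have yP: "y \<notin> ?P" using no[OF dsub_0[OF Ud]] by simp
  have sh: "\<exists>f\<in>F. c - rs y f \<in> ?P" if c: "c \<in> C" for c
    by (rule V.hyperplane_shift[OF dsub_sub[OF C(1)] C(2) Ps PC dP yC yP c]) (rule bexI)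
  show ?thesis
  proof (rule that[OF Ps yP])
    show "U \<subseteq> ?P"
    proof
      fix u assume u: "u \<in> U"
      \<comment> \<open>A nonzero \<open>f\<close> would, after division by \<open>- f\<close>, put
        \<open>y - rs u (inverse f)\<close> into \<open>?P\<close>, which \<open>no\<close>
        forbids.\<close>
      obtain f where f: "f \<in> F" "u - rs y f \<in> ?P" using sh[OF UC[OF u]] by auto
      have "f = 0"
      proof (rule ccontr)
        assume "f \<noteq> 0"
        have "rs (u - rs y f) (- inverse f) \<in> ?P" by (rule fsub_sc[OF Ps F_minus[OF F_inverse[OF f(1)]] f(2)])
        moreover have "rs (u - rs y f) (- inverse f) = y - rs u (inverse f)"
          using \<open>f \<noteq> 0\<close> by (simp add: rs_diff rs_minus_right rs_mult[symmetric])
        ultimately show False using no[OF dsub_rs[OF Ud u]] by simp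
      qed
      then show "u \<in> ?P" using f(2) by simp
    qed
    show "\<forall>c\<in>C. \<exists>f\<in>F. c - rs y f \<in> ?P" using sh by (rule ballI)
    show "\<forall>p\<in>?P. \<exists>N\<in>T. N y = p \<and> (\<forall>u\<in>U. N u = 0)"
    proof
      fix p assume "p \<in> ?P"
      then obtain N where N: "N \<in> ?K" "p = N y" by (rule imageE)
      show "\<exists>N\<in>T. N y = p \<and> (\<forall>u\<in>U. N u = 0)"
        by (rule bexI[of _ N]) (use N NU[OF N(1)] in simp_all)
    qed
  qed
qed

lemma scalar_form_exists:
  assumes P: "V.vsub P" "y \<notin> P" and sh: "\<And>b. \<exists>f\<in>F. rs y b - rs y f \<in> P"
  obtains lam where "normal_form lam" "\<forall>b. lam b = 0 \<longleftrightarrow> rs y b \<in> P"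
proof (rule form_exists[of "{b. rs y b \<in> P}"])
  show "fsub F (*) {b. rs y b \<in> P}"
  proof (rule fsubI)
    show "0 \<in> {b. rs y b \<in> P}" using fsub_0[OF P(1)] by simp
    show "b + c \<in> {b. rs y b \<in> P}" if "b \<in> {b. rs y b \<in> P}" "c \<in> {b. rs y b \<in> P}" for b c
      using that fsub_add[OF P(1)] by (simp add: rs_add_right)
    show "k * b \<in> {b. rs y b \<in> P}" if "k \<in> F" "b \<in> {b. rs y b \<in> P}" for k b
      using that fsub_sc[OF P(1) that(1)] by (simp add: F_comm[OF that(1)] rs_mult)
  qed
  show "1 \<notin> {b. rs y b \<in> P}" using P(2) by simp
  show "\<exists>f\<in>F. b - f \<in> {b. rs y b \<in> P}" for b using sh[of b] by (simp add: rs_diff_right)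
  fix lam assume "normal_form lam" "\<forall>b. lam b = 0 \<longleftrightarrow> b \<in> {b. rs y b \<in> P}"
  then show thesis using that by (simp only: mem_Collect_eq)
qed

theorem invariant_hyperplane:
  assumes nq: "\<not> all_quadratic" and dg2: "2 \<le> dg"
    and "dsub V" "V.vfin V" "V.vdim V = Suc n * dg" "tss V S" "infinite F \<or> Suc n * dg \<le> card F"
      "tdim dg (Suc n) \<le> O.vdim S"
  shows "\<exists>C. dsub C \<and> C \<subseteq> V \<and> V.vdim C = n * dg \<and> (\<forall>M\<in>S. \<forall>v\<in>C. M v \<in> C)"
  using assms(3-)
proof (induction n arbitrary: V S)
  case 0
  note V = 0(1-3) and S = 0(4)
  have "dsub {0}" by (simp add: dsub_def)
  moreover have "M 0 = 0" if "M \<in> S" for M using tss_rs[OF S that dsub_0[OF V(1)], of 0] by simp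
  ultimately show ?case using dsub_0[OF V(1)] by (intro exI[of _ "{0}"]) simp
next
  case (Suc n)
  note V = Suc.prems(1,2,3) and S = Suc.prems(4) and card = Suc.prems(5)
  obtain x C where hx: "hcomp x V C" and x0: "x \<noteq> 0" and T: "tss C {M \<in> S. M x = 0}"
    and optT: "tdim dg (Suc n) \<le> O.vdim {M \<in> S. M x = 0}"
    and CS: "C \<subseteq> (\<lambda>M. M x) ` S" and hyp: "V.vdim V \<le> V.vdim ((\<lambda>M. M x) ` S) + 1"
    and im: "\<forall>N\<in>S. N x = 0 \<longrightarrow> (\<forall>y\<in>V. N y \<in> C)"
    by (rule optimal_structure[OF V S card dg2 Suc.prems(6)])
  let ?T = "{M \<in> S. M x = 0}" and ?E = "(\<lambda>M. M x) ` S"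
  note Cd = hcomp_dsub[OF hx] and CV = hcomp_subset[OF hx] and xV = hcomp_in[OF hx]
  have Cf: "V.vfin C" by (rule V.fin_subset(1)[OF dsub_sub[OF V(1)] dsub_sub[OF Cd] CV V(2)])
  have Cn: "V.vdim C = Suc n * dg" using dim_hcomp[OF hx V(1,2)] V(3) by simp
  have card1: "infinite F \<or> Suc n * dg \<le> card F" and card0: "infinite F \<or> n * dg \<le> card F" using card by auto
  obtain U where U: "dsub U" "U \<subseteq> C" "V.vdim U = n * dg" "\<forall>M\<in>?T. \<forall>v\<in>U. M v \<in> U"
    using Suc.IH[OF Cd Cf Cn T card1 optT] by (elim exE conjE)
  have "U \<noteq> C" using U(3) Cn dg2 by auto
  then obtain y where y: "y \<in> C" "y \<notin> U" using U(2) by auto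
  obtain U' where U': "U \<subseteq> U'" "hcomp y C U'" by (rule hcomp_exists[OF Cd Cf U(1,2) y])
  have U'f: "V.vfin U'"
    by (rule V.fin_subset(1)[OF dsub_sub[OF Cd] dsub_sub[OF hcomp_dsub[OF U'(2)]] hcomp_subset[OF U'(2)] Cf])
  \<comment> \<open>Equality of dimensions shows that the given invariant \<open>U\<close> is itself
    complementary to \<open>y D\<close> in \<open>C\<close>.\<close>
  have "U = U'"
    by (rule V.fin_subset(3)[OF dsub_sub[OF hcomp_dsub[OF U'(2)]] dsub_sub[OF U(1)] U'(1) U'f])
      (use dim_hcomp[OF U'(2) Cd Cf] Cn U(3) in simp)
  then have hy: "hcomp y C U" using U'(2) by simp
  obtain P where P: "V.vsub P" "y \<notin> P" "U \<subseteq> P" "\<forall>c\<in>C. \<exists>f\<in>F. c - rs y f \<in> P"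
    "\<forall>p\<in>P. \<exists>N\<in>?T. N y = p \<and> (\<forall>u\<in>U. N u = 0)"
    by (rule optimal_cokernel[OF Cd Cf Cn T card0 optT hy U(4)])
  obtain lam where lam: "normal_form lam" "\<forall>b. lam b = 0 \<longleftrightarrow> rs y b \<in> P"
    by (rule scalar_form_exists[OF P(1,2)]) (use P(4) dsub_rs[OF Cd y(1)] in auto)
  have Es: "V.vsub ?E" by (rule ev_sub[OF S])
  have EV: "?E \<subseteq> V" by (rule ev_subset[OF S xV])
  have xE: "x \<notin> ?E"
  proof
    assume "x \<in> ?E"
    then obtain M where M: "M \<in> S" "x = M x" by (rule imageE)
    show False using tss_fix[OF S M(1) xV M(2)[symmetric]] x0 by simp
  qed
  have shE: "\<exists>f\<in>F. rs x b - rs x f \<in> ?E" for b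
    by (rule V.hyperplane_shift[OF dsub_sub[OF V(1)] V(2) Es EV hyp xV xE dsub_rs[OF V(1) xV]]) (rule bexI)
  obtain mu where mu: "normal_form mu" "\<forall>b. mu b = 0 \<longleftrightarrow> rs x b \<in> ?E"
    by (rule scalar_form_exists[OF Es xE shE])
  \<comment> \<open>In the induction step \<open>V\<close> has dimension at least 2 over
    \<open>D\<close>, so \<open>F\<close> has at least \<open>2 * dg\<close>, hence at least 4,
    elements.\<close>
  have "\<exists>s\<in>F. s \<noteq> 0 \<and> s \<noteq> 1"
  proof -
    have "infinite F \<or> 2 < card F" using card dg2 by auto
    then obtain B where B: "finite B" "B \<subseteq> F" "card B = 2 + 1" by (rule finite_subset_of_card)
    have "\<not> B \<subseteq> {0, 1}"
    proof
      assume "B \<subseteq> {0, 1}"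
      then have "card B \<le> card {0, 1 :: 'a}" by (intro card_mono) simp_all
      then show False using B(3) by simp
    qed
    then show ?thesis using B(2) by auto
  qed
  then obtain s where s: "s \<in> F" "s \<noteq> 0" "s \<noteq> 1" by auto
  interpret frame F rs V C U S x y lam mu s
  proof (unfold_locales; (fact V hx hy S lam(1) mu(1) s)?)
    show "\<exists>M\<in>S. M x = c" if "c \<in> C" for c using CS that by auto
    show "\<exists>M\<in>S. M x = rs x a" if "mu a = 0" for a using mu(2) that by auto
    show "mu (cf x C (M x)) = 0" if M: "M \<in> S" for M
    proof -
      have "M x \<in> V" by (rule tss_closed[OF S M xV])
      then have 1: "M x - rs x (cf x C (M x)) \<in> ?E" by (rule subsetD[OF CS cf_mem[OF hx]])
      have 2: "M x \<in> ?E" using M by (rule imageI)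
      \<comment> \<open>As \<open>C\<close> lies in \<open>S x\<close>, so does the component of
        \<open>M x\<close> along \<open>x\<close>.\<close>
      have "M x - (M x - rs x (cf x C (M x))) \<in> ?E" by (rule V.sub_diff[OF Es 2 1])
      then show ?thesis by (simp add: mu(2))
    qed
    fix M b w
    assume M: "M \<in> S" and w: "w \<in> C" "cf y U w = 1" and b: "cf x C (M (rs x b + w)) = b"
    let ?v = "rs x b + w"
    \<comment> \<open>For some \<open>M + N\<close> to fix \<open>?v\<close>, an \<open>N\<close> in
      \<open>S\<close> with \<open>N x = 0\<close> and \<open>N w = w - ?w\<close> is needed. Modulo
      \<open>U\<close> the vector \<open>w\<close> is \<open>y\<close>, so \<open>P\<close> supplies
      it if \<open>lam\<close> vanishes at the \<open>y\<close>-coordinate of \<open>w - ?w\<close>,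
      which is what the value 1 of \<open>lam\<close> amounts to.\<close>
    let ?w = "M ?v - rs x b"
    show "lam (cf y U (M ?v - rs x (cf x C (M ?v)))) \<noteq> 1"
    proof
      assume 1: "lam (cf y U (M ?v - rs x (cf x C (M ?v)))) = 1"
      have wV: "w \<in> V" using w CV by auto
      have xbV: "rs x b \<in> V" by (rule dsub_rs[OF V(1) xV])
      have v: "?v \<in> V" by (rule dsub_add[OF V(1) xbV wV])
      have w': "?w \<in> C" using cf_mem[OF hx tss_closed[OF S M v]] b by simp
      have dC: "w - ?w \<in> C" by (rule dsub_diff[OF Cd w(1) w'])
      have "cf y U (w - ?w) + cf y U ?w = cf y U w" using cf_add[OF hy dC w'] by simp
      then have d: "cf y U (w - ?w) = 1 - cf y U ?w" using w(2) by (simp add: eq_diff_eq)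
      have "lam (cf y U (w - ?w)) = 0" using 1 b by (simp add: d nf_diff[OF lam(1)] nf_1[OF lam(1)])
      then have p1: "rs y (cf y U (w - ?w)) \<in> P" by (simp add: lam(2))
      have p2: "(w - ?w) - rs y (cf y U (w - ?w)) \<in> P" by (rule subsetD[OF P(3) cf_mem[OF hy dC]])
      have "((w - ?w) - rs y (cf y U (w - ?w))) + rs y (cf y U (w - ?w)) \<in> P" by (rule fsub_add[OF P(1) p2 p1])
      then have "w - ?w \<in> P" by simp
      then obtain N where N: "N \<in> S" "N x = 0" "N y = w - ?w" "\<forall>u\<in>U. N u = 0" using P(5) by auto
      have yV: "y \<in> V" using y CV by auto
      have wy: "w - y \<in> U" using cf_mem[OF hy w(1)] w(2) by simp
      have wyV: "w - y \<in> V" by (rule dsub_diff[OF V(1) wV yV])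
      have "N w = N ((w - y) + y)" by simp
      also have "\<dots> = N (w - y) + N y" by (rule tss_add[OF S N(1) wyV yV])
      finally have Nw: "N w = w - ?w" using N(3,4) wy by simp
      have "N ?v = N (rs x b) + N w" by (rule tss_add[OF S N(1) xbV wV])
      also have "N (rs x b) = 0" using tss_rs[OF S N(1) xV, of b] N(2) by simp
      finally have "(M + N) ?v = ?v" using Nw by simp
      then have v0: "?v = 0" by (rule tss_fix[OF S fsub_add[OF tss_sub[OF S] M N(1)] v])
      have "cf x C ?v = b" by (rule cf_eq[OF hx]) (use w in simp)
      then have "b = 0" using v0 cf_0[OF hx dsub_0[OF Cd]] by simp
      then have "w = 0" using v0 by simp
      then show False using w(2) cf_0[OF hy dsub_0[OF U(1)]] by simp
    qed
  qed
  show ?case using Cd hcomp_subset[OF hx] Cn C_invariant[OF nq] by (intro exI[of _ C]) simp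
qed

end

section \<open>Division rings in which every element is quadratic\<close>

lemma (in fspace) dim_line:
  assumes "x \<noteq> 0" shows "vdim {sc k x |k. k \<in> F} = 1"
proof -
  let ?L = "{sc k x |k. k \<in> F}"
  interpret L: vectorspace "subfield_ring F" "frec sc ?L" by (rule vectorspace_frec[OF sub_line])
  have xL: "x \<in> ?L" using F_1 sc_1[of x] by (metis (mono_tags, lifting) mem_Collect_eq)
  then have xs: "{x} \<subseteq> carrier (frec sc ?L)" by simp
  have sm: "submodule (subfield_ring F) (L.span {x}) (frec sc ?L)" by (rule L.span_is_submodule[OF xs])
  have xx: "x \<in> L.span {x}" using L.in_own_span[OF xs] by simp
  have "L.span {x} = carrier (frec sc ?L)"
  proof (rule equalityI[OF L.span_is_subset2[OF xs]], rule subsetI)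
    fix v assume "v \<in> carrier (frec sc ?L)"
    then obtain k where "k \<in> F" "v = sc k x" by auto
    then show "v \<in> L.span {x}"
      using submodule.smult_closed[OF sm _ xx, of k] by (simp add: frec_def subfield_ring_def)
  qed
  then have "L.dim = 1" by (rule L.dim1I) (use assms xL in \<open>simp_all add: zero_frec\<close>)
  then show ?thesis by (simp add: fdim_def)
qed

locale qdiv = central F for F :: "'a::division_ring set" +
  assumes fin_D: "ffin F (*) (UNIV :: 'a set)" and aq: all_quadratic
begin

sublocale D: fspace F "(*)"
  by unfold_locales (simp_all add: algebra_simps)

abbreviation deg :: nat where "deg \<equiv> D.vdim UNIV"

definition ext :: "'a set \<Rightarrow> 'a \<Rightarrow> 'a set" where "ext A v = {a + b * v |a b. a \<in> A \<and> b \<in> A}"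

definition subalg :: "'a set \<Rightarrow> bool" where
  "subalg A \<longleftrightarrow> D.vsub A \<and> 1 \<in> A \<and> (\<forall>a\<in>A. \<forall>b\<in>A. a * b \<in> A)"

lemma subalgD:
  assumes "subalg A"
  shows subalg_sub: "D.vsub A" and subalg_1: "1 \<in> A" and subalg_mult: "a \<in> A \<Longrightarrow> b \<in> A \<Longrightarrow> a * b \<in> A"
    and subalg_0: "0 \<in> A" and subalg_add: "a \<in> A \<Longrightarrow> b \<in> A \<Longrightarrow> a + b \<in> A"
  using assms by (auto simp: subalg_def fsub_def)

lemma subalg_F: "subalg F"
  by (auto simp: subalg_def fsub_def)

lemma square:
  obtains e f where "e \<in> F" "f \<in> F" "z * z = e + f * z"
proof -
  have "\<exists>e\<in>F. \<exists>f\<in>F. z * z = e + f * z" using aq unfolding all_quadratic_def by (rule spec)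
  then show ?thesis using that by (elim bexE)
qed

lemma F_subset: "D.vsub A \<Longrightarrow> 1 \<in> A \<Longrightarrow> f \<in> F \<Longrightarrow> f \<in> A"
  using fsub_sc[of F "(*)" A f 1] by simp

text \<open>From \<open>x * (x - f) = e\<close> the inverse of \<open>x\<close> is
  \<open>inverse e * (x - f)\<close>, unless \<open>e = 0\<close>, when \<open>x\<close> is 0 or
  \<open>f\<close>. So subalgebras are division rings.\<close>

lemma inverse_in:
  assumes A: "subalg A" and x: "x \<in> A"
  shows "inverse x \<in> A"
proof (cases "x = 0")
  case False
  obtain e f where ef: "e \<in> F" "f \<in> F" "x * x = e + f * x" by (rule square)
  note FA = F_subset[OF subalg_sub[OF A] subalg_1[OF A]]
  have fx: "f * x = x * f" by (rule F_comm[OF ef(2)])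
  have e: "x * (x - f) = e" using ef(3) fx by (simp add: right_diff_distrib)
  show ?thesis
  proof (cases "e = 0")
    case True
    then have "x = f" using e False by simp
    then show ?thesis using FA ef(2) by auto
  next
    case e0: False
    have "x * (inverse e * (x - f)) = inverse e * (x * (x - f))"
      by (simp only: mult.assoc[symmetric] F_comm[OF F_inverse[OF ef(1)], of x])
    also have "\<dots> = 1" unfolding e using e0 by simp
    finally have "inverse x = inverse e * (x - f)" by (rule inverse_unique)
    then show ?thesis
      using fsub_sc[OF subalg_sub[OF A] F_inverse[OF ef(1)] D.sub_diff[OF subalg_sub[OF A] x FA[OF ef(2)]]] by simp
  qed
qed (use subalg_0[OF A] in simp)

lemma subalg_free:
  assumes A: "subalg A" and v: "v \<notin> A" and k: "k \<in> A" "k * v \<in> A"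
  shows "k = 0"
proof (rule ccontr)
  assume "k \<noteq> 0"
  then have "v = inverse k * (k * v)" by (simp add: mult.assoc[symmetric])
  then show False using v subalg_mult[OF A inverse_in[OF A k(1)] k(2)] by simp
qed

lemma ext_memI: "a \<in> A \<Longrightarrow> b \<in> A \<Longrightarrow> a + b * v \<in> ext A v"
  unfolding ext_def by blast

lemma ext_memE: assumes "x \<in> ext A v" obtains a b where "a \<in> A" "b \<in> A" "x = a + b * v"
  using assms unfolding ext_def by blast

lemma ext_sub:
  assumes A: "D.vsub A" shows "D.vsub (ext A v)"
proof (rule fsubI)
  show "0 \<in> ext A v" using ext_memI[OF fsub_0[OF A] fsub_0[OF A], of v] by simp
next
  fix x y assume "x \<in> ext A v" "y \<in> ext A v"
  then obtain a b a' b' where *: "a \<in> A" "b \<in> A" "x = a + b * v" "a' \<in> A" "b' \<in> A" "y = a' + b' * v"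
    by (elim ext_memE)
  have "x + y = (a + a') + (b + b') * v" using * by (simp add: algebra_simps)
  then show "x + y \<in> ext A v" using ext_memI[OF fsub_add[OF A *(1,4)] fsub_add[OF A *(2,5)], of v] by simp
next
  fix k x assume k: "k \<in> F" and "x \<in> ext A v"
  then obtain a b where *: "a \<in> A" "b \<in> A" "x = a + b * v" by (elim ext_memE)
  have "k * x = (k * a) + (k * b) * v" using * by (simp add: algebra_simps)
  then show "k * x \<in> ext A v" using ext_memI[OF fsub_sc[OF A k *(1)] fsub_sc[OF A k *(2)], of v] by simp
qed

lemma ext_base: "D.vsub A \<Longrightarrow> a \<in> A \<Longrightarrow> a \<in> ext A v"
  using ext_memI[of a A 0 v] fsub_0 by fastforce

text \<open>1 and \<open>v\<close> form a basis of \<open>ext A v\<close> as a left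
  \<open>A\<close>-space; \<open>q\<close> is the coefficient of \<open>v\<close>, unique by
  \<open>subalg_free\<close>, with both kernel and image equal to \<open>A\<close>.\<close>

lemma dim_ext:
  assumes A: "subalg A" and v: "v \<notin> A"
  shows "D.vdim (ext A v) = 2 * D.vdim A"
proof -
  note As = subalg_sub[OF A]
  define q where "q w = (SOME b. b \<in> A \<and> w - b * v \<in> A)" for w
  have q: "q w = b" if "b \<in> A" "w - b * v \<in> A" for w b
  proof -
    have "q w \<in> A \<and> w - q w * v \<in> A"
      unfolding q_def by (rule someI[of "\<lambda>b. b \<in> A \<and> w - b * v \<in> A"]) (use that in simp)
    then have 1: "q w \<in> A" "w - q w * v \<in> A" by simp_all
    have "(w - b * v) - (w - q w * v) \<in> A" by (rule D.sub_diff[OF As that(2) 1(2)])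
    then have "(q w - b) * v \<in> A" by (simp add: left_diff_distrib)
    then have "q w - b = 0" by (rule subalg_free[OF A v D.sub_diff[OF As 1(1) that(1)]])
    then show ?thesis by simp
  qed
  have q': "q (a + b * v) = b" if "a \<in> A" "b \<in> A" for a b by (rule q) (use that in simp_all)
  have l: "flin F (*) (*) (ext A v) q"
  proof (rule flinI)
    fix x y assume "x \<in> ext A v" "y \<in> ext A v"
    then obtain a b a' b' where *: "a \<in> A" "b \<in> A" "x = a + b * v" "a' \<in> A" "b' \<in> A" "y = a' + b' * v"
      by (elim ext_memE)
    have "x + y = (a + a') + (b + b') * v" using * by (simp add: algebra_simps)
    then have "q (x + y) = b + b'" using q'[OF fsub_add[OF As *(1,4)] fsub_add[OF As *(2,5)]] by simp
    then show "q (x + y) = q x + q y" using q' * by simp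
  next
    fix k x assume k: "k \<in> F" and "x \<in> ext A v"
    then obtain a b where *: "a \<in> A" "b \<in> A" "x = a + b * v" by (elim ext_memE)
    have "k * x = (k * a) + (k * b) * v" using * by (simp add: algebra_simps)
    then have "q (k * x) = k * b" using q'[OF fsub_sc[OF As k *(1)] fsub_sc[OF As k *(2)]] by simp
    then show "q (k * x) = k * q x" using q' * by simp
  qed
  have f: "D.vfin (ext A v)" by (rule D.fin_subset(1)[OF D.sub_UNIV ext_sub[OF As] subset_UNIV fin_D])
  have "q ` ext A v = A"
  proof
    show "q ` ext A v \<subseteq> A"
    proof
      fix y assume "y \<in> q ` ext A v"
      then obtain x where "x \<in> ext A v" "y = q x" by (rule_tac imageE)
      then show "y \<in> A" using q' by (auto elim: ext_memE)
    qed
    show "A \<subseteq> q ` ext A v"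
    proof
      fix b assume b: "b \<in> A"
      have "b = q (0 + b * v)" using q'[OF subalg_0[OF A] b] by simp
      then show "b \<in> q ` ext A v" using ext_memI[OF subalg_0[OF A] b, of v] by (rule image_eqI)
    qed
  qed
  moreover have "{w \<in> ext A v. q w = 0} = A"
  proof
    show "{w \<in> ext A v. q w = 0} \<subseteq> A"
    proof
      fix w assume w: "w \<in> {w \<in> ext A v. q w = 0}"
      then have "w \<in> ext A v" by simp
      then obtain a b where *: "a \<in> A" "b \<in> A" "w = a + b * v" by (rule ext_memE)
      then show "w \<in> A" using w q' by simp
    qed
    show "A \<subseteq> {w \<in> ext A v. q w = 0}"
      using ext_base[OF As] q'[OF _ subalg_0[OF A]] by auto
  qed
  ultimately show ?thesis using D.self.rank_nullity(2)[OF ext_sub[OF As] l f] by simp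
qed

lemma dim_F: "D.vdim F = 1"
proof -
  have "{k * 1 |k. k \<in> F} = F" by auto
  then show ?thesis using D.dim_line[of 1] by simp
qed

lemma dim_ext_F: "z \<notin> F \<Longrightarrow> D.vdim (ext F z) = 2"
  using dim_ext[OF subalg_F] dim_F by simp

lemma subalg_ext_F: "subalg (ext F z)"
  unfolding subalg_def
proof (intro conjI ballI)
  show s: "D.vsub (ext F z)" by (rule ext_sub[OF subalg_sub[OF subalg_F]])
  show "1 \<in> ext F z" by (rule ext_base[OF subalg_sub[OF subalg_F] F_1])
  fix x y assume "x \<in> ext F z" "y \<in> ext F z"
  then obtain a b c e where *: "a \<in> F" "b \<in> F" "x = a + b * z" "c \<in> F" "e \<in> F" "y = c + e * z"
    by (elim ext_memE)
  obtain n t where nt: "n \<in> F" "t \<in> F" "z * z = n + t * z" by (rule square)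
  have "x * y = a * c + a * e * z + b * (z * c) + b * (z * e) * z"
    using * by (simp add: algebra_simps)
  also have "\<dots> = a * c + a * e * z + b * (c * z) + b * (e * z) * z"
    by (simp only: F_comm[OF *(4), of z] F_comm[OF *(5), of z])
  also have "\<dots> = a * c + a * e * z + b * c * z + b * e * (n + t * z)"
    by (simp only: mult.assoc nt(3))
  also have "\<dots> = (a * c + b * e * n) + (a * e + b * c + b * e * t) * z"
    by (simp add: algebra_simps)
  also have "\<dots> \<in> ext F z" using * nt by (intro ext_memI F_add F_mult)
  finally show "x * y \<in> ext F z" .
qed

lemma ind2:
  assumes z: "z \<notin> F" and ab: "a \<in> F" "b \<in> F" "a + b * z = 0"
  shows "a = 0" "b = 0"
proof -
  show b: "b = 0"
  proof (rule subalg_free[OF subalg_F z ab(2)])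
    have "b * z = - a" using ab(3) by (simp add: add_eq_0_iff)
    then show "b * z \<in> F" using ab(1) by auto
  qed
  then show "a = 0" using ab(3) by simp
qed

text \<open>Two applications of \<open>subalg_free\<close>, to \<open>w\<close> over
  \<open>ext F z\<close> and to \<open>z\<close> over \<open>F\<close>.\<close>

lemma ind4:
  assumes z: "z \<notin> F" and w: "w \<notin> ext F z"
    and F: "a \<in> F" "b \<in> F" "c \<in> F" "e \<in> F" and eq: "a + b * z + c * w + e * (z * w) = 0"
  shows "a = 0" "b = 0" "c = 0" "e = 0"
proof -
  have k: "c + e * z \<in> ext F z" by (rule ext_memI[OF F(3,4)])
  have "(c + e * z) * w + (a + b * z) = 0" using eq by (simp add: algebra_simps)
  then have "(c + e * z) * w = - (a + b * z)" by (simp only: eq_neg_iff_add_eq_0)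
  then have "(c + e * z) * w \<in> ext F z"
    using D.sub_minus[OF subalg_sub[OF subalg_ext_F] ext_memI[OF F(1,2), of z]] by simp
  then have 0: "c + e * z = 0" by (rule subalg_free[OF subalg_ext_F w k])
  then show "c = 0" "e = 0" using ind2[OF z F(3,4)] by simp_all
  then have "a + b * z = 0" using eq by simp
  then show "a = 0" "b = 0" using ind2[OF z F(1,2)] by simp_all
qed

text \<open>Compare coefficients over 1, \<open>z\<close>, \<open>w\<close>, \<open>z * w\<close>.
  The square of \<open>z + w\<close> gives \<open>2 = 0\<close> and a common linear coefficient
  \<open>t\<close> for \<open>z\<close> and \<open>w\<close>; the square of \<open>z * w\<close>
  then gives \<open>n * t = 0\<close>. For nonzero \<open>t\<close> this makes
  \<open>z * z = t * z\<close>, so \<open>z\<close> would be in \<open>F\<close>.\<close>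

lemma commuting_pair:
  assumes z: "z \<notin> F" and w: "w \<notin> ext F z" and zw: "z * w = w * z"
  shows "(2 :: 'a) = 0" "z * z \<in> F" "w * w \<in> F"
proof -
  obtain n t where nt: "n \<in> F" "t \<in> F" "z * z = n + t * z" by (rule square)
  obtain m s where ms: "m \<in> F" "s \<in> F" "w * w = m + s * w" by (rule square)
  obtain e f where ef: "e \<in> F" "f \<in> F" "(z + w) * (z + w) = e + f * (z + w)" by (rule square)
  have "(n + m - e) + (t - f) * z + (s - f) * w + (1 + 1) * (z * w)
      = (n + t * z) + (m + s * w) + z * w + z * w - (e + f * (z + w))"
    unfolding distrib_right[of 1 1] mult_1_left by (simp add: algebra_simps)
  also have "\<dots> = z * z + w * w + z * w + w * z - (z + w) * (z + w)"
    by (simp only: nt(3) ms(3) ef(3) zw)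
  also have "\<dots> = 0" by (simp add: algebra_simps)
  finally have eq: "(n + m - e) + (t - f) * z + (s - f) * w + (1 + 1) * (z * w) = 0" .
  note i = ind4[OF z w F_diff[OF F_add[OF nt(1) ms(1)] ef(1)] F_diff[OF nt(2) ef(2)] F_diff[OF ms(2) ef(2)] F_add[OF F_1 F_1] eq]
  show "(2 :: 'a) = 0" using i(4) by simp
  have st: "s = t" using i(2,3) by simp
  obtain e' f' where ef': "e' \<in> F" "f' \<in> F" "(z * w) * (z * w) = e' + f' * (z * w)" by (rule square)
  have "(z * w) * (z * w) = z * (w * z) * w" by (simp only: mult.assoc)
  also have "\<dots> = (z * z) * (w * w)" by (simp only: zw[symmetric] mult.assoc)
  also have "\<dots> = n * m + n * t * w + t * (z * m) + t * (z * t) * w"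
    by (simp add: nt(3) ms(3) st algebra_simps)
  also have "\<dots> = n * m + n * t * w + t * m * z + t * t * (z * w)"
    by (simp only: F_comm[OF ms(1), of z, symmetric] F_comm[OF nt(2), of z, symmetric] mult.assoc)
  finally have "n * m + n * t * w + t * m * z + t * t * (z * w) = e' + f' * (z * w)" using ef'(3) by simp
  then have "(n * m - e') + (t * m) * z + (n * t) * w + (t * t - f') * (z * w) = 0"
    by (simp add: algebra_simps)
  note j = ind4[OF z w F_diff[OF F_mult[OF nt(1) ms(1)] ef'(1)] F_mult[OF nt(2) ms(1)] F_mult[OF nt(1,2)]
      F_diff[OF F_mult[OF nt(2) nt(2)] ef'(2)] this]
  have t0: "t = 0"
  proof (rule ccontr)
    assume "t \<noteq> 0"
    then have "n = 0" using j(3) by simp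
    then have "(z - t) * z = 0" using nt(3) by (simp add: left_diff_distrib)
    then have "z = t \<or> z = 0" by simp
    then show False using z nt(2) by auto
  qed
  show "z * z \<in> F" "w * w \<in> F" using nt ms st t0 by simp_all
qed

text \<open>By \<open>commuting_pair\<close>, an element \<open>z\<close> outside \<open>F\<close>
  that violates the second alternative leaves no element outside \<open>ext F z\<close>.\<close>

lemma commutative_case:
  assumes comm: "\<forall>x y :: 'a. x * y = y * x" and ne: "F \<noteq> UNIV"
  shows "deg = 2 \<or> (2 :: 'a) = 0 \<and> (\<forall>x. x * x \<in> F)"
proof (rule disjCI)
  assume "\<not> ((2 :: 'a) = 0 \<and> (\<forall>x. x * x \<in> F))"
  moreover obtain z0 where "z0 \<notin> F" using ne by auto
  ultimately obtain z where z: "z \<notin> F" "\<not> ((2 :: 'a) = 0 \<and> z * z \<in> F)" by auto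
  have "w \<in> ext F z" for w using commuting_pair(1,2)[OF z(1)] comm z(2) by auto
  then have "ext F z = UNIV" by auto
  then show "deg = 2" using dim_ext_F[OF z(1)] by simp
qed

text \<open>As \<open>v * v\<close> is in \<open>F\<close>, adjoining \<open>v\<close> to a
  subalgebra gives a subalgebra of twice the dimension.\<close>

lemma power_two:
  assumes comm: "\<forall>x y :: 'a. x * y = y * x" and sq: "\<forall>x. x * x \<in> F"
  shows "\<exists>m. deg = 2 ^ m"
proof -
  have "\<exists>m. deg = 2 ^ m" if "subalg A" "D.vdim A = 2 ^ j" for A j
    using that
  proof (induction "deg - D.vdim A" arbitrary: A j rule: less_induct)
    case less
    note A = less.prems(1)
    show ?case
    proof (cases "A = UNIV")
      case True
      then show ?thesis using less.prems(2) by auto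
    next
      case False
      then obtain v where v: "v \<notin> A" by auto
      have d: "D.vdim (ext A v) = 2 ^ Suc j" using dim_ext[OF A v] less.prems(2) by simp
      have "subalg (ext A v)"
        unfolding subalg_def
      proof (intro conjI ballI)
        show "D.vsub (ext A v)" by (rule ext_sub[OF subalg_sub[OF A]])
        show "1 \<in> ext A v" by (rule ext_base[OF subalg_sub[OF A] subalg_1[OF A]])
        fix x y assume "x \<in> ext A v" "y \<in> ext A v"
        then obtain a b c e where *: "a \<in> A" "b \<in> A" "x = a + b * v" "c \<in> A" "e \<in> A" "y = c + e * v"
          by (elim ext_memE)
        have "x * y = a * c + a * e * v + b * (v * c) + b * (v * e) * v" using * by (simp add: algebra_simps)
        also have "\<dots> = a * c + a * e * v + b * (c * v) + b * (e * v) * v"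
          using comm by metis
        also have "\<dots> = (a * c + b * e * (v * v)) + (a * e + b * c) * v" by (simp add: algebra_simps)
        finally have 1: "x * y = (a * c + b * e * (v * v)) + (a * e + b * c) * v" .
        have "v * v \<in> A" using sq F_subset[OF subalg_sub[OF A] subalg_1[OF A]] by simp
        then have "b * e * (v * v) \<in> A" by (rule subalg_mult[OF A subalg_mult[OF A *(2,5)]])
        then show "x * y \<in> ext A v"
          unfolding 1 using *
          by (intro ext_memI subalg_add[OF A _ \<open>b * e * (v * v) \<in> A\<close>] subalg_add[OF A subalg_mult[OF A] subalg_mult[OF A]]
              subalg_mult[OF A])
      qed
      moreover have "D.vdim (ext A v) \<le> deg"
        by (rule D.fin_subset(2)[OF D.sub_UNIV ext_sub[OF subalg_sub[OF A]] subset_UNIV fin_D])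
      moreover have "D.vdim A < D.vdim (ext A v)" using d less.prems(2) by simp
      ultimately show ?thesis using less.hyps[OF _ _ d] by simp
    qed
  qed
  from this[OF subalg_F, of 0] show ?thesis using dim_F by simp
qed

text \<open>For a central \<open>z\<close> outside \<open>F\<close>, \<open>commuting_pair\<close>
  forces characteristic 2 and puts the squares of all noncentral elements into \<open>F\<close>.
  Polarising, \<open>x * y + y * x\<close> is a nonzero element of \<open>F\<close> when
  \<open>x\<close> and \<open>y\<close> do not commute; replacing \<open>x\<close> by
  \<open>z * x\<close> multiplies it by \<open>z\<close>, so \<open>z\<close> would be in
  \<open>F\<close>.\<close>

lemma noncommutative_center:
  assumes xy: "x0 * y0 \<noteq> y0 * (x0 :: 'a)"
  shows "{z :: 'a. \<forall>x. z * x = x * z} = F"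
proof
  show "F \<subseteq> {z :: 'a. \<forall>x. z * x = x * z}" using F_comm by auto
  show "{z :: 'a. \<forall>x. z * x = x * z} \<subseteq> F"
  proof
    fix z assume "z \<in> {z :: 'a. \<forall>x. z * x = x * z}"
    then have z: "z * x = x * z" for x by simp
    show "z \<in> F"
    proof (rule ccontr)
      assume zF: "z \<notin> F"
      have nin: "x \<notin> ext F z" if "x * y \<noteq> y * x" for x y
      proof
        assume "x \<in> ext F z"
        then obtain a b where *: "a \<in> F" "b \<in> F" "x = a + b * z" by (rule ext_memE)
        have "b * z * y = y * (b * z)"
          by (metis z F_comm[OF *(2)] mult.assoc)
        then have "x * y = y * x" using * F_comm[OF *(1), of y] by (simp add: distrib_left distrib_right)
        then show False using that by simp
      qed
      have two: "(2 :: 'a) = 0" by (rule commuting_pair(1)[OF zF nin[OF xy] z])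
      have sq: "x * x \<in> F" if "x * y \<noteq> y * x" for x y
        by (rule commuting_pair(3)[OF zF nin[OF that] z])
      have pol: "x * y + y * x \<in> F" if xy: "x * y \<noteq> y * x" for x y
      proof -
        have "y * x \<noteq> x * y" using xy by simp
        moreover have "(x + y) * y \<noteq> y * (x + y)" using xy by (simp add: distrib_left distrib_right)
        ultimately have "(x + y) * (x + y) - x * x - y * y \<in> F" using xy by (intro F_diff sq)
        moreover have "(x + y) * (x + y) - x * x - y * y = x * y + y * x" by (simp add: algebra_simps)
        ultimately show ?thesis by simp
      qed
      let ?f = "x0 * y0 + y0 * x0"
      have f: "?f \<in> F" by (rule pol[OF xy])
      have "?f \<noteq> 0"
      proof
        assume "?f = 0"
        then have "x0 * y0 = - (y0 * x0)" by (simp add: eq_neg_iff_add_eq_0)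
        also have "\<dots> = y0 * x0"
        proof -
          have "y0 * x0 + y0 * x0 = 2 * (y0 * x0)" by (simp only: mult_2)
          then show ?thesis using two by (simp add: neg_eq_iff_add_eq_0)
        qed
        finally show False using xy by simp
      qed
      have z0: "z \<noteq> 0" using zF by auto
      have zxy: "z * x0 * y0 = z * (x0 * y0)" "y0 * (z * x0) = z * (y0 * x0)"
        by (simp only: mult.assoc, simp only: mult.assoc[symmetric] z[of y0])
      then have "z * x0 * y0 \<noteq> y0 * (z * x0)" using xy z0 by simp
      then have "z * x0 * y0 + y0 * (z * x0) \<in> F" by (rule pol)
      then have "z * ?f \<in> F" by (simp only: zxy distrib_left)
      then have "z * ?f * inverse ?f \<in> F" using F_inverse[OF f] by (rule F_mult)
      then show False using zF \<open>?f \<noteq> 0\<close> by (simp add: mult.assoc)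
    qed
  qed
qed

text \<open>Such an \<open>i\<close> generates a separable quadratic extension. If there were none,
  all elements outside \<open>F\<close> would have their squares in \<open>F\<close>. For
  \<open>p = x0 * y0\<close> one has \<open>p * p = f * p - (x0 * x0) * (y0 * y0)\<close> with
  \<open>f = x0 * y0 + y0 * x0\<close> nonzero in \<open>F\<close>, so \<open>p\<close> would be in
  \<open>F\<close> and commute with \<open>x0\<close>, making \<open>x0\<close> and
  \<open>y0\<close> commute.\<close>

lemma separable_generator:
  assumes xy: "x0 * y0 \<noteq> y0 * (x0 :: 'a)"
  obtains i where "i \<notin> F" "\<not> ((2 :: 'a) = 0 \<and> i * i \<in> F)"
proof (cases "\<exists>i. i \<notin> F \<and> \<not> ((2 :: 'a) = 0 \<and> i * i \<in> F)")
  case False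
  have nF: "x \<notin> F" if "x * y \<noteq> y * x" for x y using that F_comm by auto
  from False have sq: "(2 :: 'a) = 0 \<and> i * i \<in> F" if "i \<notin> F" for i using that by auto
  have x0: "x0 * x0 \<in> F" using sq[OF nF[OF xy]] by simp
  have y0: "y0 * y0 \<in> F" using sq[OF nF[of y0 x0]] xy by simp
  have "(x0 + y0) * y0 \<noteq> y0 * (x0 + y0)" using xy by (simp add: distrib_left distrib_right)
  then have "(x0 + y0) * (x0 + y0) \<in> F" using sq[OF nF] by simp
  then have "(x0 + y0) * (x0 + y0) - x0 * x0 - y0 * y0 \<in> F" using x0 y0 by (intro F_diff)
  moreover have "(x0 + y0) * (x0 + y0) - x0 * x0 - y0 * y0 = x0 * y0 + y0 * x0" by (simp add: algebra_simps)
  ultimately have f: "x0 * y0 + y0 * x0 \<in> F" (is "?f \<in> F") by simp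
  have two: "(2 :: 'a) = 0" using sq[OF nF[OF xy]] by simp
  have "?f \<noteq> 0"
  proof
    assume "?f = 0"
    then have "x0 * y0 = - (y0 * x0)" by (simp add: eq_neg_iff_add_eq_0)
    also have "\<dots> = y0 * x0"
    proof -
      have "y0 * x0 + y0 * x0 = 2 * (y0 * x0)" by (simp only: mult_2)
      then show ?thesis using two by (simp add: neg_eq_iff_add_eq_0)
    qed
    finally show False using xy by simp
  qed
  let ?p = "x0 * y0"
  have pF: "?p \<notin> F"
  proof
    assume p: "?p \<in> F"
    have "x0 \<noteq> 0" using xy by auto
    have "x0 * (y0 * x0) = x0 * (x0 * y0)" using F_comm[OF p, of x0] by (simp only: mult.assoc)
    then show False using xy \<open>x0 \<noteq> 0\<close> by simp
  qed
  have "?p * ?p = x0 * (?f - x0 * y0) * y0" by (simp add: algebra_simps)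
  also have "\<dots> = x0 * ?f * y0 - x0 * (x0 * y0) * y0" by (simp only: right_diff_distrib left_diff_distrib)
  also have "\<dots> = ?f * ?p - (x0 * x0) * (y0 * y0)" by (simp only: F_comm[OF f, of x0, symmetric] mult.assoc)
  finally have "?f * ?p = ?p * ?p + (x0 * x0) * (y0 * y0)" by simp
  then have "?f * ?p \<in> F" using sq[OF pF] x0 y0 by auto
  then have "inverse ?f * (?f * ?p) \<in> F" using F_inverse[OF f] F_mult by blast
  then show ?thesis using \<open>?f \<noteq> 0\<close> pF by (simp add: mult.assoc[symmetric])
qed (use that in auto)

text \<open>The field \<open>?K\<close> is its own centraliser. Commutators with \<open>i\<close>
  satisfy \<open>i * A v = A v * (t - i)\<close>, where \<open>t - i\<close> is the conjugate of
  \<open>i\<close>, so products of two of them commute with \<open>i\<close> and lie in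
  \<open>?K\<close>. Hence every commutator is a \<open>?K\<close>-multiple of \<open>A v0\<close>,
  and \<open>D = ?K + ?K v0\<close>.\<close>

lemma noncommutative_degree:
  assumes xy: "x0 * y0 \<noteq> y0 * (x0 :: 'a)"
  shows "deg = 4"
proof -
  obtain i where i: "i \<notin> F" "\<not> ((2 :: 'a) = 0 \<and> i * i \<in> F)" by (rule separable_generator[OF xy])
  let ?K = "ext F i"
  have K: "subalg ?K" by (rule subalg_ext_F)
  have cent: "w \<in> ?K" if "i * w = w * i" for w
    using commuting_pair(1,2)[OF i(1) _ that] i(2) by auto
  have Kc: "k * i = i * k" if "k \<in> ?K" for k
  proof -
    obtain a b where *: "a \<in> F" "b \<in> F" "k = a + b * i" using \<open>k \<in> ?K\<close> by (rule ext_memE)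
    have "b * i * i = i * b * i" by (simp only: F_comm[OF *(2), of i])
    then have "b * i * i = i * (b * i)" by (simp only: mult.assoc)
    then show ?thesis unfolding *(3) distrib_left distrib_right using F_comm[OF *(1), of i] by (simp only:)
  qed
  have "{z :: 'a. \<forall>x. z * x = x * z} = F" by (rule noncommutative_center[OF xy])
  then obtain v0 where v0: "i * v0 \<noteq> v0 * i" using i(1) by auto
  have v0K: "v0 \<notin> ?K" using Kc v0 by auto
  obtain n t where nt: "n \<in> F" "t \<in> F" "i * i = n + t * i" by (rule square)
  define A where "A v = i * v - v * i" for v
  have AW: "i * A v = A v * (t - i)" for v
  proof -
    have 1: "i * (i * v) = n * v + t * (i * v)"
      using arg_cong[OF nt(3), of "\<lambda>u. u * v"] by (simp only: mult.assoc distrib_right)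
    have 2: "v * i * i = n * v + t * (v * i)"
    proof -
      have "v * i * i = v * n + v * (t * i)"
        using arg_cong[OF nt(3), of "\<lambda>u. v * u"] by (simp only: mult.assoc distrib_left)
      also have "\<dots> = n * v + t * (v * i)"
        by (simp only: F_comm[OF nt(1), of v] mult.assoc[symmetric] F_comm[OF nt(2), of v])
      finally show ?thesis .
    qed
    have 3: "i * v * t = t * (i * v)" "v * i * t = t * (v * i)" by (simp_all only: F_comm[OF nt(2)])
    have "i * A v = i * (i * v) - i * v * i" by (simp only: A_def right_diff_distrib mult.assoc)
    also have "\<dots> = t * (i * v) - t * (v * i) - i * v * i + v * i * i" unfolding 1 2 by simp
    also have "\<dots> = A v * (t - i)" by (simp only: A_def left_diff_distrib right_diff_distrib 3) (simp add: algebra_simps)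
    finally show ?thesis .
  qed
  have AA: "A v * A w \<in> ?K" for v w
  proof (rule cent)
    have "(t - i) * A w = A w * t - A w * (t - i)"
      by (simp only: left_diff_distrib AW F_comm[OF nt(2), of "A w"])
    also have "\<dots> = A w * i" by (simp add: right_diff_distrib)
    finally have 1: "(t - i) * A w = A w * i" .
    have "i * (A v * A w) = A v * ((t - i) * A w)" by (simp only: mult.assoc[symmetric] AW)
    then show "i * (A v * A w) = A v * A w * i" by (simp only: 1 mult.assoc)
  qed
  let ?j = "A v0"
  have j0: "?j \<noteq> 0" using v0 by (simp add: A_def)
  have "v \<in> ext ?K v0" for v
  proof -
    \<comment> \<open>Chosen so that \<open>k * ?j = A v\<close>; as \<open>k\<close> commutes with
      \<open>i\<close>, this means that \<open>v - k * v0\<close> commutes with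
      \<open>i\<close>.\<close>
    define k where "k = A v * ?j * inverse (?j * ?j)"
    have k: "k \<in> ?K" unfolding k_def by (rule subalg_mult[OF K AA inverse_in[OF K AA]])
    have "k * ?j = A v * (?j * inverse (?j * ?j) * ?j)" by (simp only: k_def mult.assoc)
    also have "?j * inverse (?j * ?j) * ?j = 1" using j0
      by (simp add: nonzero_inverse_mult_distrib mult.assoc[symmetric])
    finally have "A v = k * ?j" by simp
    also have "\<dots> = A (k * v0)"
      by (simp only: A_def right_diff_distrib mult.assoc[symmetric] Kc[OF k])
    finally have "i * (v - k * v0) = (v - k * v0) * i" by (simp add: A_def algebra_simps)
    then have "v - k * v0 \<in> ?K" by (rule cent)
    then show ?thesis using ext_memI[OF _ k, of "v - k * v0" v0] by simp
  qed
  then have "ext ?K v0 = UNIV" by auto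
  then show ?thesis using dim_ext[OF K v0K] dim_ext_F[OF i(1)] by simp
qed

end

section \<open>Transfer from module records to subsets\<close>

lemma (in fspace) transfer:
  fixes g :: "'m \<Rightarrow> 'b"
  assumes M: "vectorspace (subfield_ring F) M" and inj: "inj_on g (carrier M)"
    and add: "\<And>x y. x \<in> carrier M \<Longrightarrow> y \<in> carrier M \<Longrightarrow> g (x \<oplus>\<^bsub>M\<^esub> y) = g x + g y"
    and smult: "\<And>k x. k \<in> F \<Longrightarrow> x \<in> carrier M \<Longrightarrow> g (k \<odot>\<^bsub>M\<^esub> x) = sc k (g x)"
  shows "vsub (g ` carrier M)"
    and "vectorspace.fin_dim (subfield_ring F) M \<longleftrightarrow> vfin (g ` carrier M)"
    and "vfin (g ` carrier M) \<Longrightarrow> vectorspace.dim (subfield_ring F) M = vdim (g ` carrier M)"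
proof -
  interpret M: vectorspace "subfield_ring F" M by (rule M)
  let ?I = "g ` carrier M"
  have cF: "carrier (subfield_ring F) = F" by (simp add: subfield_ring_def)
  have "g \<zero>\<^bsub>M\<^esub> = g \<zero>\<^bsub>M\<^esub> + g \<zero>\<^bsub>M\<^esub>" using add[of "\<zero>\<^bsub>M\<^esub>" "\<zero>\<^bsub>M\<^esub>"] by simp
  then have g0: "g \<zero>\<^bsub>M\<^esub> = 0" by simp
  show I: "vsub ?I"
  proof (rule fsubI)
    show "0 \<in> ?I" using imageI[OF M.M.zero_closed, of g] by (simp only: g0)
  next
    fix u v assume "u \<in> ?I" "v \<in> ?I"
    then obtain x y where "x \<in> carrier M" "y \<in> carrier M" "u = g x" "v = g y" by auto
    then show "u + v \<in> ?I" using add[of x y] by (intro image_eqI[of _ _ "x \<oplus>\<^bsub>M\<^esub> y"]) simp_all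
  next
    fix k v assume k: "k \<in> F" and "v \<in> ?I"
    then obtain x where "x \<in> carrier M" "v = g x" by auto
    then show "sc k v \<in> ?I"
      using smult[OF k, of x] M.smult_closed[of k x] k cF by (intro image_eqI[of _ _ "k \<odot>\<^bsub>M\<^esub> x"]) simp_all
  qed
  have vI: "vectorspace (subfield_ring F) (frec sc ?I)" by (rule vectorspace_frec[OF I])
  have "g \<in> LinearCombinations.module_hom (subfield_ring F) M (frec sc ?I)"
    using add smult by (auto simp: LinearCombinations.module_hom_def frec_def cF)
  then have L: "linear_map (subfield_ring F) M (frec sc ?I) g"
    using M vI by (auto simp: linear_map_def mod_hom_def vectorspace_def mod_hom_axioms_def)
  interpret L: linear_map "subfield_ring F" M "frec sc ?I" g by (rule L)
  define h where "h = the_inv_into (carrier M) g"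
  have h: "h (g x) = x" if "x \<in> carrier M" for x unfolding h_def by (rule the_inv_into_f_f[OF inj that])
  have "h \<in> LinearCombinations.module_hom (subfield_ring F) (frec sc ?I) M"
    unfolding LinearCombinations.module_hom_def
  proof (intro CollectI conjI ballI allI impI)
    show "h \<in> carrier (frec sc ?I) \<rightarrow> carrier M" using h by auto
    show "h (u \<oplus>\<^bsub>frec sc ?I\<^esub> v) = h u \<oplus>\<^bsub>M\<^esub> h v" if uv: "u \<in> carrier (frec sc ?I) \<and> v \<in> carrier (frec sc ?I)" for u v
    proof -
      obtain x y where *: "x \<in> carrier M" "y \<in> carrier M" "u = g x" "v = g y" using uv by auto
      then have e: "u \<oplus>\<^bsub>frec sc ?I\<^esub> v = g (x \<oplus>\<^bsub>M\<^esub> y)" by (simp add: frec_def add)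
      show ?thesis unfolding e using * h[of "x \<oplus>\<^bsub>M\<^esub> y"] h[of x] h[of y] by simp
    qed
    show "h (k \<odot>\<^bsub>frec sc ?I\<^esub> v) = k \<odot>\<^bsub>M\<^esub> h v" if kv: "k \<in> carrier (subfield_ring F) \<and> v \<in> carrier (frec sc ?I)" for k v
    proof -
      obtain x where *: "x \<in> carrier M" "v = g x" using kv by auto
      then have e: "k \<odot>\<^bsub>frec sc ?I\<^esub> v = g (k \<odot>\<^bsub>M\<^esub> x)" using kv by (simp add: frec_def smult cF)
      show ?thesis unfolding e using * h[of "k \<odot>\<^bsub>M\<^esub> x"] h[of x] kv by simp
    qed
  qed
  then have L': "linear_map (subfield_ring F) (frec sc ?I) M h"
    using M vI by (auto simp: linear_map_def mod_hom_def vectorspace_def mod_hom_axioms_def)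
  have hs: "h ` carrier (frec sc ?I) = carrier M" using h by (simp add: image_image)
  show fin: "M.fin_dim \<longleftrightarrow> vfin ?I"
  proof
    assume "M.fin_dim"
    then show "vfin ?I" using L.surj_fin_dim by (simp add: ffin_def)
  next
    assume "vfin ?I"
    then have "vectorspace.fin_dim (subfield_ring F) (frec sc ?I)" by (simp add: ffin_def)
    then show "M.fin_dim" by (rule linear_map.surj_fin_dim[OF L' _ hs])
  qed
  show "vfin ?I \<Longrightarrow> M.dim = vdim ?I"
    using L.dim_eq[OF _ inj] fin by (simp add: fdim_def)
qed

context central
begin

lemma vectorspace_self_module: "vectorspace (subfield_ring F) (self_module :: ('a, 'a) module)"
proof -
  have K: "cring (subfield_ring F)" using field_F by (simp add: field_def domain_def)
  have "\<exists>n. v + n = 0" for v :: 'a by (intro exI[of _ "- v"]) simp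
  then have "Module.module (subfield_ring F) (self_module :: ('a, 'a) module)"
    by (intro module_criteria K) (auto simp: self_module_def subfield_ring_def algebra_simps)
  then show ?thesis by (simp add: vectorspace_def field_F)
qed

lemma degree_over_eq:
  shows "finite_degree F \<longleftrightarrow> ffin F (*) (UNIV :: 'a set)"
    and "finite_degree F \<Longrightarrow> degree_over F = fdim F (*) (UNIV :: 'a set)"
proof -
  interpret D: fspace F "(*)" by unfold_locales (simp_all add: algebra_simps)
  have c: "(\<lambda>x. x) ` carrier (self_module :: ('a, 'a) module) = UNIV" by (simp add: self_module_def)
  note t = D.transfer[OF vectorspace_self_module, of "\<lambda>x. x", unfolded c]
  show 1: "finite_degree F \<longleftrightarrow> ffin F (*) (UNIV :: 'a set)"
    unfolding finite_degree_def by (rule t(2)) (simp_all add: self_module_def)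
  show "degree_over F = fdim F (*) (UNIV :: 'a set)" if "finite_degree F"
    unfolding degree_over_def by (rule t(3)) (use that 1 in \<open>simp_all add: self_module_def\<close>)
qed

end

section \<open>Separability and the clauses of quadratic type\<close>

context qdiv
begin

lemma domain_if_commutative:
  assumes comm: "\<forall>x y :: 'a. x * y = y * x"
  shows "domain (class_ring :: 'a ring)"
proof -
  have "\<exists>y. x + y = 0" for x :: 'a by (intro exI[of _ "- x"]) simp
  then have "cring (class_ring :: 'a ring)"
    by unfold_locales (use comm in \<open>auto simp: algebra_simps Units_def\<close>)
  then show ?thesis by (intro domain.intro) (simp_all add: domain_axioms_def)
qed

lemma poly_carrier: "p \<in> carrier (F[X]\<^bsub>class_ring\<^esub>) \<longleftrightarrow> p = [] \<or> set p \<subseteq> F \<and> hd p \<noteq> 0"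
  by (simp add: univ_poly_carrier[symmetric] polynomial_def)

text \<open>The minimal polynomial has degree 1 or 2, and in each case some combination of it and
  its derivative is a nonzero constant, so a common divisor is a unit.\<close>

lemma separable_irr:
  assumes comm: "\<forall>x y :: 'a. x * y = y * x" and deg2: "deg = 2"
    and ns: "\<not> ((2 :: 'a) = 0 \<and> (\<forall>x. x * x \<in> F))"
  shows "separable_poly F (ring.Irr class_ring F x)"
proof -
  have dom: "domain (class_ring :: 'a ring)" by (rule domain_if_commutative[OF comm])
  have rg: "ring (class_ring :: 'a ring)" by (rule class_ring.ring_axioms)
  have sr: "subring F (class_ring :: 'a ring)" by (rule subfieldE(1)[OF subfield_F])
  note poly_simps = ring.poly_mult.simps[OF rg] ring.poly_add.simps[OF rg] ring.normalize.simps[OF rg]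
  interpret UP: cring "F[X]\<^bsub>class_ring\<^esub>" by (rule domain.univ_poly_is_cring[OF dom sr])
  obtain n t where nt: "n \<in> F" "t \<in> F" "x * x = n + t * x" by (rule square)
  \<comment> \<open>An explicit annihilating polynomial; the minimal polynomial divides it, which
    bounds the degree.\<close>
  define p0 where "p0 = (if x \<in> F then [1, - x] else [1, - t, - n])"
  have p0: "p0 \<in> carrier (F[X]\<^bsub>class_ring\<^esub>)" "p0 \<noteq> []" "length p0 = (if x \<in> F then 2 else 3)"
    using nt F_minus[OF nt(1)] F_minus[OF nt(2)] F_minus[of x] by (simp_all add: p0_def poly_carrier)
  have e0: "ring.eval class_ring p0 x = \<zero>\<^bsub>class_ring\<^esub>"
    using nt(3) by (simp add: p0_def ring.eval.simps[OF rg] class_ring_simps power2_eq_square)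
  have xc: "x \<in> carrier class_ring" by simp
  note alg = ring.algebraicI[OF rg p0(1,2) e0]
  let ?I = "ring.Irr class_ring F x"
  have I: "?I \<in> carrier (F[X]\<^bsub>class_ring\<^esub>)" "hd ?I = 1" "ring.eval class_ring ?I x = 0"
    using domain.IrrE(1,3,4)[OF dom subfield_F xc alg] by simp_all
  have len: "length ?I - 1 \<le> length p0 - 1"
    by (rule domain.pdivides_imp_degree_le[OF dom sr I(1) p0(1,2) domain.Irr_minimal[OF dom subfield_F xc alg p0(1) e0]])
  have nI: "?I \<noteq> []" by (rule domain.pirreducibleE(1)[OF dom sr I(1) domain.IrrE(2)[OF dom subfield_F xc alg]])
  have inF: "set ?I \<subseteq> F" using I(1) nI by (simp add: poly_carrier)
  have unit: "[k] \<in> Units (F[X]\<^bsub>class_ring\<^esub>)" if "k \<in> F" "k \<noteq> 0" for k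
    unfolding ring.univ_poly_units[OF rg subfield_F] using that by simp
  show ?thesis
    unfolding separable_poly_def
  proof (intro ballI impI, elim conjE)
    fix q assume q: "q \<in> carrier (F[X]\<^bsub>class_ring\<^esub>)" and qI: "q divides\<^bsub>F[X]\<^bsub>class_ring\<^esub>\<^esub> ?I"
      and qd: "q divides\<^bsub>F[X]\<^bsub>class_ring\<^esub>\<^esub> formal_derivative ?I"
    have uq: "q \<in> Units (F[X]\<^bsub>class_ring\<^esub>)" if "q divides\<^bsub>F[X]\<^bsub>class_ring\<^esub>\<^esub> [k]" "k \<in> F" "k \<noteq> 0" for k
      by (rule UP.divides_unit[OF that(1) q unit[OF that(2,3)]])
    have "1 \<le> length ?I" "length ?I \<le> length p0" using len nI p0(2) by (cases ?I; cases p0; simp)+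
    then have "length ?I = 1 \<or> length ?I = 2 \<or> length ?I = 3 \<and> x \<notin> F" using p0(3) by (cases "x \<in> F") auto
    then consider "length ?I = 1" | "length ?I = 2" | "length ?I = 3" "x \<notin> F" by auto
    then show "q \<in> Units (F[X]\<^bsub>class_ring\<^esub>)"
    proof cases
      case 1
      then have "?I = [1]" using I(2) by (cases ?I) simp_all
      then show ?thesis using I(3) by (simp add: ring.eval.simps[OF rg] class_ring_simps)
    next
      case 2
      then obtain c where c: "?I = [1, c]" using I(2)
        by (cases ?I; cases "tl ?I") auto
      have "formal_derivative ?I = [1]" unfolding c formal_derivative_def
        by (simp add: upt_rec ring.coeff.simps[OF rg] ring.normalize.simps[OF rg])
      then show ?thesis using uq[of 1] qd by simp
    next
      case 3
      then obtain a b where ab: "?I = [1, a, b]" using I(2)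
        by (cases ?I; cases "tl ?I"; cases "tl (tl ?I)") auto
      have F: "a \<in> F" "b \<in> F" using inF ab by simp_all
      have ex: "x * x + (a * x + b) = 0" using I(3) unfolding ab
        by (simp add: ring.eval.simps[OF rg] class_ring_simps power2_eq_square)
      have d: "formal_derivative ?I = ring.normalize class_ring [2, a]"
        unfolding ab formal_derivative_def
        by (simp add: upt_rec ring.coeff.simps[OF rg])
      show ?thesis
      proof (cases "(2 :: 'a) = 0")
        case True
        \<comment> \<open>With \<open>a = 0\<close> in characteristic 2 the square of
          \<open>x\<close> lies in \<open>F\<close>, and so does that of every
          \<open>u + v * x\<close>, contrary to \<open>ns\<close>. The derivative is therefore the
          nonzero constant \<open>a\<close>.\<close>
        have "a \<noteq> 0"
        proof
          assume a0: "a = 0"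
          then have "x * x = - b" using ex by (simp add: eq_neg_iff_add_eq_0)
          then have xx: "x * x \<in> F" using F by auto
          have "ext F x = UNIV"
            by (rule D.fin_subset(3)[OF D.sub_UNIV ext_sub[OF subalg_sub[OF subalg_F]] subset_UNIV fin_D])
              (simp add: dim_ext_F[OF 3(2)] deg2)
          have "y * y \<in> F" for y
          proof -
            have "y \<in> ext F x" using \<open>ext F x = UNIV\<close> by simp
            then obtain u v where uv: "u \<in> F" "v \<in> F" "y = u + v * x" by (rule ext_memE)
            have "y * y = u * u + u * (v * x) + u * (v * x) + (v * x) * (v * x)"
              using comm uv(3) by (simp add: algebra_simps)
            also have "u * u + u * (v * x) + u * (v * x) = u * u + 2 * (u * (v * x))" by (simp only: mult_2 add.assoc)
            also have "\<dots> = u * u" using True by simp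
            also have "(v * x) * (v * x) = v * v * (x * x)" using comm by (metis mult.assoc)
            finally show ?thesis using uv xx by auto
          qed
          then show False using ns True by simp
        qed
        then show ?thesis using uq[OF _ F(1)] qd d True by (simp add: ring.normalize.simps[OF rg])
      next
        case False
        then have d2: "formal_derivative ?I = [2, a]" using d by (simp add: ring.normalize.simps[OF rg])
        have four: "(4 :: 'a) \<noteq> 0"
        proof -
          have e: "(2 :: 'a) * 2 = 4" by simp
          show ?thesis using no_zero_divisors[OF False False] unfolding e .
        qed
        have "(2 * x + a) * (2 * x + a) = 2 * x * (2 * x) + (2 * x * a + a * (2 * x)) + a * a"
          by (simp only: distrib_left distrib_right add_ac)
        also have "2 * x * (2 * x) = 4 * (x * x)"
        proof -
          have "2 * x * (2 * x) = 2 * (x * 2 * x)" by (simp only: mult.assoc)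
          also have "x * 2 = 2 * x" using comm by blast
          finally show ?thesis by (simp add: mult.assoc)
        qed
        also have "2 * x * a + a * (2 * x) = 4 * (a * x)"
        proof -
          have 1: "a * (2 * x) = 2 * x * a" using comm by blast
          have "2 * x * a = 2 * (a * x)" using comm[rule_format, of x a] by (simp only: mult.assoc)
          then have "2 * x * a + a * (2 * x) = (2 + 2) * (a * x)" by (simp only: 1 distrib_right)
          then show ?thesis by simp
        qed
        finally have "(2 * x + a) * (2 * x + a) = 4 * (x * x + (a * x + b)) + (a * a - 4 * b)"
          by (simp add: distrib_left)
        then have delta: "(2 * x + a) * (2 * x + a) = a * a - 4 * b" using ex by simp
        have F2: "(2 :: 'a) \<in> F" "(4 :: 'a) \<in> F"
        proof -
          have "(1 :: 'a) + 1 \<in> F" by (intro F_add F_1)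
          then show "(2 :: 'a) \<in> F" by simp
          then have "(2 :: 'a) * 2 \<in> F" by (intro F_mult)
          then show "(4 :: 'a) \<in> F" by simp
        qed
        have "2 * x + a \<noteq> 0"
        proof
          assume "2 * x + a = 0"
          then have "2 * x = - a" by (simp add: eq_neg_iff_add_eq_0)
          moreover have "inverse 2 * - a \<in> F" by (rule F_mult[OF F_inverse[OF F2(1)] F_minus[OF F(1)]])
          ultimately have "inverse 2 * (2 * x) \<in> F" by (simp only:)
          moreover have "inverse 2 * (2 * x) = x" by (simp only: mult.assoc[symmetric] left_inverse[OF False] mult_1_left)
          ultimately show False using 3(2) by (simp only:)
        qed
        then have dn: "a * a - 4 * b \<noteq> 0" unfolding delta[symmetric] by simp
        let ?U = "F[X]\<^bsub>class_ring\<^esub>"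
        have aa: "2 * a + 2 * a = 4 * a" by (simp only: distrib_right[symmetric]) simp
        \<comment> \<open>The square of the derivative minus 4 times the polynomial is the
          discriminant \<open>a * a - 4 * b\<close>. By \<open>delta\<close> it equals the square of
          \<open>2 * x + a\<close>, which is nonzero as \<open>x\<close> is outside
          \<open>F\<close>.\<close>
        have pp: "[2, a] \<otimes>\<^bsub>?U\<^esub> [2, a] = [4, 4 * a, a * a]"
          using four comm[rule_format, of a "2 :: 'a"] False
          by (cases "a = 0") (simp_all add: univ_poly_mult poly_simps aa)
        have kI: "[- 4] \<otimes>\<^bsub>?U\<^esub> [1, a, b] = [- 4, - 4 * a, - 4 * b]"
          using four by (simp add: univ_poly_mult poly_simps)
        have su: "[4, 4 * a, a * a] \<oplus>\<^bsub>?U\<^esub> [- 4, - 4 * a, - 4 * b] = [a * a - 4 * b]"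
          using dn by (simp add: univ_poly_add poly_simps)
        obtain r where r: "r \<in> carrier ?U" "[2, a] = q \<otimes>\<^bsub>?U\<^esub> r" using qd d2 by (auto simp: factor_def)
        obtain s where s: "s \<in> carrier ?U" "[1, a, b] = q \<otimes>\<^bsub>?U\<^esub> s" using qI ab by (auto simp: factor_def)
        have c4: "[- 4] \<in> carrier ?U" using F2 four by (auto simp: poly_carrier)
        have c2: "[2, a] \<in> carrier ?U" using F F2 False by (simp add: poly_carrier)
        have "[a * a - 4 * b] = [2, a] \<otimes>\<^bsub>?U\<^esub> [2, a] \<oplus>\<^bsub>?U\<^esub> [- 4] \<otimes>\<^bsub>?U\<^esub> [1, a, b]"
          by (simp only: pp kI su)
        also have "\<dots> = (q \<otimes>\<^bsub>?U\<^esub> r) \<otimes>\<^bsub>?U\<^esub> [2, a] \<oplus>\<^bsub>?U\<^esub> [- 4] \<otimes>\<^bsub>?U\<^esub> (q \<otimes>\<^bsub>?U\<^esub> s)"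
          by (simp only: r(2)[symmetric] s(2)[symmetric])
        also have "\<dots> = q \<otimes>\<^bsub>?U\<^esub> (r \<otimes>\<^bsub>?U\<^esub> [2, a] \<oplus>\<^bsub>?U\<^esub> [- 4] \<otimes>\<^bsub>?U\<^esub> s)"
          using q r(1) s(1) c4 c2 by (simp add: UP.r_distr UP.m_assoc UP.m_lcomm)
        finally have "q divides\<^bsub>?U\<^esub> [a * a - 4 * b]"
          using q r(1) s(1) c4 c2 by (intro dividesI[of "r \<otimes>\<^bsub>?U\<^esub> [2, a] \<oplus>\<^bsub>?U\<^esub> [- 4] \<otimes>\<^bsub>?U\<^esub> s"]) simp_all
        then show ?thesis by (rule uq) (use dn F F2 in auto)
      qed
    qed
  qed
qed

theorem quadratic_type:
  assumes deg: "degree_over F = deg"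
  shows "quadratic_type F"
proof (cases "F = UNIV")
  case True
  then have "degree_over F = 1" using deg dim_F by simp
  then show ?thesis by (simp add: quadratic_type_def)
next
  case ne: False
  show ?thesis
  proof (cases "\<forall>x y :: 'a. x * y = y * x")
    case comm: True
    show ?thesis
    proof (cases "(2 :: 'a) = 0 \<and> (\<forall>x. x * x \<in> F)")
      case True
      obtain m where m: "deg = 2 ^ m" using power_two[OF comm] True by auto
      have "m \<noteq> 0"
      proof
        assume "m = 0"
        then have "D.vdim F = deg" using m dim_F by simp
        then have "F = UNIV"
          by (rule D.fin_subset(3)[OF D.sub_UNIV subalg_sub[OF subalg_F] subset_UNIV fin_D])
        then show False using ne by simp
      qed
      moreover have "CHAR('a) = 2"
      proof -
        have "of_nat 2 = (0 :: 'a)" using True by simp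
        then have "CHAR('a) dvd 2" by (simp only: of_nat_eq_0_iff_char_dvd)
        then have "CHAR('a) = 1 \<or> CHAR('a) = 2" using dvd_imp_le[of "CHAR('a)" 2]
          by (cases "CHAR('a) = 0") (auto simp: le_Suc_eq numeral_2_eq_2)
        then show ?thesis using CHAR_not_1' by auto
      qed
      ultimately show ?thesis
        using comm True m deg by (auto simp: quadratic_type_def power2_eq_square Suc_le_eq)
    next
      case False
      then have d2: "deg = 2" using commutative_case[OF comm ne] by blast
      then have "separable_field_extension F"
        using separable_irr[OF comm d2 False] comm by (simp add: separable_field_extension_def)
      then show ?thesis using d2 deg by (simp add: quadratic_type_def)
    qed
  next
    case False
    then obtain x0 y0 :: 'a where xy: "x0 * y0 \<noteq> y0 * x0" by auto
    have "I = {0} \<or> I = UNIV" if I: "ideal I (class_ring :: 'a ring)" for I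
    proof (cases "I = {0}")
      case False
      have "0 \<in> I" using additive_subgroup.zero_closed[OF ideal.axioms(1)[OF I]] by simp
      then obtain x where x: "x \<in> I" "x \<noteq> 0" using False by (elim not_zeroE)
      have "y \<in> I" for y
        using ideal.I_l_closed[OF I x(1), of "y * inverse x"] x(2) by (simp add: mult.assoc)
      then show ?thesis by auto
    qed simp
    then show ?thesis
      using noncommutative_degree[OF xy] noncommutative_center[OF xy] deg
      by (simp add: quadratic_type_def quaternion_algebra_def)
  qed
qed

end

section \<open>Matrices as operators\<close>

text \<open>Columns of length \<open>n\<close> are encoded as functions supported on \<open>{..<n}\<close>: the type \<^typ>\<open>'a vec\<close> mixes
  lengths and is not an additive group.\<close>

definition frs :: "(nat \<Rightarrow> 'a::division_ring) \<Rightarrow> 'a \<Rightarrow> nat \<Rightarrow> 'a" where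
  "frs v a = (\<lambda>i. v i * a)"

definition fvec :: "nat \<Rightarrow> (nat \<Rightarrow> 'a::division_ring) set" where
  "fvec n = {v. \<forall>i\<ge>n. v i = 0}"

definition to_fun :: "nat \<Rightarrow> 'a::division_ring vec \<Rightarrow> nat \<Rightarrow> 'a" where
  "to_fun n w = (\<lambda>i. if i < n then w $ i else 0)"

definition op_of :: "nat \<Rightarrow> 'a::division_ring mat \<Rightarrow> (nat \<Rightarrow> 'a) \<Rightarrow> nat \<Rightarrow> 'a" where
  "op_of n M v = to_fun n (M *\<^sub>v vec n v)"

lemma vec_to_fun: "w \<in> carrier_vec n \<Longrightarrow> vec n (to_fun n w) = w"
  by (intro eq_vecI) (auto simp: to_fun_def)

lemma to_fun_vec: "v \<in> fvec n \<Longrightarrow> to_fun n (vec n v) = v"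
  by (auto simp: to_fun_def fvec_def fun_eq_iff)

lemma to_fun_in: "to_fun n w \<in> fvec n"
  by (simp add: to_fun_def fvec_def)

lemma to_fun_add: "u \<in> carrier_vec n \<Longrightarrow> w \<in> carrier_vec n \<Longrightarrow> to_fun n (u + w) = to_fun n u + to_fun n w"
  by (auto simp: to_fun_def fun_eq_iff)

lemma vec_add: "vec n (u + v) = vec n u + vec n (v :: nat \<Rightarrow> 'a::division_ring)"
  by (intro eq_vecI) auto

lemma mult_vec_right:
  fixes M :: "'a::division_ring mat"
  assumes "M \<in> carrier_mat n n" "w \<in> carrier_vec n"
  shows "M *\<^sub>v map_vec (\<lambda>x. x * a) w = map_vec (\<lambda>x. x * a) (M *\<^sub>v w)"
  using assms
  by (intro eq_vecI) (auto simp: scalar_prod_def sum_distrib_right mult.assoc intro!: sum.cong)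

lemma smult_mult_vec:
  fixes M :: "'a::division_ring mat"
  assumes "M \<in> carrier_mat n n" "w \<in> carrier_vec n"
  shows "(k \<cdot>\<^sub>m M) *\<^sub>v w = map_vec (\<lambda>x. k * x) (M *\<^sub>v w)"
  using assms
  by (intro eq_vecI) (auto simp: scalar_prod_def sum_distrib_left mult.assoc intro!: sum.cong)

lemma mult_unit_vec:
  fixes M :: "'a::division_ring mat"
  assumes "M \<in> carrier_mat n n" "j < n"
  shows "M *\<^sub>v unit_vec n j = col M j"
  using assms by (intro eq_vecI) (simp_all add: scalar_prod_right_unit)

lemma op_of_eq_0:
  assumes M: "M \<in> carrier_mat n n" and 0: "\<And>v. v \<in> fvec n \<Longrightarrow> op_of n M v = 0"
  shows "M = 0\<^sub>m n n"
proof (rule eq_matI)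
  fix i j assume ij: "i < dim_row (0\<^sub>m n n :: 'a mat)" "j < dim_col (0\<^sub>m n n :: 'a mat)"
  let ?e = "to_fun n (unit_vec n j :: 'a vec)"
  have "op_of n M ?e i = 0" using 0[OF to_fun_in] by simp
  then have "(M *\<^sub>v unit_vec n j) $ i = 0" using ij by (simp add: op_of_def vec_to_fun, simp add: to_fun_def)
  then have "row M i \<bullet> unit_vec n j = 0" using M ij by simp
  then show "M $$ (i, j) = 0\<^sub>m n n $$ (i, j)" using M ij by (simp add: scalar_prod_right_unit)
qed (use M in auto)

locale column_space = central F for F :: "'a::division_ring set" +
  assumes fin_F: "ffin F (*) (UNIV :: 'a set)"
begin

sublocale rspace_fin F frs
  by unfold_locales (auto simp: frs_def fun_eq_iff algebra_simps fin_F)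

lemma dsub_fvec: "dsub (fvec n)"
  by (auto simp: dsub_def fvec_def frs_def)

lemma flin_coord: "flin F scv (*) W (\<lambda>v. v i)"
  by (rule flinI, simp, simp add: frs_def, rule F_comm[symmetric])

lemma fvec_0: "fvec 0 = {0 :: nat \<Rightarrow> 'a}"
  by (auto simp: fvec_def fun_eq_iff)

lemma fvec_ker: "{v \<in> fvec (Suc n). v n = 0} = (fvec n :: (nat \<Rightarrow> 'a) set)"
  by (auto simp: fvec_def le_Suc_eq) (metis le_antisym not_less_eq_eq)

lemma fvec_dim: "V.vfin (fvec n) \<and> V.vdim (fvec n) = n * dg"
proof (induction n)
  case 0
  then show ?case unfolding fvec_0 using V.fin_zero V.dim_zero by simp
next
  case (Suc n)
  have s: "V.vsub (fvec (Suc n))" by (rule dsub_sub[OF dsub_fvec])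
  have im: "(\<lambda>v. v n) ` fvec (Suc n) = (UNIV :: 'a set)"
  proof (rule equalityI[OF subset_UNIV], rule subsetI)
    fix a :: 'a
    have "(\<lambda>i. if i = n then a else 0) \<in> fvec (Suc n)" by (simp add: fvec_def)
    then show "a \<in> (\<lambda>v. v n) ` fvec (Suc n)" by (rule rev_image_eqI) simp
  qed
  have f: "V.vfin (fvec (Suc n))"
    by (rule VD.fin_extension[OF s flin_coord[of _ n]]) (use Suc fin_D in \<open>simp_all only: fvec_ker im\<close>)
  have "D.vdim ((\<lambda>v. v n) ` fvec (Suc n)) + V.vdim {v \<in> fvec (Suc n). v n = 0} = V.vdim (fvec (Suc n))"
    by (rule VD.rank_nullity(2)[OF s flin_coord f])
  then show ?case using f Suc by (simp only: im fvec_ker) simp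
qed

lemma op_of_add:
  assumes "A \<in> carrier_mat n n" "B \<in> carrier_mat n n"
  shows "op_of n (A + B) = op_of n A + op_of n B"
  using assms
  by (auto simp: fun_eq_iff op_of_def add_mult_distrib_mat_vec[of _ n n] to_fun_add[symmetric])

lemma op_of_smult:
  assumes "k \<in> F" "A \<in> carrier_mat n n"
  shows "op_of n (k \<cdot>\<^sub>m A) = sco k (op_of n A)"
  using assms
  by (auto simp: fun_eq_iff op_of_def smult_mult_vec[of _ n] to_fun_def frs_def F_comm)

lemma op_of_dlin:
  assumes M: "M \<in> carrier_mat n n" shows "dlin (fvec n) (op_of n M)"
  unfolding dlin_def
proof (intro conjI ballI allI)
  show "op_of n M v \<in> fvec n" for v by (simp add: op_of_def to_fun_in)
  show "op_of n M (u + v) = op_of n M u + op_of n M v" for u v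
    unfolding op_of_def vec_add using M
    by (subst mult_add_distrib_mat_vec[OF M]) (simp_all add: to_fun_add)
  show "op_of n M (frs v a) = frs (op_of n M v) a" for v a
  proof -
    have "vec n (frs v a) = map_vec (\<lambda>x. x * a) (vec n v)" by (intro eq_vecI) (auto simp: frs_def)
    then have "M *\<^sub>v vec n (frs v a) = map_vec (\<lambda>x. x * a) (M *\<^sub>v vec n v)"
      using mult_vec_right[OF M, of "vec n v" a] by simp
    then show ?thesis using M by (auto simp: op_of_def to_fun_def frs_def fun_eq_iff)
  qed
qed

lemma one_minus_mult_vec:
  fixes M :: "'a mat"
  assumes "M \<in> carrier_mat n n" "w \<in> carrier_vec n"
  shows "(1\<^sub>m n - M) *\<^sub>v w = w - M *\<^sub>v w"
  using assms by (subst minus_mult_distrib_mat_vec[of _ n n]) simp_all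

lemma no_fixed_vector:
  fixes M :: "'a mat"
  assumes M: "M \<in> carrier_mat n n" and i: "invertible_mat (1\<^sub>m n - M)"
    and v: "v \<in> fvec n" "op_of n M v = v"
  shows "v = 0"
proof -
  obtain B where B: "B * (1\<^sub>m n - M) = 1\<^sub>m (dim_row B)" "(1\<^sub>m n - M) * B = 1\<^sub>m n"
    using i M by (auto simp: invertible_mat_def inverts_mat_def)
  \<comment> \<open>\<open>invertible_mat\<close> leaves the size of \<open>B\<close> open; the two
    products determine it.\<close>
  have "dim_col (B * (1\<^sub>m n - M)) = n" "dim_col ((1\<^sub>m n - M) * B) = n" using M B(2) by simp_all
  then have Bc: "B \<in> carrier_mat n n" using B(1) by (intro carrier_matI) simp_all
  let ?w = "vec n v"
  have w: "?w \<in> carrier_vec n" by simp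
  have Mw: "M *\<^sub>v ?w \<in> carrier_vec n" using M by simp
  have "vec n (to_fun n (M *\<^sub>v ?w)) = ?w" using v(2) by (simp add: op_of_def)
  then have "M *\<^sub>v ?w = ?w" using vec_to_fun[OF Mw] by simp
  then have 0: "(1\<^sub>m n - M) *\<^sub>v ?w = 0\<^sub>v n" using one_minus_mult_vec[OF M w] by simp
  have "?w = (B * (1\<^sub>m n - M)) *\<^sub>v ?w" using B(1) Bc by simp
  also have "\<dots> = B *\<^sub>v ((1\<^sub>m n - M) *\<^sub>v ?w)" by (rule assoc_mult_mat_vec[OF Bc minus_carrier_mat[OF M] w])
  also have "\<dots> = 0\<^sub>v n" unfolding 0 using Bc by (intro eq_vecI) (auto simp: scalar_prod_def)
  finally have "to_fun n ?w = to_fun n (0\<^sub>v n)" by (rule arg_cong)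
  then have "v = to_fun n (0\<^sub>v n)" using to_fun_vec[OF v(1)] by simp
  then have "v i = 0" for i by (cases "i < n") (simp_all add: to_fun_def)
  then show ?thesis by (simp add: fun_eq_iff)
qed

text \<open>Without nonzero fixed vectors \<open>1 - M\<close> is injective on a finite-dimensional
  \<open>F\<close>-space, hence onto. Preimages of the unit vectors are the columns of a right
  inverse, and injectivity makes it a left inverse.\<close>

lemma invertible_if_no_fixed_vector:
  fixes M :: "'a mat"
  assumes M: "M \<in> carrier_mat n n" and nf: "\<And>v. v \<in> fvec n \<Longrightarrow> op_of n M v = v \<Longrightarrow> v = 0"
  shows "invertible_mat (1\<^sub>m n - M)"
proof -
  let ?A = "1\<^sub>m n - M"
  have A: "?A \<in> carrier_mat n n" using M by auto
  define phi where "phi v = v - op_of n M v" for v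
  have s: "V.vsub (fvec n)" by (rule dsub_sub[OF dsub_fvec])
  have f: "V.vfin (fvec n)" using fvec_dim by simp
  note dl = op_of_dlin[OF M, unfolded dlin_def]
  have l: "flin F scv scv (fvec n) phi"
    using dl by (intro flinI) (simp_all add: phi_def rs_diff)
  have im: "phi ` fvec n \<subseteq> fvec n"
    using dl dsub_diff[OF dsub_fvec] by (auto simp: phi_def)
  have "V.vdim (phi ` fvec n) = V.vdim (fvec n)"
    by (rule V.self.dim_inj[OF s l f]) (use nf in \<open>simp add: phi_def\<close>)
  then have surj: "phi ` fvec n = fvec n" by (rule V.fin_subset(3)[OF s V.self.sub_image[OF s l] im f])
  have col: "\<exists>b. b \<in> fvec n \<and> phi b = to_fun n (unit_vec n j)" for j
  proof -
    have "to_fun n (unit_vec n j) \<in> phi ` fvec n" unfolding surj by (rule to_fun_in)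
    then show ?thesis by auto
  qed
  then obtain b where b: "\<And>j. b j \<in> fvec n" "\<And>j. phi (b j) = to_fun n (unit_vec n j)" by metis
  define B where "B = mat n n (\<lambda>(i, j). b j i)"
  have B: "B \<in> carrier_mat n n" by (simp add: B_def)
  have colB: "col B j = vec n (b j)" if "j < n" for j using that by (intro eq_vecI) (auto simp: B_def)
  have Ab: "?A *\<^sub>v vec n (b j) = unit_vec n j" for j
  proof -
    have w: "vec n (b j) - M *\<^sub>v vec n (b j) \<in> carrier_vec n" using M by simp
    have "?A *\<^sub>v vec n (b j) = vec n (b j) - M *\<^sub>v vec n (b j)" by (rule one_minus_mult_vec[OF M]) simp
    also have "\<dots> = vec n (phi (b j))" using M by (intro eq_vecI) (auto simp: phi_def op_of_def to_fun_def)
    also have "\<dots> = unit_vec n j" unfolding b(2) by (rule vec_to_fun) simp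
    finally show ?thesis .
  qed
  have AB: "?A * B = 1\<^sub>m n"
  proof (rule eq_matI)
    fix i j assume ij: "i < dim_row (1\<^sub>m n :: 'a mat)" "j < dim_col (1\<^sub>m n :: 'a mat)"
    have "(?A * B) $$ (i, j) = (?A *\<^sub>v col B j) $ i" using A B ij M by simp
    also have "\<dots> = 1\<^sub>m n $$ (i, j)" using ij by (simp add: colB Ab unit_vec_def)
    finally show "(?A * B) $$ (i, j) = 1\<^sub>m n $$ (i, j)" .
  qed (use A B M in auto)
  have inj: "u = w" if u: "u \<in> carrier_vec n" and w: "w \<in> carrier_vec n" and e: "?A *\<^sub>v u = ?A *\<^sub>v w"
    for u w :: "'a vec"
  proof -
    have uw: "u - w \<in> carrier_vec n" using u w by simp
    have "?A *\<^sub>v (u - w) = 0\<^sub>v n" using e A u w by (subst mult_minus_distrib_mat_vec[OF A u w]) simp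
    then have 0: "(u - w) - M *\<^sub>v (u - w) = 0\<^sub>v n" using one_minus_mult_vec[OF M uw] by simp
    have "M *\<^sub>v (u - w) = u - w"
    proof (rule eq_vecI)
      fix i assume i: "i < dim_vec (u - w)"
      have "((u - w) - M *\<^sub>v (u - w)) $ i = 0" unfolding 0 using i w by simp
      then show "(M *\<^sub>v (u - w)) $ i = (u - w) $ i" using i M u w by simp
    qed (use M w in auto)
    then have "op_of n M (to_fun n (u - w)) = to_fun n (u - w)" using vec_to_fun[OF uw] by (simp add: op_of_def)
    then have "to_fun n (u - w) = 0" by (rule nf[OF to_fun_in])
    then have "vec n (to_fun n (u - w)) = 0\<^sub>v n" by (intro eq_vecI) auto
    then have "u - w = 0\<^sub>v n" using vec_to_fun[OF uw] by simp
    then have "(u - w) $ i = 0" if "i < n" for i using that by simp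
    then show "u = w" using u w by (intro eq_vecI) auto
  qed
  have BA: "B * ?A = 1\<^sub>m n"
  proof (rule eq_matI)
    fix i j assume ij: "i < dim_row (1\<^sub>m n :: 'a mat)" "j < dim_col (1\<^sub>m n :: 'a mat)"
    have Aj: "col ?A j \<in> carrier_vec n" using A ij by simp
    have "?A *\<^sub>v (B *\<^sub>v col ?A j) = (?A * B) *\<^sub>v col ?A j"
      by (rule assoc_mult_mat_vec[OF A B Aj, symmetric])
    also have "\<dots> = col ?A j" unfolding AB using Aj by simp
    also have "\<dots> = ?A *\<^sub>v unit_vec n j"
      using mult_unit_vec[OF A] ij by simp
    finally have e: "?A *\<^sub>v (B *\<^sub>v col ?A j) = ?A *\<^sub>v unit_vec n j" .
    have "B *\<^sub>v col ?A j \<in> carrier_vec n" by (rule mult_mat_vec_carrier[OF B Aj])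
    then have "B *\<^sub>v col ?A j = unit_vec n j" by (rule inj[OF _ unit_vec_carrier e])
    moreover have "(B * ?A) $$ (i, j) = (B *\<^sub>v col ?A j) $ i" using A B ij M by simp
    ultimately show "(B * ?A) $$ (i, j) = 1\<^sub>m n $$ (i, j)" using ij by (auto simp: unit_vec_def)
  qed (use A B M in auto)
  show ?thesis
    unfolding invertible_mat_def inverts_mat_def using M B AB BA
    by (intro conjI exI[of _ B]) (simp_all add: square_mat.simps carrier_matD[OF B] carrier_matD[OF M])
qed

end

section \<open>Triangular matrices attaining the bound\<close>

definition upper_mats :: "nat \<Rightarrow> ('a::division_ring \<Rightarrow> 'a) \<Rightarrow> (nat \<Rightarrow> nat \<Rightarrow> 'a) set" where
  "upper_mats n lam = {A. (\<forall>i j. n \<le> j \<or> j < i \<longrightarrow> A i j = 0) \<and> (\<forall>i. lam (A i i) = 0)}"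

context column_space
begin

abbreviation scm :: "'a \<Rightarrow> (nat \<Rightarrow> nat \<Rightarrow> 'a) \<Rightarrow> nat \<Rightarrow> nat \<Rightarrow> 'a" where
  "scm k A \<equiv> (\<lambda>i j. k * A i j)"

sublocale M: fspace F scm
  by unfold_locales (auto simp: fun_eq_iff algebra_simps)

sublocale MV: fspace2 F scm scv by unfold_locales

text \<open>Projection to \<open>F\<close> along an \<open>F\<close>-complement of \<open>F\<close>
  in \<open>D\<close>.\<close>

lemma normal_form_exists:
  obtains lam where "normal_form lam" "D.vdim {b. lam b = 0} = dg - 1"
proof -
  have Fs: "D.vsub F" by (auto simp: fsub_def)
  obtain H where H: "D.vsub H" "H \<subseteq> UNIV" "F \<inter> H = {0}" "\<And>w. w \<in> UNIV \<Longrightarrow> \<exists>u\<in>F. \<exists>v\<in>H. w = u + v"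
    using D.complement[OF D.sub_UNIV fin_F Fs subset_UNIV] by metis
  have "1 \<notin> H"
  proof
    assume "1 \<in> H"
    then have "1 \<in> F \<inter> H" by simp
    then show False unfolding H(3) by simp
  qed
  moreover have "\<exists>f\<in>F. b - f \<in> H" for b
  proof -
    obtain u v where "u \<in> F" "v \<in> H" "b = u + v" using H(4)[of b] by auto
    then show ?thesis by (intro bexI[of _ u]) simp_all
  qed
  ultimately obtain lam where lam: "normal_form lam" "\<forall>b. lam b = 0 \<longleftrightarrow> b \<in> H"
    by (rule form_exists[OF H(1)])
  have l: "flin F (*) (*) UNIV lam" by (rule flinI) (simp_all add: nf_add[OF lam(1)] nf_mult[OF lam(1)])
  have "range lam = F"
  proof
    show "range lam \<subseteq> F" using nf_F[OF lam(1)] by auto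
    show "F \<subseteq> range lam"
    proof
      fix f assume "f \<in> F"
      then have "f = lam f" using nf_mult[OF lam(1), of f 1] nf_1[OF lam(1)] by simp
      then show "f \<in> range lam" by (rule range_eqI)
    qed
  qed
  moreover have "{k * 1 |k. k \<in> F} = F" by auto
  then have "D.vdim F = 1" using D.dim_line[of 1] by simp
  ultimately have "1 + D.vdim {b. lam b = 0} = dg"
    using D.self.rank_nullity(2)[OF D.sub_UNIV l fin_F] by simp
  then show ?thesis using that[OF lam(1)] by simp
qed

context
  fixes lam :: "'a \<Rightarrow> 'a"
  assumes lam: "normal_form lam" and dlam: "D.vdim {b. lam b = 0} = dg - 1"
begin

lemma upper_sub: "M.vsub (upper_mats n lam)"
  by (rule fsubI) (auto simp: upper_mats_def nf_0[OF lam] nf_add[OF lam] nf_mult[OF lam])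

lemma upper_0: "upper_mats 0 lam = {0}"
  by (auto simp: upper_mats_def fun_eq_iff nf_0[OF lam])

text \<open>As the entries are extended by 0, the smaller triangular space is literally the part of
  the larger one with vanishing last column, so dimensions can be counted column by column.\<close>

lemma upper_ker: "{A \<in> upper_mats (Suc n) lam. (\<lambda>i. A i n) = 0} = upper_mats n lam"
proof
  show "upper_mats n lam \<subseteq> {A \<in> upper_mats (Suc n) lam. (\<lambda>i. A i n) = 0}"
    by (auto simp: upper_mats_def fun_eq_iff)
  show "{A \<in> upper_mats (Suc n) lam. (\<lambda>i. A i n) = 0} \<subseteq> upper_mats n lam"
  proof
    fix A assume "A \<in> {A \<in> upper_mats (Suc n) lam. (\<lambda>i. A i n) = 0}"
    then have A: "A \<in> upper_mats (Suc n) lam" and 0: "A i n = 0" for i by (auto simp: fun_eq_iff)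
    show "A \<in> upper_mats n lam"
      unfolding upper_mats_def
    proof (intro CollectI conjI allI impI)
      show "lam (A i i) = 0" for i using A by (simp add: upper_mats_def)
      show "A i j = 0" if "n \<le> j \<or> j < i" for i j
        using A 0[of i] that by (cases "j = n") (auto simp: upper_mats_def)
    qed
  qed
qed

lemma upper_image:
  "(\<lambda>A i. A i n) ` upper_mats (Suc n) lam = {v \<in> fvec (Suc n). lam (v n) = 0}" (is "_ = ?C")
proof
  show "(\<lambda>A i. A i n) ` upper_mats (Suc n) lam \<subseteq> ?C"
    by (auto simp: upper_mats_def fvec_def)
  show "?C \<subseteq> (\<lambda>A i. A i n) ` upper_mats (Suc n) lam"
  proof
    fix v assume v: "v \<in> ?C"
    let ?A = "\<lambda>i j. if j = n then v i else 0"
    have "?A \<in> upper_mats (Suc n) lam" using v nf_0[OF lam] by (auto simp: upper_mats_def fvec_def)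
    then show "v \<in> (\<lambda>A i. A i n) ` upper_mats (Suc n) lam"
      by (intro image_eqI[of _ _ ?A]) simp_all
  qed
qed

text \<open>The last column is free above the diagonal and constrained by \<open>lam\<close> on it:
  \<open>n * dg\<close> plus \<open>dg - 1\<close> dimensions.\<close>

lemma column_dim: "V.vsub {v \<in> fvec (Suc n). lam (v n) = 0}" "V.vfin {v \<in> fvec (Suc n). lam (v n) = 0}"
  "V.vdim {v \<in> fvec (Suc n). lam (v n) = 0} = Suc n * dg - 1"
proof -
  let ?C = "{v \<in> fvec (Suc n). lam (v n) = 0}"
  have fs: "V.vsub (fvec (Suc n))" by (rule dsub_sub[OF dsub_fvec])
  have H: "D.vsub {b. lam b = 0}"
    by (rule fsubI) (simp_all add: nf_0[OF lam] nf_add[OF lam] nf_mult[OF lam])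
  have e: "?C = {v \<in> fvec (Suc n). v n \<in> {b. lam b = 0}}" by simp
  show s: "V.vsub ?C" unfolding e by (rule VD.sub_vimage[OF fs flin_coord H])
  show f: "V.vfin ?C" by (rule V.fin_subset(1)[OF fs s]) (use fvec_dim in auto)
  have "(\<lambda>v. v n) ` ?C = {b. lam b = 0}"
  proof
    show "{b. lam b = 0} \<subseteq> (\<lambda>v. v n) ` ?C"
    proof
      fix b assume "b \<in> {b. lam b = 0}"
      then have "(\<lambda>i. if i = n then b else 0) \<in> ?C" by (simp add: fvec_def)
      then show "b \<in> (\<lambda>v. v n) ` ?C" by (rule rev_image_eqI) simp
    qed
  qed auto
  moreover have "{v \<in> ?C. v n = 0} = {v \<in> fvec (Suc n). v n = 0}" using nf_0[OF lam] by auto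
  then have "{v \<in> ?C. v n = 0} = fvec n" by (simp only: fvec_ker)
  ultimately have "dg - 1 + n * dg = V.vdim ?C"
    using VD.rank_nullity(2)[OF s flin_coord[of _ n] f] dlam conjunct2[OF fvec_dim[of n]] by (simp only:)
  then show "V.vdim ?C = Suc n * dg - 1" using dg_pos by simp
qed

lemma upper_dim: "M.vfin (upper_mats n lam) \<and> M.vdim (upper_mats n lam) = tdim dg n"
proof (induction n)
  case 0
  then show ?case unfolding upper_0 using M.fin_zero M.dim_zero by simp
next
  case (Suc n)
  have l: "flin F scm scv (upper_mats (Suc n) lam) (\<lambda>A i. A i n)"
    by (rule flinI, simp add: fun_eq_iff, rule ext, unfold frs_def, rule F_comm)
  have f: "M.vfin (upper_mats (Suc n) lam)"
    by (rule MV.fin_extension[OF upper_sub l]) (use Suc column_dim(2) in \<open>simp_all only: upper_ker upper_image\<close>)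
  then show ?case
    using MV.rank_nullity(2)[OF upper_sub l f] Suc unfolding upper_ker upper_image column_dim(3) by simp
qed

text \<open>At the last nonzero coordinate \<open>k\<close> of a fixed vector, row \<open>k\<close>
  reads \<open>A k k * v k = v k\<close>, so \<open>A k k = 1\<close>, where \<open>lam\<close> does
  not vanish.\<close>

lemma upper_no_fixed:
  assumes A: "A \<in> upper_mats n lam" and v: "v \<in> fvec n" "op_of n (mat n n (\<lambda>(i, j). A i j)) v = v"
  shows "v = 0"
proof (rule ccontr)
  assume "v \<noteq> 0"
  then obtain i0 where i0: "v i0 \<noteq> 0" by (auto simp: fun_eq_iff)
  have bound: "i < n" if "v i \<noteq> 0" for i using v(1) that by (auto simp: fvec_def not_less[symmetric])
  define k where "k = (GREATEST i. v i \<noteq> 0)"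
  have k: "v k \<noteq> 0" unfolding k_def by (rule GreatestI_nat[of "\<lambda>i. v i \<noteq> 0" i0 n]) (use i0 bound less_imp_le in auto)
  have kmax: "v j = 0" if "k < j" for j
  proof (rule ccontr)
    assume "v j \<noteq> 0"
    then have "j \<le> k" unfolding k_def by (rule Greatest_le_nat[of "\<lambda>i. v i \<noteq> 0" j n]) (use bound less_imp_le in auto)
    then show False using that by simp
  qed
  have kn: "k < n" by (rule bound[OF k])
  have "v k = op_of n (mat n n (\<lambda>(i, j). A i j)) v k" using v(2) by simp
  also have "\<dots> = (\<Sum>j\<in>{0..<n}. A k j * v j)" using kn by (simp add: op_of_def to_fun_def scalar_prod_def)
  also have "\<dots> = (\<Sum>j\<in>{k}. A k j * v j)"
  proof (rule sum.mono_neutral_right)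
    show "\<forall>j\<in>{0..<n} - {k}. A k j * v j = 0"
    proof
      fix j assume "j \<in> {0..<n} - {k}"
      then consider "j < k" | "k < j" by fastforce
      then show "A k j * v j = 0" using A kmax by cases (auto simp: upper_mats_def)
    qed
  qed (use kn in auto)
  finally have "(A k k - 1) * v k = 0" by (simp add: left_diff_distrib)
  then have "A k k = 1" using k by simp
  moreover have "lam (A k k) = 0" using A by (simp add: upper_mats_def)
  ultimately show False using nf_1[OF lam] by simp
qed

lemma large_trivial_spectrum_subspace:
  assumes vs: "vectorspace (subfield_ring F) (module_mat TYPE('a) n n)"
  shows "\<exists>T. trivial_spectrum_subspace F n T \<and> mat_dim F n T = tdim dg n"
proof -
  let ?mk = "\<lambda>A. mat n n (\<lambda>(i, j). A i j) :: 'a mat"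
  let ?T = "?mk ` upper_mats n lam"
  interpret W: vectorspace "subfield_ring F" "module_mat TYPE('a) n n" by (rule vs)
  have cF: "carrier (subfield_ring F) = F" by (simp add: subfield_ring_def)
  have "submodule (subfield_ring F) ?T (module_mat TYPE('a) n n)"
  proof (rule submodule.intro)
    show "Module.module (subfield_ring F) (module_mat TYPE('a) n n)" by (rule W.module_axioms)
    show "?T \<subseteq> carrier (module_mat TYPE('a) n n)" by (auto simp: module_mat_simps)
    show "u \<oplus>\<^bsub>module_mat TYPE('a) n n\<^esub> w \<in> ?T" if "u \<in> ?T" "w \<in> ?T" for u w
    proof -
      obtain A B where *: "A \<in> upper_mats n lam" "B \<in> upper_mats n lam" "u = ?mk A" "w = ?mk B" using \<open>u \<in> ?T\<close> \<open>w \<in> ?T\<close> by auto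
      have "u \<oplus>\<^bsub>module_mat TYPE('a) n n\<^esub> w = ?mk (A + B)" unfolding * by (intro eq_matI) (auto simp: module_mat_simps)
      then show ?thesis using fsub_add[OF upper_sub *(1,2)] by (rule image_eqI)
    qed
    have "\<zero>\<^bsub>module_mat TYPE('a) n n\<^esub> = ?mk 0" by (intro eq_matI) (auto simp: module_mat_simps)
    then show "\<zero>\<^bsub>module_mat TYPE('a) n n\<^esub> \<in> ?T" using fsub_0[OF upper_sub, of n] by (rule image_eqI)
    show "k \<odot>\<^bsub>module_mat TYPE('a) n n\<^esub> u \<in> ?T" if "k \<in> carrier (subfield_ring F)" "u \<in> ?T" for k u
    proof -
      obtain A where *: "A \<in> upper_mats n lam" "u = ?mk A" using \<open>u \<in> ?T\<close> by auto
      have k: "k \<in> F" using that(1) cF by simp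
      have "k \<odot>\<^bsub>module_mat TYPE('a) n n\<^esub> u = ?mk (scm k A)" unfolding * by (intro eq_matI) (auto simp: module_mat_simps)
      then show ?thesis using fsub_sc[OF upper_sub k *(1)] by (rule image_eqI)
    qed
  qed
  then have sub: "VectorSpace.subspace (subfield_ring F) ?T (module_mat TYPE('a) n n)"
    using vs by (simp add: VectorSpace.subspace_def)
  have "invertible_mat (1\<^sub>m n - M)" if "M \<in> ?T" for M
  proof -
    obtain A where A: "A \<in> upper_mats n lam" "M = ?mk A" using \<open>M \<in> ?T\<close> by auto
    show ?thesis
    proof (rule invertible_if_no_fixed_vector)
      show "M \<in> carrier_mat n n" using A by simp
      show "v = 0" if "v \<in> fvec n" "op_of n M v = v" for v
        using upper_no_fixed[OF A(1)] that A(2) by simp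
    qed
  qed
  then have ts: "trivial_spectrum_subspace F n ?T"
    using sub by (simp add: trivial_spectrum_subspace_def mat_subspace_def)
  \<comment> \<open>Inverse to the passage from functions to matrices on \<open>upper_mats\<close>,
    so that the dimension found there carries over to \<open>?T\<close>.\<close>
  define g where "g M = (\<lambda>i j. if i < n \<and> j < n then M $$ (i, j) else 0)" for M :: "'a mat"
  let ?R = "(module_mat TYPE('a) n n)\<lparr>carrier := ?T\<rparr>"
  have gmk: "g (?mk A) = A" if "A \<in> upper_mats n lam" for A
  proof (intro ext)
    fix i j
    have "A i j = 0" if "\<not> (i < n \<and> j < n)"
    proof -
      have "n \<le> j \<or> j < i" using that by auto
      then show ?thesis using \<open>A \<in> upper_mats n lam\<close> unfolding upper_mats_def by blast
    qed
    then show "g (?mk A) i j = A i j" by (auto simp: g_def)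
  qed
  have im: "g ` carrier ?R = upper_mats n lam" using gmk by (auto simp: image_image)
  have "vectorspace.dim (subfield_ring F) ?R = M.vdim (g ` carrier ?R)"
  proof (rule M.transfer(3))
    show "vectorspace (subfield_ring F) ?R" by (rule W.subspace_is_vs[OF sub])
    show "inj_on g (carrier ?R)" by (rule inj_on_inverseI[of _ ?mk]) (use gmk in auto)
    show "g (x \<oplus>\<^bsub>?R\<^esub> y) = g x + g y" if "x \<in> carrier ?R" "y \<in> carrier ?R" for x y
      using that by (auto simp: g_def fun_eq_iff module_mat_simps)
    show "g (k \<odot>\<^bsub>?R\<^esub> x) = scm k (g x)" if "k \<in> F" "x \<in> carrier ?R" for k x
      using that by (auto simp: g_def fun_eq_iff module_mat_simps)
    show "M.vfin (g ` carrier ?R)" unfolding im using upper_dim by simp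
  qed
  then have "mat_dim F n ?T = tdim dg n" unfolding mat_dim_def im using upper_dim by simp
  then show ?thesis using ts by blast
qed

end

section \<open>Trivial spectrum spaces of matrices as operator spaces\<close>

lemma tss_of_trivial_spectrum:
  assumes S: "trivial_spectrum_subspace F n S"
  shows "tss (fvec n) (op_of n ` S)" "O.vdim (op_of n ` S) = mat_dim F n S"
proof -
  have sub: "VectorSpace.subspace (subfield_ring F) S (module_mat TYPE('a) n n)"
    using S by (simp add: trivial_spectrum_subspace_def mat_subspace_def)
  then have vs: "vectorspace (subfield_ring F) (module_mat TYPE('a) n n)"
    and sm: "submodule (subfield_ring F) S (module_mat TYPE('a) n n)"
    by (simp_all add: VectorSpace.subspace_def)
  interpret W: vectorspace "subfield_ring F" "module_mat TYPE('a) n n" by (rule vs)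
  have c: "M \<in> carrier_mat n n" if "M \<in> S" for M
    using submodule.subset[OF sm] that by (auto simp: module_mat_simps)
  let ?R = "(module_mat TYPE('a) n n)\<lparr>carrier := S\<rparr>"
  have vR: "vectorspace (subfield_ring F) ?R" by (rule W.subspace_is_vs[OF sub])
  have zero: "M = 0\<^sub>m n n" if "M \<in> S" "\<And>v. v \<in> fvec n \<Longrightarrow> op_of n M v = 0" for M
    by (rule op_of_eq_0[OF c[OF that(1)] that(2)])
  have add: "op_of n (x \<oplus>\<^bsub>?R\<^esub> y) = op_of n x + op_of n y" if "x \<in> carrier ?R" "y \<in> carrier ?R" for x y
    using op_of_add[OF c c, of x y] that by (simp add: module_mat_simps)
  have smult: "op_of n (k \<odot>\<^bsub>?R\<^esub> x) = sco k (op_of n x)" if "k \<in> F" "x \<in> carrier ?R" for k x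
    using op_of_smult[OF that(1) c, of x] that by (simp add: module_mat_simps)
  have inj: "inj_on (op_of n) (carrier ?R)"
  proof (rule inj_onI)
    fix A B assume AB: "A \<in> carrier ?R" "B \<in> carrier ?R" and e: "op_of n A = op_of n B"
    have m: "- 1 \<in> F" by auto
    have Bc: "(- 1) \<cdot>\<^sub>m B \<in> carrier_mat n n" using c AB by simp
    have "op_of n (A + (- 1) \<cdot>\<^sub>m B) = op_of n A + sco (- 1) (op_of n B)"
      using op_of_add[OF c Bc, of A] op_of_smult[OF m c, of B] AB by simp
    also have "\<dots> = 0" unfolding e by (auto simp: fun_eq_iff frs_def)
    finally have "A + (- 1) \<cdot>\<^sub>m B = 0\<^sub>m n n"
      using op_of_eq_0[of "A + (- 1) \<cdot>\<^sub>m B" n] c AB by simp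
    then have 0: "(A + (- 1) \<cdot>\<^sub>m B) $$ (i, j) = 0" if "i < n" "j < n" for i j using that by simp
    have Ac: "A \<in> carrier_mat n n" and Bc: "B \<in> carrier_mat n n" using c AB by simp_all
    show "A = B"
    proof (rule eq_matI)
      fix i j assume "i < dim_row B" "j < dim_col B"
      then show "A $$ (i, j) = B $$ (i, j)" using 0[of i j] Ac Bc by simp
    qed (use Ac Bc in simp_all)
  qed
  note t = O.transfer[OF vR inj add smult, simplified]
  show tss: "tss (fvec n) (op_of n ` S)"
    unfolding tss_def
  proof (intro conjI ballI impI)
    show "O.vsub (op_of n ` S)" by (rule t(1))
    fix N assume "N \<in> op_of n ` S"
    then obtain M where M: "M \<in> S" "N = op_of n M" by (rule imageE)
    show "dlin (fvec n) N" unfolding M(2) by (rule op_of_dlin[OF c[OF M(1)]])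
    have i: "invertible_mat (1\<^sub>m n - M)" using S M(1) by (simp add: trivial_spectrum_subspace_def)
    show "v = 0" if "v \<in> fvec n" "N v = v" for v
      using no_fixed_vector[OF c[OF M(1)] i that(1)] that(2) M(2) by simp
    assume "\<forall>v\<in>fvec n. N v = 0"
    then have "M = 0\<^sub>m n n" using M by (intro zero) auto
    then show "N = 0" unfolding M(2) by (auto simp: fun_eq_iff op_of_def to_fun_def)
  qed
  have "O.vfin (op_of n ` S)" by (rule fin_ops[OF dsub_fvec _ tss]) (use fvec_dim in simp)
  then show "O.vdim (op_of n ` S) = mat_dim F n S" using t(3) by (simp add: mat_dim_def)
qed

end

theorem corollary1p11:
  fixes F :: "'a::division_ring set" and n d :: nat
  assumes "central_subfield F"
    and "finite_degree F" and "degree_over F = d"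
    and "n \<ge> 1"
    and "infinite F \<or> card F \<ge> n * d"
    and "\<not> quadratic_type F"
    and "\<exists>S. optimal_trivial_spectrum_subspace F n S \<and> irreducible_mats n S"
  shows "n = 1"
proof -
  have c: "central F" using assms(1) by (rule central.intro)
  have fin: "ffin F (*) (UNIV :: 'a set)" using central.degree_over_eq(1)[OF c] assms(2) by simp
  interpret column_space F by (rule column_space.intro[OF c column_space_axioms.intro[OF fin]])
  have dg: "dg = d" using degree_over_eq(2)[OF assms(2)] assms(3) by simp
  have nq: "\<not> all_quadratic"
  proof
    assume aq: all_quadratic
    have q: "qdiv F" by (rule qdiv.intro[OF c qdiv_axioms.intro[OF fin aq]])
    show False using qdiv.quadratic_type[OF q degree_over_eq(2)[OF assms(2)]] assms(6) by contradiction
  qed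
  \<comment> \<open>Degree 1 is of quadratic type; excluding it supplies \<open>2 \<le> dg\<close>,
    on which the equality case rests.\<close>
  have "d \<noteq> 1" using assms(3,6) by (auto simp: quadratic_type_def)
  then have dg2: "2 \<le> dg" using dg_pos dg by simp
  obtain S where S: "optimal_trivial_spectrum_subspace F n S" "irreducible_mats n S" using assms(7) by blast
  have ts: "trivial_spectrum_subspace F n S" using S(1) by (simp add: optimal_trivial_spectrum_subspace_def)
  have vs: "vectorspace (subfield_ring F) (module_mat TYPE('a) n n)"
    using ts by (simp add: trivial_spectrum_subspace_def mat_subspace_def VectorSpace.subspace_def)
  obtain lam where lam: "normal_form lam" "D.vdim {b. lam b = 0} = dg - 1" by (rule normal_form_exists)
  obtain T where T: "trivial_spectrum_subspace F n T" "mat_dim F n T = tdim dg n"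
    using large_trivial_spectrum_subspace[OF lam vs] by blast
  \<comment> \<open>Comparison with the triangular space shows that an optimal \<open>S\<close>
    reaches the bound.\<close>
  have opt: "tdim dg n \<le> O.vdim (op_of n ` S)"
    using S(1) T unfolding tss_of_trivial_spectrum(2)[OF ts] by (auto simp: optimal_trivial_spectrum_subspace_def)
  obtain m where m: "n = Suc m" using assms(4) by (cases n) simp_all
  have card: "infinite F \<or> Suc m * dg \<le> card F" using assms(5) m dg by simp
  obtain C where C: "dsub C" "C \<subseteq> fvec n" "V.vdim C = m * dg" "\<forall>M\<in>op_of n ` S. \<forall>v\<in>C. M v \<in> C"
    using invariant_hyperplane[OF nq dg2 dsub_fvec _ _ tss_of_trivial_spectrum(1)[OF ts[unfolded m]] card opt[unfolded m]]
      fvec_dim[of "Suc m"] unfolding m[symmetric] by blast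
  let ?W = "vec n ` C"
  have "right_subspace n ?W"
    unfolding right_subspace_def
  proof (intro conjI ballI allI)
    show "?W \<subseteq> carrier_vec n" by auto
    have "0\<^sub>v n = vec n (0 :: nat \<Rightarrow> 'a)" by (intro eq_vecI) auto
    then show "0\<^sub>v n \<in> ?W" using dsub_0[OF C(1)] by (rule image_eqI)
    show "u + w \<in> ?W" if "u \<in> ?W" "w \<in> ?W" for u w
    proof -
      obtain v v' where "v \<in> C" "v' \<in> C" "u = vec n v" "w = vec n v'" using \<open>u \<in> ?W\<close> \<open>w \<in> ?W\<close> by auto
      then show ?thesis using dsub_add[OF C(1), of v v'] by (auto simp: vec_add[symmetric])
    qed
    show "map_vec (\<lambda>x. x * a) w \<in> ?W" if "w \<in> ?W" for w a
    proof -
      obtain v where v: "v \<in> C" "w = vec n v" using \<open>w \<in> ?W\<close> by auto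
      have "map_vec (\<lambda>x. x * a) w = vec n (frs v a)" unfolding v(2) by (intro eq_vecI) (auto simp: frs_def)
      then show ?thesis using dsub_rs[OF C(1) v(1), of a] by (rule image_eqI)
    qed
  qed
  moreover have "M *\<^sub>v w \<in> ?W" if M: "M \<in> S" and w: "w \<in> ?W" for M w
  proof -
    have "VectorSpace.subspace (subfield_ring F) S (module_mat TYPE('a) n n)"
      using ts by (simp add: trivial_spectrum_subspace_def mat_subspace_def)
    then have Mc: "M \<in> carrier_mat n n"
      using M submodule.subset[of "subfield_ring F" S "module_mat TYPE('a) n n"]
      by (auto simp: VectorSpace.subspace_def module_mat_simps)
    obtain v where v: "v \<in> C" "w = vec n v" using w by auto
    have "M *\<^sub>v w = vec n (op_of n M v)" unfolding op_of_def v(2) by (rule vec_to_fun[symmetric]) (use Mc in simp)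
    then show ?thesis using C(4) M v(1) by auto
  qed
  ultimately have W: "?W = {0\<^sub>v n} \<or> ?W = carrier_vec n"
    using S(2) by (simp add: irreducible_mats_def)
  have tf: "to_fun n (vec n v) = v" if "v \<in> C" for v using to_fun_vec C(2) that by auto
  \<comment> \<open>The invariant subspace has dimension \<open>m * dg\<close>, which is 0 only for
    \<open>m = 0\<close> and never equals \<open>n * dg\<close>.\<close>
  from W show "n = 1"
  proof
    assume W0: "?W = {0\<^sub>v n}"
    have "v = 0" if "v \<in> C" for v
    proof -
      have "vec n v = 0\<^sub>v n" using W0 that by auto
      then have "v = to_fun n (0\<^sub>v n)" using tf[OF that] by simp
      then show ?thesis by (auto simp: to_fun_def fun_eq_iff)
    qed
    then have "C = {0}" using dsub_0[OF C(1)] by auto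
    then have "m * dg = 0" using C(3) V.dim_zero by simp
    then show ?thesis using m dg2 by simp
  next
    assume W1: "?W = carrier_vec n"
    have "fvec n \<subseteq> C"
    proof
      fix v :: "nat \<Rightarrow> 'a" assume v: "v \<in> fvec n"
      have "vec n v \<in> ?W" unfolding W1 by simp
      then obtain u where u: "vec n v = vec n u" "u \<in> C" by (rule imageE)
      have "v = to_fun n (vec n v)" by (rule to_fun_vec[OF v, symmetric])
      also have "\<dots> = u" unfolding u(1) by (rule tf[OF u(2)])
      finally have "v = u" .
      with u(2) show "v \<in> C" by simp
    qed
    then have Cv: "C = fvec n" using C(2) by simp
    have "n * dg = m * dg" using C(3) fvec_dim[of n] unfolding Cv by simp
    then show ?thesis using m dg2 by simp
  qed
qed

end
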